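(* Let $G$ be a connected directed graph on the $n+1$ vertices $[n+1]$ with $m$ edges and with shifted in-degree vector $\mathbf{u}=(u_1,\ldots,u_n)$. The function $E_G(x)=\operatorname{vol}\mathcal{F}_{\widehat{G}(x)}(1,0,\ldots,0)$, defined for nonnegative integers $x$, is the Kostant partition function $$E_G(x)=K_G\Bigl(x+u_1,\,x+u_2,\ldots,x+u_n,\,-xn-\sum_{k=1}^nu_k\Bigr),$$ which is a polynomial in $x$ of degree $m-n$ with nonnegative coefficients and whose leading coefficient equals $$\frac{1}{(m-n)!}\operatorname{vol}\mathcal{F}_G(1,1,\ldots,1).$$
   Context: Directed graphs may have multiple edges; every edge is directed from a smaller vertex to a larger vertex. For $G$ on $[n+1]=\{1,\ldots,n+1\}$, $u_i=(\text{in-degree of }i)-1$ for $1\le i\le n$. For a nonnegative integer $x$, $\widehat{G}(x)$ is the directed graph obtained from $G$ by adding a vertex $0$ and, for each $i=1,\ldots,n$, $x$ parallel edges $(0,i)$. Flow polytope: for a directed graph $H$ with ordered vertices $v_0<v_1<\cdots<v_N$ and $M$ edges and $\mathbf{a}\in\mathbb{Z}^N$, $\mathcal{F}_H(\mathbf{a})\subset\mathbb{R}^M$ is the set of tuples $(b_e)_{e\in E(H)}$ of nonnegative reals such that for every vertex except the last, (sum of $b_e$ over edges leaving it) minus (sum of $b_e$ over edges entering it) equals the corresponding entry of $\mathbf{a}$. When $H$ is connected it lies in an affine subspace of dimension $M-N$, and $\operatorname{vol}$ is normalized volume: $(M-N)!$ times the $(M-N)$-dimensional volume, normalized so that a fundamental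 cell of the lattice of integer points of the linear subspace parallel to this affine subspace has volume $1$; an empty polytope has volume $0$. In $\mathcal{F}_{\widehat G(x)}(1,0,\ldots,0)$ the net flow is $1$ at vertex $0$ and $0$ at vertices $1,\ldots,n$. Kostant partition function: for $\mathbf{v}\in\mathbb{Z}^{n+1}$ with entry sum $0$, $K_G(\mathbf{v})$ is the number of nonnegative integer tuples $(b_e)_{e\in E(G)}$ with $\sum_{e=(i,j)}b_e(\mathbf{e}_i-\mathbf{e}_j)=\mathbf{v}$, where $\mathbf{e}_i$ are the standard basis vectors.
   Formalization: Since the claim fails otherwise, n ≥ 1 is assumed, E_G is shown to agree with the polynomial at x = 0 only when m > n (at all x ≥ 1 always), and degree exactly m−n is asserted only if every vertex 1,…,n has an outgoing edge (otherwise degree at most m−n). *)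

theory Defs
  imports
    "HOL-Analysis.Analysis"
    "HOL-Computational_Algebra.Polynomial"
    "Graph_Theory.Digraph_Component"
begin

text \<open>
  A directed multigraph is a \<^type>\<open>pre_digraph\<close>; the vertex type is linearly ordered. A vector
  indexed by the edges of \<open>H\<close> is a function on the arc type that vanishes outside \<open>arcs H\<close>.
\<close>

definition shifted_indegree :: "('a, 'e) pre_digraph \<Rightarrow> 'a \<Rightarrow> int" where
  "shifted_indegree G i = int (in_degree G i) - 1"

definition add_source :: "nat \<Rightarrow> nat \<Rightarrow> (nat, 'e) pre_digraph \<Rightarrow> (nat, 'e + nat \<times> nat) pre_digraph" where
  "add_source n x G =
     \<lparr> verts = insert 0 (verts G),
       arcs = arcs G <+> ({1..n} \<times> {..<x}),
       tail = case_sum (tail G) (\<lambda>_. 0),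
       head = case_sum (head G) fst \<rparr>"

subsection \<open>Flow polytopes\<close>

definition net_flow :: "('a, 'e) pre_digraph \<Rightarrow> ('e \<Rightarrow> real) \<Rightarrow> 'a \<Rightarrow> real" where
  "net_flow H b v = (\<Sum>e\<in>out_arcs H v. b e) - (\<Sum>e\<in>in_arcs H v. b e)"

definition flow_space :: "('a::linorder, 'e) pre_digraph \<Rightarrow> ('a \<Rightarrow> int) \<Rightarrow> ('e \<Rightarrow> real) set" where
  "flow_space H a =
     {b. (\<forall>e. e \<notin> arcs H \<longrightarrow> b e = 0) \<and>
         (\<forall>v \<in> verts H - {Max (verts H)}. net_flow H b v = of_int (a v))}"

definition flow_polytope :: "('a::linorder, 'e) pre_digraph \<Rightarrow> ('a \<Rightarrow> int) \<Rightarrow> ('e \<Rightarrow> real) set" where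
  "flow_polytope H a = {b \<in> flow_space H a. \<forall>e\<in>arcs H. 0 \<le> b e}"

subsection \<open>Normalized volume\<close>

definition lincomb :: "('e \<Rightarrow> real) list \<Rightarrow> (nat \<Rightarrow> real) \<Rightarrow> 'e \<Rightarrow> real" where
  "lincomb B c = (\<lambda>e. \<Sum>i<length B. c i * (B ! i) e)"

definition direction :: "('e \<Rightarrow> real) set \<Rightarrow> ('e \<Rightarrow> real) set" where
  "direction A = {\<lambda>e. y e - z e | y z. y \<in> A \<and> z \<in> A}"

text \<open>
  \<open>B\<close> is a basis of the real vector space \<open>V\<close> and at the same time a \<open>\<int>\<close>-basis of the lattice of
  integer points of \<open>V\<close>.
\<close>

definition lattice_basis :: "('e \<Rightarrow> real) set \<Rightarrow> ('e \<Rightarrow> real) list \<Rightarrow> bool" where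
  "lattice_basis V B \<longleftrightarrow>
     bij_betw (lincomb B) ({..<length B} \<rightarrow>\<^sub>E UNIV) V \<and>
     bij_betw (lincomb B) ({..<length B} \<rightarrow>\<^sub>E \<int>) {v \<in> V. \<forall>e. v e \<in> \<int>}"

text \<open>
  Normalized volume of a subset \<open>P\<close> of an affine space \<open>A\<close> whose direction is a rational subspace:
  \<open>P\<close> is measured by Lebesgue measure in the affine coordinates \<open>c\<close> given by a base point of \<open>A\<close>
  and a lattice basis, so that a fundamental cell of the lattice has measure 1, and multiplied by
  \<open>d!\<close> with \<open>d = length B\<close> the dimension of \<open>A\<close>. Lattice bases differ by unimodular matrices, so the
  choices of \<open>B\<close> and of the base point do not matter. The empty set has volume 0 in any case.
\<close>

definition normalized_volume :: "('e \<Rightarrow> real) set \<Rightarrow> ('e \<Rightarrow> real) set \<Rightarrow> real" where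
  "normalized_volume A P =
     (let B = (SOME B. lattice_basis (direction A) B);
          p = (SOME p. p \<in> A);
          d = length B
      in fact d * measure (\<Pi>\<^sub>M i\<in>{..<d}. lborel)
           {c \<in> {..<d} \<rightarrow>\<^sub>E UNIV. (\<lambda>e. p e + lincomb B c e) \<in> P})"

text \<open>
  For a connected graph with \<open>N + 1\<close> vertices and \<open>M\<close> edges the dimension of the flow space is
  \<open>M - N\<close>. The volume is always taken in this dimension, so it is 0 for a polytope of smaller
  dimension.
\<close>

definition flow_volume :: "('a::linorder, 'e) pre_digraph \<Rightarrow> ('a \<Rightarrow> int) \<Rightarrow> real" where
  "flow_volume H a = normalized_volume (flow_space H a) (flow_polytope H a)"

definition E_poly :: "nat \<Rightarrow> (nat, 'e) pre_digraph \<Rightarrow> nat \<Rightarrow> real" where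
  "E_poly n G x = flow_volume (add_source n x G) (\<lambda>v. if v = 0 then 1 else 0)"

subsection \<open>Kostant partition function\<close>

definition kostant :: "('a, 'e) pre_digraph \<Rightarrow> ('a \<Rightarrow> int) \<Rightarrow> nat" where
  "kostant G v =
     card {b \<in> arcs G \<rightarrow>\<^sub>E (UNIV :: nat set).
             \<forall>k\<in>verts G. (\<Sum>e\<in>arcs G. int (b e) * (of_bool (k = tail G e) - of_bool (k = head G e))) = v k}"

end

(*
  A linear bijection that maps one integer lattice onto another preserves Lebesgue measure, so the
  normalized volume may be computed in any coordinates that are compatible with the lattice. Choose
  one arc out of every vertex except the sink: a flow is determined by its values on the other
  arcs, and these are such coordinates for the flow space.

  In these coordinates the volume of a flow polytope and the number of its integer points are
  evaluated by the same computation, integrating over the arcs out of one vertex at a time, from the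
  last vertex to the first. It uses only that the kernels P k y (namely y^k/k! for volumes and the
  multichoose coefficients for counting) are closed under Dirichlet integration and satisfy the
  binomial convolution identity. The results are Lidskii-type formulas: the volume of F_G(a) is
  (m-n)! times the sum of prod_v a_v^(j_v)/(j_v)!, and K_G(x+u_1,...,x+u_n,...) is the sum of
  prod_v multichoose(x, j_v), over the same finite set of exponent vectors j with sum m-n. The
  second sum is a polynomial in x with nonnegative coefficients, and comparing it with the first one
  for a = (1,...,1) gives the leading coefficient.

  For E_G(x) the volume formula is applied to the reversal of the graph with the added source.
  There only the first vertex, n+1, has a nonzero net flow, so all exponents except its own must
  vanish, and the surviving terms are exactly the integer flows counted by K_G.
*)
theory Submission
  imports Defs
begin

section \<open>Lattice isomorphisms and normalized volume\<close>

text \<open>The shift \<open>eps\<close> explains the shape of the result. Sums of multichoose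
  products over 0, ..., s have a closed form when each part r enters as r + 1, so the counting
  kernel always sees a flow plus one. At a vertex v the kernel supplies one unit, while every arc
  into v claims one; what remains for v is a_v + 1 - indeg(v). For a_v = x + u_v this is exactly x,
  the same variable at every vertex. For volumes the shift is 0 and a_v itself remains.

  In the reversed graph the same numbers reappear as arc counts: vertex i has indeg(i) + x arcs out,
  one of them determined by the others, so x + u_i are free. A vanishing exponent at i then says
  that the exponents on the arcs of G form an integer flow with net flow x + u_i.

  Counting requires a_v >= indeg(v), that is x >= 1, and an arc out of every vertex before the last.
  The value x = 0 and graphs with an earlier sink are settled directly, because then there is no
  flow at all.\<close>

interpretation lborel_product: product_sigma_finite "\<lambda>_::'i. lborel :: real measure" ..

lemma space_lborel_PiM [simp]: "space (\<Pi>\<^sub>M i\<in>I. lborel) = (I \<rightarrow>\<^sub>E (UNIV :: real set))"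
  by (simp add: space_PiM)

section \<open>Invariance of product Lebesgue measure under translations and reflections\<close>

lemma measurable_lborel_PiM_coordinatewise:
  fixes g :: "'i \<Rightarrow> real \<Rightarrow> real"
  assumes g: "\<And>i. i \<in> I \<Longrightarrow> g i \<in> borel_measurable borel"
  shows "(\<lambda>x. \<lambda>i\<in>I. g i (x i)) \<in> measurable (\<Pi>\<^sub>M i\<in>I. lborel) (\<Pi>\<^sub>M i\<in>I. lborel)"
proof (rule measurable_restrict)
  fix i assume i: "i \<in> I"
  have "(\<lambda>x. g i (x i)) \<in> borel_measurable (\<Pi>\<^sub>M i\<in>I. lborel)"
    by (rule measurable_compose[OF measurable_component_singleton[OF i]]) (use g[OF i] in simp)
  then show "(\<lambda>x. g i (x i)) \<in> (\<Pi>\<^sub>M i\<in>I. lborel) \<rightarrow>\<^sub>M lborel" by simp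
qed

lemma distr_lborel_PiM_coordinatewise:
  fixes g :: "'i \<Rightarrow> real \<Rightarrow> real"
  assumes "finite I" and g: "\<And>i. i \<in> I \<Longrightarrow> g i \<in> borel_measurable borel"
    and inv: "\<And>i. i \<in> I \<Longrightarrow> distr lborel borel (g i) = lborel"
  shows "distr (\<Pi>\<^sub>M i\<in>I. lborel) (\<Pi>\<^sub>M i\<in>I. lborel) (\<lambda>x. \<lambda>i\<in>I. g i (x i)) = (\<Pi>\<^sub>M i\<in>I. lborel)"
proof (rule lborel_product.PiM_eqI[OF \<open>finite I\<close>])
  note [measurable] = measurable_lborel_PiM_coordinatewise[OF g]
  fix A :: "'i \<Rightarrow> real set" assume A: "\<And>i. i \<in> I \<Longrightarrow> A i \<in> sets lborel"
  have eq: "(\<lambda>x. \<lambda>i\<in>I. g i (x i)) -` Pi\<^sub>E I A \<inter> space (\<Pi>\<^sub>M i\<in>I. lborel) = Pi\<^sub>E I (\<lambda>i. g i -` A i)"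
    by (auto simp: PiE_iff)
  have "emeasure (distr (\<Pi>\<^sub>M i\<in>I. lborel) (\<Pi>\<^sub>M i\<in>I. lborel) (\<lambda>x. \<lambda>i\<in>I. g i (x i))) (Pi\<^sub>E I A)
      = emeasure (\<Pi>\<^sub>M i\<in>I. lborel) (Pi\<^sub>E I (\<lambda>i. g i -` A i))"
    using A \<open>finite I\<close> by (subst emeasure_distr, simp, intro sets_PiM_I_finite) (use eq in auto)
  also have "\<dots> = (\<Prod>i\<in>I. emeasure lborel (g i -` A i))"
    using A g by (intro lborel_product.emeasure_PiM[OF \<open>finite I\<close>]) (auto intro: measurable_sets_borel)
  also have "\<dots> = (\<Prod>i\<in>I. emeasure lborel (A i))"
  proof (rule prod.cong[OF refl])
    fix i assume i: "i \<in> I"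
    have "emeasure lborel (A i) = emeasure (distr lborel borel (g i)) (A i)"
      using inv[OF i] by simp
    also have "\<dots> = emeasure lborel (g i -` A i)"
      using A[OF i] g[OF i] by (subst emeasure_distr) auto
    finally show "emeasure lborel (g i -` A i) = emeasure lborel (A i)" ..
  qed
  finally show "emeasure (distr (\<Pi>\<^sub>M i\<in>I. lborel) (\<Pi>\<^sub>M i\<in>I. lborel) (\<lambda>x. \<lambda>i\<in>I. g i (x i))) (Pi\<^sub>E I A)
      = (\<Prod>i\<in>I. emeasure lborel (A i))" .
qed simp

lemma nn_integral_lborel_PiM_coordinatewise:
  fixes g :: "'i \<Rightarrow> real \<Rightarrow> real"
  assumes "finite I" and g: "\<And>i. i \<in> I \<Longrightarrow> g i \<in> borel_measurable borel"
    and inv: "\<And>i. i \<in> I \<Longrightarrow> distr lborel borel (g i) = lborel"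
    and f: "f \<in> borel_measurable (\<Pi>\<^sub>M i\<in>I. lborel)"
  shows "(\<integral>\<^sup>+x. f (\<lambda>i\<in>I. g i (x i)) \<partial>(\<Pi>\<^sub>M i\<in>I. lborel)) = (\<integral>\<^sup>+x. f x \<partial>(\<Pi>\<^sub>M i\<in>I. lborel))"
proof -
  have "(\<integral>\<^sup>+x. f x \<partial>(\<Pi>\<^sub>M i\<in>I. lborel))
     = (\<integral>\<^sup>+x. f x \<partial>distr (\<Pi>\<^sub>M i\<in>I. lborel) (\<Pi>\<^sub>M i\<in>I. lborel) (\<lambda>x. \<lambda>i\<in>I. g i (x i)))"
    by (simp add: distr_lborel_PiM_coordinatewise[OF assms(1-3)])
  also have "\<dots> = (\<integral>\<^sup>+x. f (\<lambda>i\<in>I. g i (x i)) \<partial>(\<Pi>\<^sub>M i\<in>I. lborel))"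
    by (rule nn_integral_distr[OF measurable_lborel_PiM_coordinatewise[OF g]]) (use f in simp_all)
  finally show ?thesis ..
qed

lemma nn_integral_lborel_PiM_shift:
  assumes "finite I" "f \<in> borel_measurable (\<Pi>\<^sub>M i\<in>I. lborel)"
  shows "(\<integral>\<^sup>+x. f (\<lambda>i\<in>I. z i + x i) \<partial>(\<Pi>\<^sub>M i\<in>I. lborel)) = (\<integral>\<^sup>+x. f x \<partial>(\<Pi>\<^sub>M i\<in>I. lborel :: real measure))"
  using nn_integral_lborel_PiM_coordinatewise[OF assms(1), of "\<lambda>i t. z i + t" f] assms
  by (simp add: lborel_distr_plus)

lemma nn_integral_lborel_PiM_reflect:
  assumes "finite I" "f \<in> borel_measurable (\<Pi>\<^sub>M i\<in>I. lborel)"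
  shows "(\<integral>\<^sup>+x. f (\<lambda>i\<in>I. z i - x i) \<partial>(\<Pi>\<^sub>M i\<in>I. lborel)) = (\<integral>\<^sup>+x. f x \<partial>(\<Pi>\<^sub>M i\<in>I. lborel :: real measure))"
proof -
  have "distr lborel borel (\<lambda>t. z i - t) = (lborel :: real measure)" for i
    using lborel_real_affine[of "-1" "z i"] by (simp add: density_1)
  then show ?thesis
    using nn_integral_lborel_PiM_coordinatewise[OF assms(1), of "\<lambda>i t. z i - t" f] assms by simp
qed

section \<open>Isomorphisms of integer lattices\<close>

lemma nn_integral_count_space_unique:
  assumes "\<exists>!z. z \<in> Z \<and> P z"
  shows "(\<integral>\<^sup>+z. of_bool (P z) \<partial>count_space Z) = (1::ennreal)"
proof -
  obtain w where w: "w \<in> Z \<and> P w" "\<forall>z. z \<in> Z \<and> P z \<longrightarrow> z = w" using assms by (rule ex1E)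
  have "(\<integral>\<^sup>+z. of_bool (P z) \<partial>count_space Z) = (\<integral>\<^sup>+z. (1::ennreal) * indicator {w} z \<partial>count_space Z)"
  proof (rule nn_integral_cong)
    fix z assume "z \<in> space (count_space Z)"
    then have "P z \<longleftrightarrow> z = w" using w by (metis space_count_space)
    then show "of_bool (P z) = (1::ennreal) * indicator {w} z" by (simp add: indicator_def)
  qed
  also have "\<dots> = 1"
    using conjunct1[OF w(1)] by (subst nn_integral_cmult_indicator) auto
  finally show ?thesis .
qed

text \<open>The index sets differ because coordinates with respect to a lattice basis are numbered,
  while flow coordinates are indexed by arcs. That both sets have the same size is a consequence
  (\<open>card_eq\<close>), not an assumption.\<close>

locale lattice_iso =
  fixes I :: "'i set" and F :: "'f set" and T :: "('i \<Rightarrow> real) \<Rightarrow> 'f \<Rightarrow> real"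
  assumes finite: "finite I" "finite F"
    and bij: "bij_betw T (I \<rightarrow>\<^sub>E UNIV) (F \<rightarrow>\<^sub>E UNIV)"
    and lat: "bij_betw T (I \<rightarrow>\<^sub>E \<int>) (F \<rightarrow>\<^sub>E \<int>)"
    and add: "\<And>x y. x \<in> I \<rightarrow>\<^sub>E UNIV \<Longrightarrow> y \<in> I \<rightarrow>\<^sub>E UNIV \<Longrightarrow>
      T (\<lambda>i\<in>I. x i + y i) = (\<lambda>f\<in>F. T x f + T y f)"
begin

lemma T_in: "x \<in> I \<rightarrow>\<^sub>E UNIV \<Longrightarrow> T x \<in> F \<rightarrow>\<^sub>E UNIV"
  using bij by (auto simp: bij_betw_def)

lemma T_surj: "v \<in> F \<rightarrow>\<^sub>E UNIV \<Longrightarrow> \<exists>z. z \<in> I \<rightarrow>\<^sub>E UNIV \<and> T z = v"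
  unfolding bij_betw_imp_surj_on[OF bij, symmetric] by blast

lemma T_surj_Ints: "v \<in> F \<rightarrow>\<^sub>E \<int> \<Longrightarrow> \<exists>z. z \<in> I \<rightarrow>\<^sub>E \<int> \<and> T z = v"
  unfolding bij_betw_imp_surj_on[OF lat, symmetric] by blast

lemma T_diff:
  assumes x: "x \<in> I \<rightarrow>\<^sub>E UNIV" and y: "y \<in> I \<rightarrow>\<^sub>E UNIV"
  shows "T (\<lambda>i\<in>I. x i - y i) = (\<lambda>f\<in>F. T x f - T y f)"
proof -
  have "T x = T (\<lambda>i\<in>I. (\<lambda>i\<in>I. x i - y i) i + y i)"
    using x by (intro arg_cong[where f = T]) (auto simp: PiE_def extensional_def)
  also have "\<dots> = (\<lambda>f\<in>F. T (\<lambda>i\<in>I. x i - y i) f + T y f)"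
    using y by (intro add) auto
  finally have eq: "T x = (\<lambda>f\<in>F. T (\<lambda>i\<in>I. x i - y i) f + T y f)" .
  have "T (\<lambda>i\<in>I. x i - y i) \<in> F \<rightarrow>\<^sub>E UNIV" by (rule T_in) auto
  then show ?thesis by (subst eq) (auto simp: PiE_def extensional_def fun_eq_iff)
qed

lemma card_le: "card I \<le> card F"
  \<comment> \<open>The map \<open>T\<close> is injective modulo 2 on the vertices of the unit cube.\<close>
proof -
  define C where "C = (I \<rightarrow>\<^sub>E {0, 1::real})"
  define D where "D = (F \<rightarrow>\<^sub>E {0, 1::int})"
  define g where "g c = (\<lambda>f\<in>F. \<lfloor>T c f\<rfloor> mod 2)" for c
  have CZ: "C \<subseteq> I \<rightarrow>\<^sub>E \<int>" unfolding C_def by (rule PiE_mono) auto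
  have TZ: "T c f \<in> \<int>" if "c \<in> I \<rightarrow>\<^sub>E \<int>" "f \<in> F" for c f
    using lat that by (auto simp: bij_betw_def)
  have "inj_on g C"
  proof (rule inj_onI)
    fix c d assume c: "c \<in> C" and d: "d \<in> C" and eq: "g c = g d"
    have cZ: "c \<in> I \<rightarrow>\<^sub>E \<int>" "d \<in> I \<rightarrow>\<^sub>E \<int>" using c d CZ by auto
    then have cU: "c \<in> I \<rightarrow>\<^sub>E UNIV" "d \<in> I \<rightarrow>\<^sub>E UNIV" by auto
    \<comment> \<open>Half of T c - T d, integral because the two images agree modulo 2. Its
      integral preimage z gives c - d = 2z, and an even number among -1, 0, 1 is 0.\<close>
    define v where "v = (\<lambda>f\<in>F. real_of_int ((\<lfloor>T c f\<rfloor> - \<lfloor>T d f\<rfloor>) div 2))"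
    have "v \<in> F \<rightarrow>\<^sub>E \<int>" by (auto simp: v_def)
    then obtain z where z: "z \<in> I \<rightarrow>\<^sub>E \<int>" "T z = v" using T_surj_Ints by blast
    then have zU: "z \<in> I \<rightarrow>\<^sub>E UNIV" by auto
    have "T (\<lambda>i\<in>I. c i - d i) = T (\<lambda>i\<in>I. z i + z i)"
    proof
      fix f show "T (\<lambda>i\<in>I. c i - d i) f = T (\<lambda>i\<in>I. z i + z i) f"
      proof (cases "f \<in> F")
        case f: True
        obtain p where p: "T c f = of_int p" using TZ[OF cZ(1) f] by (rule Ints_cases)
        obtain q where q: "T d f = of_int q" using TZ[OF cZ(2) f] by (rule Ints_cases)
        note pq = p q
        have "p mod 2 = q mod 2" using fun_cong[OF eq, of f] f pq by (simp add: g_def)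
        then have "p - q = 2 * ((p - q) div 2)" by presburger
        then have "real_of_int (p - q) = 2 * real_of_int ((p - q) div 2)" by (metis of_int_mult of_int_numeral)
        moreover have "T (\<lambda>i\<in>I. z i + z i) f = v f + v f"
          using fun_cong[OF add[OF zU zU], of f] f z(2) by simp
        moreover have "T (\<lambda>i\<in>I. c i - d i) f = of_int (p - q)"
          using fun_cong[OF T_diff[OF cU], of f] f pq by simp
        ultimately show ?thesis using f pq by (simp add: v_def)
      qed (use fun_cong[OF T_diff[OF cU], of f] fun_cong[OF add[OF zU zU], of f] in simp)
    qed
    moreover have "(\<lambda>i\<in>I. c i - d i) \<in> I \<rightarrow>\<^sub>E UNIV" "(\<lambda>i\<in>I. z i + z i) \<in> I \<rightarrow>\<^sub>E UNIV" by auto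
    ultimately have *: "(\<lambda>i\<in>I. c i - d i) = (\<lambda>i\<in>I. z i + z i)"
      by (intro inj_onD[OF bij_betw_imp_inj_on[OF bij]])
    show "c = d"
    proof
      fix i show "c i = d i"
      proof (cases "i \<in> I")
        case True
        then have "z i \<in> \<int>" using z(1) by (auto simp: PiE_iff)
        then obtain k where "z i = of_int k" by (rule Ints_cases)
        then have "c i - d i = of_int (2 * k)" using fun_cong[OF *, of i] True by simp
        moreover have "c i \<in> {0,1}" "d i \<in> {0,1}" using c d True by (auto simp: C_def PiE_iff)
        ultimately have "real_of_int (2 * k) = of_int (-1) \<or> real_of_int (2 * k) = of_int 0 \<or> real_of_int (2 * k) = of_int 1"
          by auto
        then have "2 * k = -1 \<or> 2 * k = 0 \<or> 2 * k = 1" unfolding of_int_eq_iff .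
        then have "k = 0" by presburger
        then show ?thesis using \<open>c i - d i = of_int (2 * k)\<close> by simp
      next
        case False then show ?thesis using cU by (auto simp: PiE_def extensional_def)
      qed
    qed
  qed
  moreover have "g ` C \<subseteq> D" unfolding g_def D_def by (auto simp: PiE_iff)
  moreover have "finite D" unfolding D_def using finite by (intro finite_PiE) auto
  ultimately have "card C \<le> card D" by (meson card_inj_on_le)
  then have "(2::nat) ^ card I \<le> 2 ^ card F"
    by (simp add: C_def D_def card_PiE finite)
  then show ?thesis by simp
qed

text \<open>Symmetry of the notion turns the one-sided estimate \<open>card_le\<close> into an
  equality.\<close>

lemma inverse: "lattice_iso F I (the_inv_into (I \<rightarrow>\<^sub>E UNIV) T)"
proof
  let ?g = "the_inv_into (I \<rightarrow>\<^sub>E UNIV) T"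
  have inj: "inj_on T (I \<rightarrow>\<^sub>E UNIV)" by (rule bij_betw_imp_inj_on[OF bij])
  show bij': "bij_betw ?g (F \<rightarrow>\<^sub>E UNIV) (I \<rightarrow>\<^sub>E UNIV)"
    by (rule bij_betw_the_inv_into[OF bij])
  have IZ: "(I \<rightarrow>\<^sub>E \<int>) \<subseteq> (I \<rightarrow>\<^sub>E (UNIV :: real set))" "(F \<rightarrow>\<^sub>E \<int>) \<subseteq> (F \<rightarrow>\<^sub>E (UNIV :: real set))"
    by auto
  have g_T: "?g (T x) = x" if "x \<in> I \<rightarrow>\<^sub>E UNIV" for x
    by (rule the_inv_into_f_f[OF inj that])
  have T_g: "T (?g y) = y" if "y \<in> F \<rightarrow>\<^sub>E UNIV" for y
    by (rule f_the_inv_into_f_bij_betw[OF bij]) (use that in simp)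
  have "?g ` (F \<rightarrow>\<^sub>E \<int>) = ?g ` T ` (I \<rightarrow>\<^sub>E \<int>)" by (simp only: bij_betw_imp_surj_on[OF lat])
  also have "\<dots> = (\<lambda>x. x) ` (I \<rightarrow>\<^sub>E \<int>)"
    unfolding image_image by (intro image_cong refl g_T) (use IZ(1) in blast)
  finally have "?g ` (F \<rightarrow>\<^sub>E \<int>) = I \<rightarrow>\<^sub>E \<int>" by simp
  then show "bij_betw ?g (F \<rightarrow>\<^sub>E \<int>) (I \<rightarrow>\<^sub>E \<int>)"
    using inj_on_subset[OF bij_betw_imp_inj_on[OF bij'] IZ(2)] by (simp add: bij_betw_def)
  fix x y :: "'f \<Rightarrow> real" assume x: "x \<in> F \<rightarrow>\<^sub>E UNIV" and y: "y \<in> F \<rightarrow>\<^sub>E UNIV"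
  have gx: "?g x \<in> I \<rightarrow>\<^sub>E UNIV" and gy: "?g y \<in> I \<rightarrow>\<^sub>E UNIV"
    using bij_betw_apply[OF bij'] x y by auto
  have "?g (\<lambda>f\<in>F. x f + y f) = ?g (T (\<lambda>i\<in>I. ?g x i + ?g y i))"
    by (simp only: add[OF gx gy] T_g[OF x] T_g[OF y])
  also have "\<dots> = (\<lambda>i\<in>I. ?g x i + ?g y i)" by (rule g_T) auto
  finally show "?g (\<lambda>f\<in>F. x f + y f) = (\<lambda>i\<in>I. ?g x i + ?g y i)" .
qed (rule finite)+

lemma card_eq: "card I = card F"
  using card_le lattice_iso.card_le[OF inverse] by simp

end

text \<open>Measurability is kept out of \<open>lattice_iso\<close>, so that \<open>inverse\<close>
  has nothing to prove about it.\<close>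

locale measurable_lattice_iso = lattice_iso I F T for I :: "'i set" and F :: "'f set" and T +
  assumes measurable_T: "T \<in> measurable (\<Pi>\<^sub>M i\<in>I. lborel) (\<Pi>\<^sub>M f\<in>F. lborel)"
begin

text \<open>
  The measure of the set of all \<open>(x, y)\<close> with \<open>T x \<in> A\<close> and \<open>T x + y \<in> B\<close>, computed in both
  orders of integration. It shows that Lebesgue measure and the image of Lebesgue measure under
  \<open>T\<close> are proportional, because both are translation invariant.
\<close>

lemma weil_identity:
  assumes A: "A \<in> sets (\<Pi>\<^sub>M f\<in>F. lborel)" and B: "B \<in> sets (\<Pi>\<^sub>M f\<in>F. lborel)"
  shows "emeasure (\<Pi>\<^sub>M i\<in>I. lborel) (T -` A \<inter> (I \<rightarrow>\<^sub>E UNIV)) * emeasure (\<Pi>\<^sub>M f\<in>F. lborel) B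
       = emeasure (\<Pi>\<^sub>M i\<in>I. lborel) (T -` B \<inter> (I \<rightarrow>\<^sub>E UNIV)) * emeasure (\<Pi>\<^sub>M f\<in>F. lborel) A"
proof -
  let ?M = "\<Pi>\<^sub>M i\<in>I. lborel :: real measure" and ?N = "\<Pi>\<^sub>M f\<in>F. lborel :: real measure"
  interpret MF: finite_product_sigma_finite "\<lambda>_. lborel :: real measure" I by standard (rule finite)
  interpret NF: finite_product_sigma_finite "\<lambda>_. lborel :: real measure" F by standard (rule finite)
  interpret P: pair_sigma_finite ?M ?N ..
  have Tf: "(\<lambda>p. T (fst p) f) \<in> borel_measurable (?M \<Otimes>\<^sub>M ?N)" if "f \<in> F" for f
    using measurable_compose[OF measurable_fst measurable_compose[OF measurable_T measurable_component_singleton[OF that]]]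
    by simp
  have sf: "(\<lambda>p. snd p f) \<in> borel_measurable (?M \<Otimes>\<^sub>M ?N)" if "f \<in> F" for f
    using measurable_compose[OF measurable_snd measurable_component_singleton[OF that, of "\<lambda>_. lborel"]] by simp
  have plus: "(\<lambda>p. \<lambda>f\<in>F. T (fst p) f + snd p f) \<in> measurable (?M \<Otimes>\<^sub>M ?N) ?N"
    and minus: "(\<lambda>p. \<lambda>f\<in>F. T (fst p) f - snd p f) \<in> measurable (?M \<Otimes>\<^sub>M ?N) ?N"
    using Tf sf by (auto intro!: measurable_restrict)
  have plus1: "(\<lambda>y. \<lambda>f\<in>F. T x f + y f) \<in> measurable ?N ?N"
    and minus1: "(\<lambda>y. \<lambda>f\<in>F. T x f - y f) \<in> measurable ?N ?N" for x
    by (auto intro!: measurable_restrict measurable_component_singleton[where M = "\<lambda>_. lborel", simplified])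
  have minus2: "(\<lambda>x. \<lambda>f\<in>F. T x f - y f) \<in> measurable ?M ?N" for y
    using measurable_compose[OF measurable_T measurable_component_singleton]
    by (auto intro!: measurable_restrict borel_measurable_diff)
  have T1: "(\<lambda>p. T (fst p)) \<in> measurable (?M \<Otimes>\<^sub>M ?N) ?N"
    by (rule measurable_compose[OF measurable_fst measurable_T])
  note indA = measurable_compose[OF _ borel_measurable_indicator[OF A]]
  note indB = measurable_compose[OF _ borel_measurable_indicator[OF B]]
  have emT: "emeasure ?M (T -` C \<inter> (I \<rightarrow>\<^sub>E UNIV)) = (\<integral>\<^sup>+x. indicator C (T x) \<partial>?M)"
    if "C \<in> sets ?N" for C
  proof -
    have "emeasure ?M (T -` C \<inter> (I \<rightarrow>\<^sub>E UNIV)) = (\<integral>\<^sup>+x. indicator (T -` C \<inter> (I \<rightarrow>\<^sub>E UNIV)) x \<partial>?M)"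
      using measurable_sets[OF measurable_T that] by simp
    also have "\<dots> = (\<integral>\<^sup>+x. indicator C (T x) \<partial>?M)"
      by (intro nn_integral_cong) (auto simp: indicator_def)
    finally show ?thesis .
  qed
  let ?J = "\<lambda>x y. indicator A (T x) * indicator B (\<lambda>f\<in>F. T x f + y f) :: ennreal"
  have "emeasure ?M (T -` A \<inter> (I \<rightarrow>\<^sub>E UNIV)) * emeasure ?N B
      = (\<integral>\<^sup>+x. indicator A (T x) * emeasure ?N B \<partial>?M)"
    unfolding emT[OF A] by (rule nn_integral_multc[symmetric]) (intro indA measurable_T)
  also have "\<dots> = (\<integral>\<^sup>+x. \<integral>\<^sup>+y. ?J x y \<partial>?N \<partial>?M)"
  proof (rule nn_integral_cong)
    fix x assume x: "x \<in> space ?M"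
    have "(\<integral>\<^sup>+y. ?J x y \<partial>?N) = indicator A (T x) * (\<integral>\<^sup>+y. indicator B (\<lambda>f\<in>F. T x f + y f) \<partial>?N)"
      by (rule nn_integral_cmult) (intro indB plus1)
    also have "(\<integral>\<^sup>+y. indicator B (\<lambda>f\<in>F. T x f + y f) \<partial>?N) = (\<integral>\<^sup>+y. indicator B y \<partial>?N)"
      by (rule nn_integral_lborel_PiM_shift[OF finite(2)]) (intro borel_measurable_indicator B)
    also have "\<dots> = emeasure ?N B" using B by simp
    finally show "indicator A (T x) * emeasure ?N B = (\<integral>\<^sup>+y. ?J x y \<partial>?N)" by (rule sym)
  qed
  also have "\<dots> = (\<integral>\<^sup>+y. \<integral>\<^sup>+x. ?J x y \<partial>?M \<partial>?N)"
    by (rule P.Fubini'[symmetric], unfold split_beta) (intro borel_measurable_times_ennreal indA indB T1 plus)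
  also have "\<dots> = (\<integral>\<^sup>+y. \<integral>\<^sup>+x. indicator A (\<lambda>f\<in>F. T x f - y f) * indicator B (T x) \<partial>?M \<partial>?N)"
  proof (rule nn_integral_cong)
    fix y assume "y \<in> space ?N"
    then have y: "y \<in> F \<rightarrow>\<^sub>E UNIV" by simp
    \<comment> \<open>Surjectivity of T converts the translation by y in the target into a
      translation by w in the source, where the measure is invariant as well.\<close>
    then obtain w where w: "w \<in> I \<rightarrow>\<^sub>E UNIV" "T w = y"
      using T_surj by blast
    have "(\<integral>\<^sup>+x. indicator A (\<lambda>f\<in>F. T x f - y f) * indicator B (T x) \<partial>?M)
       = (\<integral>\<^sup>+x. indicator A (\<lambda>f\<in>F. T (\<lambda>i\<in>I. w i + x i) f - y f) * indicator B (T (\<lambda>i\<in>I. w i + x i)) \<partial>?M)"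
      by (rule nn_integral_lborel_PiM_shift[OF finite(1), symmetric])
        (intro borel_measurable_times_ennreal indA indB minus2 measurable_T)
    also have "\<dots> = (\<integral>\<^sup>+x. ?J x y \<partial>?M)"
    proof (rule nn_integral_cong)
      fix x assume "x \<in> space ?M"
      then have x: "x \<in> I \<rightarrow>\<^sub>E UNIV" by simp
      have 1: "T (\<lambda>i\<in>I. w i + x i) = (\<lambda>f\<in>F. T x f + y f)"
        using add[OF w(1) x] w(2) by (auto simp: fun_eq_iff)
      have 2: "(\<lambda>f\<in>F. T (\<lambda>i\<in>I. w i + x i) f - y f) = T x"
        using T_in[OF x] unfolding 1 by (auto simp: fun_eq_iff PiE_def extensional_def)
      show "indicator A (\<lambda>f\<in>F. T (\<lambda>i\<in>I. w i + x i) f - y f) * indicator B (T (\<lambda>i\<in>I. w i + x i)) = ?J x y"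
        unfolding 2 unfolding 1 by simp
    qed
    finally show "(\<integral>\<^sup>+x. ?J x y \<partial>?M) = (\<integral>\<^sup>+x. indicator A (\<lambda>f\<in>F. T x f - y f) * indicator B (T x) \<partial>?M)" ..
  qed
  also have "\<dots> = (\<integral>\<^sup>+x. \<integral>\<^sup>+y. indicator A (\<lambda>f\<in>F. T x f - y f) * indicator B (T x) \<partial>?N \<partial>?M)"
    by (rule P.Fubini', unfold split_beta) (intro borel_measurable_times_ennreal indA indB T1 minus)
  also have "\<dots> = (\<integral>\<^sup>+x. emeasure ?N A * indicator B (T x) \<partial>?M)"
  proof (rule nn_integral_cong)
    fix x assume x: "x \<in> space ?M"
    have "(\<integral>\<^sup>+y. indicator A (\<lambda>f\<in>F. T x f - y f) * indicator B (T x) \<partial>?N)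
       = (\<integral>\<^sup>+y. indicator A (\<lambda>f\<in>F. T x f - y f) \<partial>?N) * indicator B (T x)"
      by (rule nn_integral_multc) (intro indA minus1)
    also have "(\<integral>\<^sup>+y. indicator A (\<lambda>f\<in>F. T x f - y f) \<partial>?N) = (\<integral>\<^sup>+y. indicator A y \<partial>?N)"
      by (rule nn_integral_lborel_PiM_reflect[OF finite(2)]) (intro borel_measurable_indicator A)
    also have "\<dots> = emeasure ?N A" using A by simp
    finally show "(\<integral>\<^sup>+y. indicator A (\<lambda>f\<in>F. T x f - y f) * indicator B (T x) \<partial>?N)
       = emeasure ?N A * indicator B (T x)" .
  qed
  also have "\<dots> = emeasure ?M (T -` B \<inter> (I \<rightarrow>\<^sub>E UNIV)) * emeasure ?N A"
    unfolding emT[OF B] mult.commute[of _ "emeasure ?N A"]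
    by (rule nn_integral_cmult) (intro indB measurable_T)
  finally show ?thesis .
qed

text \<open>
  The unit cube and the preimage of the unit cube are both fundamental domains of the integer
  lattice.
\<close>

lemma emeasure_vimage_unit_cube:
  "emeasure (\<Pi>\<^sub>M i\<in>I. lborel) (T -` (F \<rightarrow>\<^sub>E {0..<1}) \<inter> (I \<rightarrow>\<^sub>E UNIV)) = 1"
proof -
  let ?M = "\<Pi>\<^sub>M i\<in>I. lborel :: real measure" and ?Z = "I \<rightarrow>\<^sub>E (\<int> :: real set)"
  define Q where "Q = (I \<rightarrow>\<^sub>E {0..<1::real})"
  define R where "R = (F \<rightarrow>\<^sub>E {0..<1::real})"
  have Q: "Q \<in> sets ?M" and R: "R \<in> sets (\<Pi>\<^sub>M f\<in>F. lborel)"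
    using finite by (auto simp: Q_def R_def intro!: sets_PiM_I_finite)
  have meas_shift: "(\<lambda>x. \<lambda>i\<in>I. z i + x i) \<in> measurable ?M ?M"
    "(\<lambda>x. \<lambda>i\<in>I. x i - z i) \<in> measurable ?M ?M" for z :: "'i \<Rightarrow> real"
    by (auto intro!: measurable_restrict borel_measurable_diff measurable_component_singleton[where M = "\<lambda>_. lborel", simplified])
  have of_bool: "(\<lambda>x. of_bool (g x \<in> C) :: ennreal) \<in> borel_measurable L"
    if "g \<in> measurable L K" "C \<in> sets K" for g :: "'x \<Rightarrow> 'y" and C K L
    using measurable_compose[OF that(1) borel_measurable_indicator[OF that(2)]]
    by (simp add: indicator_def of_bool_def)
  have countZ: "countable ?Z"
    by (intro countable_PiE finite countable_subset[OF _ countable_rat] Ints_subset_Rats)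
  \<comment> \<open>Integer translates of the half-open cube tile the space; the translate
    containing a point is found by coordinatewise floors.\<close>
  have floor_part: "\<exists>!z. z \<in> J \<rightarrow>\<^sub>E (\<int> :: real set) \<and> (\<lambda>i\<in>J. x i - z i) \<in> J \<rightarrow>\<^sub>E {0..<1}"
    for J :: "'x set" and x
  proof (rule ex1I[of _ "\<lambda>i\<in>J. of_int \<lfloor>x i\<rfloor>"])
    fix z assume z: "z \<in> J \<rightarrow>\<^sub>E (\<int> :: real set) \<and> (\<lambda>i\<in>J. x i - z i) \<in> J \<rightarrow>\<^sub>E {0..<1}"
    show "z = (\<lambda>i\<in>J. of_int \<lfloor>x i\<rfloor>)"
    proof
      fix i show "z i = (\<lambda>i\<in>J. of_int \<lfloor>x i\<rfloor>) i"
      proof (cases "i \<in> J")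
        case True
        then have "z i \<in> \<int>" "0 \<le> x i - z i" "x i - z i < 1" using z by (auto simp: PiE_iff)
        then obtain k where k: "z i = of_int k" by (auto elim: Ints_cases)
        have "\<lfloor>x i\<rfloor> = k" using \<open>0 \<le> x i - z i\<close> \<open>x i - z i < 1\<close> k by (intro floor_unique) auto
        then show ?thesis using True k by simp
      qed (use z in \<open>auto simp: PiE_def extensional_def\<close>)
    qed
  next
    have "x i - of_int \<lfloor>x i\<rfloor> < 1" for i by linarith
    then show "(\<lambda>i\<in>J. of_int \<lfloor>x i\<rfloor>) \<in> J \<rightarrow>\<^sub>E (\<int> :: real set) \<and> (\<lambda>i\<in>J. x i - (\<lambda>i\<in>J. of_int \<lfloor>x i\<rfloor>) i) \<in> J \<rightarrow>\<^sub>E {0..<1}"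
      by (auto simp: PiE_iff)
  qed
  have "emeasure ?M (T -` R \<inter> (I \<rightarrow>\<^sub>E UNIV)) = (\<integral>\<^sup>+x. of_bool (T x \<in> R) \<partial>?M)"
  proof -
    have "emeasure ?M (T -` R \<inter> (I \<rightarrow>\<^sub>E UNIV)) = (\<integral>\<^sup>+x. indicator (T -` R \<inter> (I \<rightarrow>\<^sub>E UNIV)) x \<partial>?M)"
      using measurable_sets[OF measurable_T R] by simp
    also have "\<dots> = (\<integral>\<^sup>+x. of_bool (T x \<in> R) \<partial>?M)"
      by (intro nn_integral_cong) (auto simp: indicator_def)
    finally show ?thesis .
  qed
  \<comment> \<open>A factor 1 is inserted, written as the number of integer vectors z that move x
    into the cube Q. After the substitution of z + x for x, the sum over z instead counts the
    translates that hit the preimage of R, and that number is 1 again.\<close>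
  also have "\<dots> = (\<integral>\<^sup>+x. \<integral>\<^sup>+z. of_bool (T x \<in> R) * of_bool ((\<lambda>i\<in>I. x i - z i) \<in> Q) \<partial>count_space ?Z \<partial>?M)"
  proof (rule nn_integral_cong)
    fix x :: "'i \<Rightarrow> real"
    have "(\<integral>\<^sup>+z. of_bool (T x \<in> R) * of_bool ((\<lambda>i\<in>I. x i - z i) \<in> Q) \<partial>count_space ?Z)
       = of_bool (T x \<in> R) * (\<integral>\<^sup>+z. of_bool ((\<lambda>i\<in>I. x i - z i) \<in> Q) \<partial>count_space ?Z)"
      by (rule nn_integral_cmult) simp
    also have "(\<integral>\<^sup>+z. of_bool ((\<lambda>i\<in>I. x i - z i) \<in> Q) \<partial>count_space ?Z) = 1"
      unfolding Q_def by (rule nn_integral_count_space_unique) (rule floor_part)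
    finally show "of_bool (T x \<in> R) = (\<integral>\<^sup>+z. of_bool (T x \<in> R) * of_bool ((\<lambda>i\<in>I. x i - z i) \<in> Q) \<partial>count_space ?Z)"
      unfolding mult_1_right by (rule sym)
  qed
  also have "\<dots> = (\<integral>\<^sup>+z. \<integral>\<^sup>+x. of_bool (T x \<in> R) * of_bool ((\<lambda>i\<in>I. x i - z i) \<in> Q) \<partial>?M \<partial>count_space ?Z)"
    by (rule nn_integral_count_space_nn_integral[OF countZ])
      (intro borel_measurable_times_ennreal of_bool[OF measurable_T R] of_bool[OF meas_shift(2) Q])
  also have "\<dots> = (\<integral>\<^sup>+z. \<integral>\<^sup>+x. of_bool (T (\<lambda>i\<in>I. z i + x i) \<in> R) * of_bool (x \<in> Q) \<partial>?M \<partial>count_space ?Z)"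
  proof (rule nn_integral_cong)
    fix z :: "'i \<Rightarrow> real"
    have "(\<integral>\<^sup>+x. of_bool (T x \<in> R) * of_bool ((\<lambda>i\<in>I. x i - z i) \<in> Q) \<partial>?M)
       = (\<integral>\<^sup>+x. of_bool (T (\<lambda>i\<in>I. z i + x i) \<in> R) * of_bool ((\<lambda>i\<in>I. (\<lambda>i\<in>I. z i + x i) i - z i) \<in> Q) \<partial>?M)"
      by (rule nn_integral_lborel_PiM_shift[OF finite(1), symmetric])
        (intro borel_measurable_times_ennreal of_bool[OF measurable_T R] of_bool[OF meas_shift(2) Q])
    also have "\<dots> = (\<integral>\<^sup>+x. of_bool (T (\<lambda>i\<in>I. z i + x i) \<in> R) * of_bool (x \<in> Q) \<partial>?M)"
    proof (rule nn_integral_cong)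
      fix x assume "x \<in> space ?M"
      then have "(\<lambda>i\<in>I. (\<lambda>i\<in>I. z i + x i) i - z i) = x"
        by (auto simp: fun_eq_iff PiE_def extensional_def)
      then show "of_bool (T (\<lambda>i\<in>I. z i + x i) \<in> R) * of_bool ((\<lambda>i\<in>I. (\<lambda>i\<in>I. z i + x i) i - z i) \<in> Q)
        = of_bool (T (\<lambda>i\<in>I. z i + x i) \<in> R) * (of_bool (x \<in> Q) :: ennreal)" by simp
    qed
    finally show "(\<integral>\<^sup>+x. of_bool (T x \<in> R) * of_bool ((\<lambda>i\<in>I. x i - z i) \<in> Q) \<partial>?M)
      = (\<integral>\<^sup>+x. of_bool (T (\<lambda>i\<in>I. z i + x i) \<in> R) * of_bool (x \<in> Q) \<partial>?M)" .
  qed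
  also have "\<dots> = (\<integral>\<^sup>+x. \<integral>\<^sup>+z. of_bool (T (\<lambda>i\<in>I. z i + x i) \<in> R) * of_bool (x \<in> Q) \<partial>count_space ?Z \<partial>?M)"
    by (rule nn_integral_count_space_nn_integral[OF countZ, symmetric])
      (intro borel_measurable_times_ennreal of_bool[OF measurable_compose[OF meas_shift(1) measurable_T] R]
        of_bool[OF measurable_ident Q, unfolded id_apply])
  also have "\<dots> = (\<integral>\<^sup>+x. indicator Q x \<partial>?M)"
  proof (rule nn_integral_cong)
    fix x assume "x \<in> space ?M"
    then have x: "x \<in> I \<rightarrow>\<^sub>E UNIV" by simp
    have "\<exists>!z. z \<in> ?Z \<and> T (\<lambda>i\<in>I. z i + x i) \<in> R"
    proof -
      have eq: "T (\<lambda>i\<in>I. z i + x i) = (\<lambda>f\<in>F. T x f - (\<lambda>f\<in>F. - T z f) f)" if "z \<in> ?Z" for z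
      proof -
        have "z \<in> I \<rightarrow>\<^sub>E UNIV" using that by auto
        from add[OF this x] show ?thesis by (auto simp: fun_eq_iff)
      qed
      \<comment> \<open>The floor vector has to be subtracted from T x, whereas T z is added; hence
        z is the preimage of the negated vector.\<close>
      obtain v where v: "v \<in> F \<rightarrow>\<^sub>E \<int> \<and> (\<lambda>f\<in>F. T x f - v f) \<in> R"
        and v_unique: "\<forall>w. w \<in> F \<rightarrow>\<^sub>E \<int> \<and> (\<lambda>f\<in>F. T x f - w f) \<in> R \<longrightarrow> w = v"
        using floor_part[of F "T x", folded R_def] by (rule ex1E)
      have "(\<lambda>f\<in>F. - v f) \<in> F \<rightarrow>\<^sub>E \<int>" using v by (auto simp: PiE_iff)
      then obtain z where z: "z \<in> ?Z" "T z = (\<lambda>f\<in>F. - v f)" using T_surj_Ints by blast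
      have vz: "(\<lambda>f\<in>F. - T z f) = v" using v z(2) by (auto simp: fun_eq_iff PiE_def extensional_def)
      show ?thesis
      proof (rule ex1I[of _ z])
        show "z \<in> ?Z \<and> T (\<lambda>i\<in>I. z i + x i) \<in> R" unfolding eq[OF z(1)] vz using z(1) v by simp
      next
        fix y assume y: "y \<in> ?Z \<and> T (\<lambda>i\<in>I. y i + x i) \<in> R"
        have Ty: "T y \<in> F \<rightarrow>\<^sub>E \<int>" using lat y by (auto simp: bij_betw_def)
        have "(\<lambda>f\<in>F. - T y f) = v"
          using v_unique y Ty by (auto simp: PiE_iff eq)
        from fun_cong[OF this] have minus: "- T y f = v f" if "f \<in> F" for f
          using that by (metis restrict_apply')
        have "T y = T z"
        proof
          fix f show "T y f = T z f"
          proof (cases "f \<in> F")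
            case True then show ?thesis using minus[OF True] z(2) by simp
          next
            case False then show ?thesis using Ty z(2) by (auto simp: PiE_def extensional_def)
          qed
        qed
        then show "y = z" using y z(1) by (intro inj_onD[OF bij_betw_imp_inj_on[OF lat]]) auto
      qed
    qed
    then have "(\<integral>\<^sup>+z. of_bool (T (\<lambda>i\<in>I. z i + x i) \<in> R) \<partial>count_space ?Z) = (1::ennreal)"
      by (rule nn_integral_count_space_unique)
    moreover have "(\<integral>\<^sup>+z. of_bool (T (\<lambda>i\<in>I. z i + x i) \<in> R) * of_bool (x \<in> Q) \<partial>count_space ?Z)
       = (\<integral>\<^sup>+z. of_bool (T (\<lambda>i\<in>I. z i + x i) \<in> R) \<partial>count_space ?Z) * (of_bool (x \<in> Q) :: ennreal)"
      by (rule nn_integral_multc) simp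
    ultimately show "(\<integral>\<^sup>+z. of_bool (T (\<lambda>i\<in>I. z i + x i) \<in> R) * of_bool (x \<in> Q) \<partial>count_space ?Z) = (indicator Q x :: ennreal)"
      by (simp add: indicator_def)
  qed
  also have "\<dots> = emeasure ?M Q" using Q by simp
  also have "\<dots> = 1"
    unfolding Q_def by (subst lborel_product.emeasure_PiM[OF finite(1)]) auto
  finally show ?thesis unfolding R_def .
qed

text \<open>Taking the unit cube for B in \<open>weil_identity\<close> fixes the factor of
  proportionality, since the cube and its preimage both have measure 1.\<close>

theorem emeasure_vimage:
  assumes A: "A \<in> sets (\<Pi>\<^sub>M f\<in>F. lborel)"
  shows "emeasure (\<Pi>\<^sub>M i\<in>I. lborel) (T -` A \<inter> (I \<rightarrow>\<^sub>E UNIV)) = emeasure (\<Pi>\<^sub>M f\<in>F. lborel) A"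
proof -
  have "emeasure (\<Pi>\<^sub>M f\<in>F. lborel) (F \<rightarrow>\<^sub>E {0..<1::real}) = 1"
    by (subst lborel_product.emeasure_PiM[OF finite(2)]) auto
  moreover have "(F \<rightarrow>\<^sub>E {0..<1::real}) \<in> sets (\<Pi>\<^sub>M f\<in>F. lborel)"
    using finite by (auto intro!: sets_PiM_I_finite)
  ultimately show ?thesis
    using weil_identity[OF A, of "F \<rightarrow>\<^sub>E {0..<1}"] emeasure_vimage_unit_cube by simp
qed

end

text \<open>The coordinates indexed by \<open>F\<close> determine a point of \<open>A\<close>, compatibly with the integer lattice.\<close>

locale coordinate_chart =
  fixes A :: "('e \<Rightarrow> real) set" and F :: "'e set"
  assumes finite_F: "finite F" and nonempty: "A \<noteq> {}"
    and bij_direction: "bij_betw (\<lambda>v. restrict v F) (direction A) (F \<rightarrow>\<^sub>E UNIV)"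
    and lat_direction: "bij_betw (\<lambda>v. restrict v F) {v \<in> direction A. \<forall>e. v e \<in> \<int>} (F \<rightarrow>\<^sub>E \<int>)"
    and linear_direction: "\<And>v w c. v \<in> direction A \<Longrightarrow> w \<in> direction A \<Longrightarrow> (\<lambda>e. v e + c * w e) \<in> direction A"
    and translate: "\<And>p v. p \<in> A \<Longrightarrow> v \<in> direction A \<Longrightarrow> (\<lambda>e. p e + v e) \<in> A"
begin

lemma zero_direction: "(\<lambda>e. 0) \<in> direction A"
  using nonempty unfolding direction_def by force

lemma sum_direction:
  fixes d :: nat
  assumes "\<And>i. i < d \<Longrightarrow> w i \<in> direction A"
  shows "(\<lambda>e. \<Sum>i<d. c i * w i e) \<in> direction A"
  using assms
proof (induction d)
  case (Suc d)
  then show ?case using linear_direction[of "\<lambda>e. \<Sum>i<d. c i * w i e" "w d" "c d"] by simp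
qed (simp add: zero_direction)

lemma inj_restrict_direction: "inj_on (\<lambda>v. restrict v F) (direction A)"
  by (rule bij_betw_imp_inj_on[OF bij_direction])

lemma restrict_eq_imp_eq:
  assumes "v \<in> direction A" "w \<in> direction A" "restrict v F = restrict w F"
  shows "v = w"
  using inj_restrict_direction assms unfolding inj_on_def by blast

lemma inj_restrict: "inj_on (\<lambda>v. restrict v F) A"
proof (rule inj_onI)
  fix a b assume ab: "a \<in> A" "b \<in> A" "restrict a F = restrict b F"
  have ab_dir: "(\<lambda>e. a e - b e) \<in> direction A" using ab unfolding direction_def by auto
  have "a e = b e" if "e \<in> F" for e using fun_cong[OF ab(3), of e] that by simp
  then have "restrict (\<lambda>e. a e - b e) F = restrict (\<lambda>e. 0) F" by (auto simp: fun_eq_iff)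
  then have "(\<lambda>e. a e - b e) = (\<lambda>e. 0)"
    by (rule restrict_eq_imp_eq[OF ab_dir zero_direction])
  then show "a = b" by (simp add: fun_eq_iff)
qed

text \<open>\<open>normalized_volume\<close> selects its basis by \<open>SOME\<close>, which says
  something only if a basis exists. The integral preimages of the unit vectors of F form one,
  because coefficients can be read off as coordinates in F.\<close>

lemma ex_lattice_basis: "\<exists>B. lattice_basis (direction A) B"
proof -
  obtain fs where fs: "set fs = F" "distinct fs" using finite_distinct_list[OF finite_F] by auto
  define d where "d = length fs"
  have "\<exists>w. w \<in> direction A \<and> (\<forall>e. w e \<in> \<int>) \<and> restrict w F = (\<lambda>e\<in>F. of_bool (e = fs ! i))" for i
  proof -
    have "(\<lambda>e\<in>F. of_bool (e = fs ! i)) \<in> F \<rightarrow>\<^sub>E \<int>" by auto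
    then have "(\<lambda>e\<in>F. of_bool (e = fs ! i)) \<in> (\<lambda>v. restrict v F) ` {v \<in> direction A. \<forall>e. v e \<in> \<int>}"
      by (simp only: bij_betw_imp_surj_on[OF lat_direction])
    then show ?thesis by force
  qed
  then obtain w where w: "\<And>i. w i \<in> direction A" "\<And>i e. w i e \<in> \<int>"
    "\<And>i. restrict (w i) F = (\<lambda>e\<in>F. of_bool (e = fs ! i))" by metis
  define B where "B = map w [0..<d]"
  have lenB: "length B = d" by (simp add: B_def)
  have linB: "lincomb B c = (\<lambda>e. \<Sum>i<d. c i * w i e)" for c
    by (simp add: lincomb_def B_def)
  have coord: "lincomb B c (fs ! j) = c j" if j: "j < d" for c j
  proof -
    have jF: "fs ! j \<in> F" using j fs(1) by (auto simp: d_def)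
    have "w i (fs ! j) = of_bool (i = j)" if i: "i < d" for i
    proof -
      have "w i (fs ! j) = of_bool (fs ! j = fs ! i)" using fun_cong[OF w(3), of i "fs ! j"] jF by simp
      also have "fs ! j = fs ! i \<longleftrightarrow> i = j" using i j fs(2) by (auto simp: d_def nth_eq_iff_index_eq)
      finally show ?thesis .
    qed
    then have "lincomb B c (fs ! j) = (\<Sum>i<d. if i = j then c i else 0)"
      unfolding linB by (intro sum.cong) auto
    then show ?thesis using j by simp
  qed
  have inV: "lincomb B c \<in> direction A" for c unfolding linB by (rule sum_direction) (rule w(1))
  \<comment> \<open>The coefficient set S and its span W are variable, since
    \<open>lattice_basis\<close> demands the same bijection over the reals and over the
    integers.\<close>
  have bij: "bij_betw (lincomb B) ({..<d} \<rightarrow>\<^sub>E S) W"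
    if W: "W \<subseteq> direction A" and WS: "\<And>v e. v \<in> W \<Longrightarrow> v e \<in> S"
      and BW: "\<And>c. c \<in> {..<d} \<rightarrow>\<^sub>E S \<Longrightarrow> lincomb B c \<in> W" for S W
  proof (rule bij_betw_imageI)
    show "inj_on (lincomb B) ({..<d} \<rightarrow>\<^sub>E S)"
    proof (rule inj_onI)
      fix b c assume bc: "b \<in> {..<d} \<rightarrow>\<^sub>E S" "c \<in> {..<d} \<rightarrow>\<^sub>E S" "lincomb B b = lincomb B c"
      show "b = c"
      proof
        fix i show "b i = c i"
          using coord[of i b] coord[of i c] bc by (cases "i < d") (auto simp: PiE_def extensional_def)
      qed
    qed
    show "lincomb B ` ({..<d} \<rightarrow>\<^sub>E S) = W"
    proof (intro subset_antisym subsetI)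
      fix v assume v: "v \<in> W"
      define c where "c = (\<lambda>i\<in>{..<d}. v (fs ! i))"
      have cS: "c \<in> {..<d} \<rightarrow>\<^sub>E S" using WS[OF v] by (auto simp: c_def)
      have "restrict (lincomb B c) F = restrict v F"
      proof
        fix e show "restrict (lincomb B c) F e = restrict v F e"
        proof (cases "e \<in> F")
          case True
          then obtain j where "j < d" "e = fs ! j" using fs(1) by (auto simp: in_set_conv_nth d_def)
          then show ?thesis using True by (simp add: coord) (simp add: c_def)
        qed simp
      qed
      then have "lincomb B c = v"
        using restrict_eq_imp_eq[OF inV subsetD[OF W v]] by simp
      then show "v \<in> lincomb B ` ({..<d} \<rightarrow>\<^sub>E S)" using cS by blast
    qed (use BW in blast)
  qed
  have "lattice_basis (direction A) B"
    unfolding lattice_basis_def lenB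
  proof
    show "bij_betw (lincomb B) ({..<d} \<rightarrow>\<^sub>E UNIV) (direction A)"
      by (rule bij) (use inV in auto)
    show "bij_betw (lincomb B) ({..<d} \<rightarrow>\<^sub>E \<int>) {v \<in> direction A. \<forall>e. v e \<in> \<int>}"
    proof (rule bij)
      fix c :: "nat \<Rightarrow> real" assume c: "c \<in> {..<d} \<rightarrow>\<^sub>E \<int>"
      have "lincomb B c e \<in> \<int>" for e
        unfolding linB by (intro Ints_sum Ints_mult w(2)) (use c in \<open>auto simp: PiE_iff\<close>)
      then show "lincomb B c \<in> {v \<in> direction A. \<forall>e. v e \<in> \<int>}" using inV by simp
    qed auto
  qed
  then show ?thesis ..
qed

text \<open>Whatever basis is selected, passing from its coefficients to the coordinates in F is a
  composition of two bijections that respect integer points, so it preserves measure. The choice of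
  the base point is absorbed by translation invariance.\<close>

theorem normalized_volume_eq:
  assumes P: "P \<subseteq> A" and meas: "(\<lambda>b. restrict b F) ` P \<in> sets (\<Pi>\<^sub>M e\<in>F. lborel)"
  shows "normalized_volume A P = fact (card F) * measure (\<Pi>\<^sub>M e\<in>F. lborel) ((\<lambda>b. restrict b F) ` P)"
proof -
  define B where "B = (SOME B. lattice_basis (direction A) B)"
  define p where "p = (SOME p. p \<in> A)"
  define d where "d = length B"
  define T where "T c = restrict (lincomb B c) F" for c
  define Q where "Q = (\<lambda>b. restrict b F) ` P"
  have p: "p \<in> A" unfolding p_def using nonempty by (simp add: some_in_eq)
  have "lattice_basis (direction A) B" unfolding B_def by (rule someI_ex[OF ex_lattice_basis])
  then have B: "bij_betw (lincomb B) ({..<d} \<rightarrow>\<^sub>E UNIV) (direction A)"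
    "bij_betw (lincomb B) ({..<d} \<rightarrow>\<^sub>E \<int>) {v \<in> direction A. \<forall>e. v e \<in> \<int>}"
    by (auto simp: lattice_basis_def d_def)
  interpret measurable_lattice_iso "{..<d}" F T
  proof
    show "bij_betw T ({..<d} \<rightarrow>\<^sub>E UNIV) (F \<rightarrow>\<^sub>E UNIV)"
      using bij_betw_trans[OF B(1) bij_direction] by (simp add: comp_def T_def[abs_def])
    show "bij_betw T ({..<d} \<rightarrow>\<^sub>E \<int>) (F \<rightarrow>\<^sub>E \<int>)"
      using bij_betw_trans[OF B(2) lat_direction] by (simp add: comp_def T_def[abs_def])
    show "T (\<lambda>i\<in>{..<d}. x i + y i) = (\<lambda>f\<in>F. T x f + T y f)" for x y
      by (auto simp: fun_eq_iff T_def lincomb_def d_def[symmetric] distrib_right sum.distrib)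
    show "T \<in> measurable (\<Pi>\<^sub>M i\<in>{..<d}. lborel) (\<Pi>\<^sub>M f\<in>F. lborel)"
      unfolding T_def[abs_def] lincomb_def d_def[symmetric]
      by (intro measurable_restrict) (simp add: measurable_component_singleton[where M = "\<lambda>_. lborel", simplified])
  qed (use finite_F in auto)
  \<comment> \<open>The image of P, translated back by the base point: membership in P becomes a
    condition on the direction vector alone.\<close>
  define Q' where "Q' = {y \<in> F \<rightarrow>\<^sub>E UNIV. (\<lambda>e\<in>F. p e + y e) \<in> Q}"
  have Q: "Q \<in> sets (\<Pi>\<^sub>M e\<in>F. lborel)" using meas by (simp add: Q_def)
  have shift: "(\<lambda>y. \<lambda>e\<in>F. p e + y e) \<in> measurable (\<Pi>\<^sub>M e\<in>F. lborel) (\<Pi>\<^sub>M e\<in>F. lborel)"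
    by (auto intro!: measurable_restrict measurable_component_singleton[where M = "\<lambda>_. lborel", simplified])
  have Q': "Q' \<in> sets (\<Pi>\<^sub>M e\<in>F. lborel)"
    using measurable_sets[OF shift Q] by (simp add: Q'_def vimage_def Int_def conj_commute)
  have "emeasure (\<Pi>\<^sub>M e\<in>F. lborel) Q' = (\<integral>\<^sup>+y. indicator Q (\<lambda>e\<in>F. p e + y e) \<partial>(\<Pi>\<^sub>M e\<in>F. lborel))"
    unfolding nn_integral_indicator[OF Q', symmetric]
    by (intro nn_integral_cong) (simp add: indicator_def Q'_def)
  also have "\<dots> = (\<integral>\<^sup>+y. indicator Q y \<partial>(\<Pi>\<^sub>M e\<in>F. lborel))"
    by (rule nn_integral_lborel_PiM_shift[OF finite_F]) (intro borel_measurable_indicator Q)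
  finally have Q'_Q: "emeasure (\<Pi>\<^sub>M e\<in>F. lborel) Q' = emeasure (\<Pi>\<^sub>M e\<in>F. lborel) Q" using Q by simp
  have "(\<lambda>e. p e + lincomb B c e) \<in> P \<longleftrightarrow> T c \<in> Q'" if c: "c \<in> {..<d} \<rightarrow>\<^sub>E UNIV" for c
  proof -
    have inA: "(\<lambda>e. p e + lincomb B c e) \<in> A"
      by (rule translate[OF p bij_betw_apply[OF B(1) c]])
    have "(\<lambda>e. p e + lincomb B c e) \<in> P \<longleftrightarrow> restrict (\<lambda>e. p e + lincomb B c e) F \<in> Q"
      unfolding Q_def using inj_on_image_mem_iff[OF inj_restrict inA P] by simp
    also have "restrict (\<lambda>e. p e + lincomb B c e) F = (\<lambda>e\<in>F. p e + T c e)"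
      by (auto simp: T_def)
    finally show ?thesis using T_in[OF c] unfolding Q'_def by blast
  qed
  then have "{c \<in> {..<d} \<rightarrow>\<^sub>E UNIV. (\<lambda>e. p e + lincomb B c e) \<in> P} = T -` Q' \<inter> ({..<d} \<rightarrow>\<^sub>E UNIV)"
    by auto
  then have "measure (\<Pi>\<^sub>M i\<in>{..<d}. lborel) {c \<in> {..<d} \<rightarrow>\<^sub>E UNIV. (\<lambda>e. p e + lincomb B c e) \<in> P}
      = measure (\<Pi>\<^sub>M e\<in>F. lborel) Q"
    using emeasure_vimage[OF Q'] Q'_Q by (simp add: measure_def)
  then show ?thesis
    using card_eq by (simp add: normalized_volume_def Let_def B_def[symmetric] p_def[symmetric] d_def[symmetric] Q_def)
qed

end

section \<open>Flows on acyclic graphs\<close>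

text \<open>
  The sinks are the vertices from \<open>N\<close> on, where no conservation law is imposed. The flow on the
  chosen arc \<open>sp v\<close> out of \<open>v\<close> is determined by the flows on the other arcs.
\<close>

locale flow_graph =
  fixes E :: "'e set" and t h :: "'e \<Rightarrow> nat" and N :: nat and sp :: "nat \<Rightarrow> 'e"
  assumes finite_E: "finite E"
    and t_less_N: "e \<in> E \<Longrightarrow> t e < N"
    and t_less_h: "e \<in> E \<Longrightarrow> t e < h e"
    and sp_in: "v < N \<Longrightarrow> sp v \<in> E"
    and t_sp: "v < N \<Longrightarrow> t (sp v) = v"
begin

definition Out :: "nat \<Rightarrow> 'e set" where "Out v = {e \<in> E. t e = v}"
definition In :: "nat \<Rightarrow> 'e set" where "In v = {e \<in> E. h e = v}"
definition free_out :: "nat \<Rightarrow> 'e set" where "free_out v = Out v - {sp v}"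
definition free :: "'e set" where "free = E - sp ` {..<N}"

lemma finite_sets [simp]: "finite (Out v)" "finite (In v)" "finite (free_out v)" "finite free"
  using finite_E by (auto simp: Out_def In_def free_out_def free_def)

lemma free_iff: "e \<in> free \<longleftrightarrow> e \<in> E \<and> e \<noteq> sp (t e)"
  using t_less_N t_sp unfolding free_def by (metis Diff_iff imageE image_eqI lessThan_iff)

lemma free_out_iff: "e \<in> free_out v \<longleftrightarrow> e \<in> free \<and> t e = v"
  by (auto simp: free_out_def Out_def free_iff)

lemma Out_eq_insert: "v < N \<Longrightarrow> Out v = insert (sp v) (free_out v)" "sp v \<notin> free_out v"
  using sp_in t_sp by (auto simp: free_out_def Out_def)

lemma sum_Out:
  fixes f :: "'e \<Rightarrow> 'b::comm_monoid_add"
  shows "v < N \<Longrightarrow> sum f (Out v) = f (sp v) + sum f (free_out v)"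
  using Out_eq_insert by simp

definition flow :: "(nat \<Rightarrow> 'b::ab_group_add) \<Rightarrow> ('e \<Rightarrow> 'b) \<Rightarrow> bool" where
  "flow a b \<longleftrightarrow> (\<forall>e. e \<notin> E \<longrightarrow> b e = 0) \<and> (\<forall>v<N. sum b (Out v) = a v + sum b (In v))"

text \<open>Completes values on the free arcs to a flow by solving the conservation law at v for the
  arc \<open>sp v\<close>. The recursion ends because arcs into \<open>t e\<close> have smaller
  tails. The value type is any abelian group, so that real and integer flows share the
  construction.\<close>

function ext :: "(nat \<Rightarrow> 'b::ab_group_add) \<Rightarrow> ('e \<Rightarrow> 'b) \<Rightarrow> 'e \<Rightarrow> 'b" where
  "ext a b e = (if e \<notin> E then 0 else if e = sp (t e)
     then a (t e) + (\<Sum>e'\<in>In (t e). ext a b e') - sum b (free_out (t e)) else b e)"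
  by auto
termination
  by (relation "Wellfounded.measure (\<lambda>(a, b, e). t e)") (auto simp: In_def dest: t_less_h)

declare ext.simps [simp del]

lemma ext_free: "e \<in> free \<Longrightarrow> ext a b e = b e"
  by (subst ext.simps) (auto simp: free_iff)

lemma ext_outside: "e \<notin> E \<Longrightarrow> ext a b e = 0"
  by (subst ext.simps) auto

lemma ext_sp:
  assumes "v < N"
  shows "ext a b (sp v) = a v + sum (ext a b) (In v) - sum b (free_out v)"
  by (subst ext.simps) (use sp_in[OF assms] t_sp[OF assms] in simp)

lemma sum_free_out_ext: "sum (ext a b) (free_out v) = sum b (free_out v)"
  by (rule sum.cong) (auto simp: free_out_iff ext_free)

lemma flow_ext: "flow a (ext a b)"
  unfolding flow_def by (auto simp: ext_outside sum_Out ext_sp sum_free_out_ext)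

lemma t_induct [case_names step]:
  assumes "\<And>e. (\<And>e'. t e' < t e \<Longrightarrow> Q e') \<Longrightarrow> Q e"
  shows "Q e"
  by (rule measure_induct[of t]) (use assms in blast)

text \<open>The flow on e depends only on free arcs with tail at most \<open>t e\<close>. This
  causality makes it possible to integrate over the arcs out of the last vertex while all earlier
  flows are held fixed.\<close>

lemma ext_cong:
  assumes "\<And>f. f \<in> free \<Longrightarrow> t f \<le> t e \<Longrightarrow> b f = c f"
  shows "ext a b e = ext a c e"
  using assms
proof (induction e rule: t_induct)
  case (step e)
  have "sum b (free_out (t e)) = sum c (free_out (t e))"
    by (rule sum.cong) (auto simp: free_out_iff intro: step.prems)
  moreover have "sum (ext a b) (In (t e)) = sum (ext a c) (In (t e))"
  proof (rule sum.cong[OF refl])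
    fix x assume "x \<in> In (t e)"
    then have "t x < t e" using t_less_h[of x] by (auto simp: In_def)
    then show "ext a b x = ext a c x" using step.prems by (intro step.IH) auto
  qed
  moreover have "b e = c e" if "e \<in> E" "e \<noteq> sp (t e)"
    using step.prems[of e] that by (simp add: free_iff)
  ultimately show ?case by (subst (1 2) ext.simps) auto
qed

lemma ext_restrict: "ext a (restrict b free) = ext a b"
  by (rule ext) (rule ext_cong, simp)

lemma flow_unique:
  assumes "flow a b" "flow a c" "\<And>f. f \<in> free \<Longrightarrow> b f = c f"
  shows "b = c"
proof
  fix e show "b e = c e"
  proof (induction e rule: t_induct)
    case (step e)
    show ?case
    proof (cases "e \<in> E \<and> e = sp (t e)")
      case False
      then show ?thesis using assms(1,2) assms(3)[of e] by (cases "e \<in> E") (auto simp: flow_def free_iff)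
    next
      case True
      then have N: "t e < N" using t_less_N by auto
      have "sum b (free_out (t e)) = sum c (free_out (t e))"
        by (rule sum.cong) (auto simp: free_out_iff intro: assms(3))
      moreover have "sum b (In (t e)) = sum c (In (t e))"
        by (rule sum.cong) (auto intro!: step simp: In_def dest: t_less_h)
      moreover have "sum b (Out (t e)) = a (t e) + sum b (In (t e))"
        "sum c (Out (t e)) = a (t e) + sum c (In (t e))"
        using assms(1,2) N by (auto simp: flow_def)
      ultimately have "b (sp (t e)) + sum c (free_out (t e)) = c (sp (t e)) + sum c (free_out (t e))"
        using sum_Out[OF N, of b] sum_Out[OF N, of c] by simp
      then have "b (sp (t e)) = c (sp (t e))" by (rule add_right_imp_eq)
      then show ?thesis using True by metis
    qed
  qed
qed

lemma ext_eq_flow: "flow a b \<Longrightarrow> ext a b = b"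
  by (rule flow_unique[OF flow_ext]) (auto simp: ext_free)

text \<open>Solving for \<open>sp v\<close> involves no division. This is why the free coordinates
  identify integer flows with all integer vectors.\<close>

lemma ext_Ints:
  fixes a :: "nat \<Rightarrow> 'b::ring_1"
  assumes "\<And>v. a v \<in> \<int>" "\<And>f. f \<in> free \<Longrightarrow> b f \<in> \<int>"
  shows "ext a b e \<in> \<int>"
proof (induction e rule: t_induct)
  case (step e)
  have "sum b (free_out (t e)) \<in> \<int>" by (rule Ints_sum) (auto simp: free_out_iff intro: assms)
  moreover have "sum (ext a b) (In (t e)) \<in> \<int>"
    by (rule Ints_sum) (auto intro!: step simp: In_def dest: t_less_h)
  ultimately show ?case
    by (subst ext.simps) (auto intro!: Ints_diff Ints_add assms simp: free_iff)
qed

lemma flow_lincomb: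
  fixes b c :: "'e \<Rightarrow> 'b::comm_ring"
  assumes "flow a b" "flow a' c"
  shows "flow (\<lambda>v. a v + r * a' v) (\<lambda>e. b e + r * c e)"
  using assms by (auto simp: flow_def sum.distrib sum_distrib_left[symmetric] algebra_simps)

lemma direction_flow:
  fixes a :: "nat \<Rightarrow> real"
  shows "direction {b. flow a b} = {b. flow (\<lambda>_. 0) b}"
proof (intro subset_antisym subsetI)
  fix v assume "v \<in> direction {b. flow a b}"
  then obtain y z where yz: "flow a y" "flow a z" "v = (\<lambda>e. y e - z e)" by (auto simp: direction_def)
  then show "v \<in> {b. flow (\<lambda>_. 0) b}" using flow_lincomb[OF yz(1,2), of "-1"] by simp
next
  fix v :: "'e \<Rightarrow> real" assume "v \<in> {b. flow (\<lambda>_. 0) b}"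
  then have "flow a (\<lambda>e. ext a (\<lambda>_. 0) e + v e)"
    using flow_lincomb[OF flow_ext[of a "\<lambda>_. 0"], of "\<lambda>_. 0" v 1] by simp
  then show "v \<in> direction {b. flow a b}"
    using flow_ext[of a "\<lambda>_. 0"] unfolding direction_def
    by (intro CollectI exI[of _ "\<lambda>e. ext a (\<lambda>_. 0) e + v e"] exI[of _ "ext a (\<lambda>_. 0)"]) auto
qed

lemma coordinate_chart_flow:
  fixes a :: "nat \<Rightarrow> real"
  shows "coordinate_chart {b. flow a b} free"
proof
  show "finite free" by simp
  show "{b. flow a b} \<noteq> {}" using flow_ext by auto
  let ?R = "\<lambda>v. restrict v free" and ?X = "ext (\<lambda>_. 0 :: real)"
  have RX: "?R (?X v) = v" if "v \<in> free \<rightarrow>\<^sub>E S" for v S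
    using that by (auto simp: fun_eq_iff ext_free restrict_def PiE_def extensional_def)
  have XR: "?X (?R v) = v" if "flow (\<lambda>_. 0) v" for v
    using ext_eq_flow[OF that] by (simp add: ext_restrict)
  show "bij_betw ?R (direction {b. flow a b}) (free \<rightarrow>\<^sub>E UNIV)"
    unfolding direction_flow
    by (rule bij_betw_byWitness[where f' = ?X]) (auto simp: XR RX flow_ext)
  show "bij_betw ?R {v \<in> direction {b. flow a b}. \<forall>e. v e \<in> \<int>} (free \<rightarrow>\<^sub>E \<int>)"
    unfolding direction_flow
    by (rule bij_betw_byWitness[where f' = ?X]) (auto simp: XR RX flow_ext intro!: ext_Ints)
  show "(\<lambda>e. v e + c * w e) \<in> direction {b. flow a b}"
    if "v \<in> direction {b. flow a b}" "w \<in> direction {b. flow a b}" for v w c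
    using that flow_lincomb[of "\<lambda>_. 0" v "\<lambda>_. 0" w c] by (simp add: direction_flow)
  show "(\<lambda>e. p e + v e) \<in> {b. flow a b}"
    if "p \<in> {b. flow a b}" "v \<in> direction {b. flow a b}" for p v
    using that flow_lincomb[of a p "\<lambda>_. 0" v 1] by (simp add: direction_flow)
qed

text \<open>The set J is general because during the elimination only coordinates with small tails
  are left; M stands for Lebesgue measure as well as for counting measure.\<close>

lemma measurable_ext:
  fixes M :: "'b::{second_countable_topology, topological_ab_group_add} measure"
  assumes M: "sets M = sets borel" and "\<And>f. f \<in> free \<Longrightarrow> t f \<le> t e \<Longrightarrow> f \<in> J"
  shows "(\<lambda>b. ext a b e) \<in> borel_measurable (PiM J (\<lambda>_. M))"
  using assms(2)
proof (induction e rule: t_induct)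
  case (step e)
  have comp: "(\<lambda>b. b f) \<in> borel_measurable (PiM J (\<lambda>_. M))" if "f \<in> free" "t f \<le> t e" for f
    using measurable_component_singleton[OF step.prems[OF that], of "\<lambda>_. M"] M measurable_cong_sets by blast
  have 1: "(\<lambda>b. sum b (free_out (t e))) \<in> borel_measurable (PiM J (\<lambda>_. M))"
    by (rule borel_measurable_sum) (auto simp: free_out_iff intro: comp)
  have 2: "(\<lambda>b. sum (ext a b) (In (t e))) \<in> borel_measurable (PiM J (\<lambda>_. M))"
  proof (rule borel_measurable_sum)
    fix x assume "x \<in> In (t e)"
    then have "t x < t e" using t_less_h[of x] by (auto simp: In_def)
    then show "(\<lambda>b. ext a b x) \<in> borel_measurable (PiM J (\<lambda>_. M))" using step.prems by (intro step.IH) auto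
  qed
  have "(\<lambda>b. a (t e) + sum (ext a b) (In (t e))) \<in> borel_measurable (PiM J (\<lambda>_. M))"
    by (intro borel_measurable_add 2) simp
  moreover have "continuous_on UNIV (\<lambda>x :: 'b \<times> 'b. fst x - snd x)"
    by (intro continuous_intros)
  ultimately have 3: "(\<lambda>b. a (t e) + sum (ext a b) (In (t e)) - sum b (free_out (t e))) \<in> borel_measurable (PiM J (\<lambda>_. M))"
    by (intro borel_measurable_continuous_Pair[OF _ 1, where H = "\<lambda>x y. x - y"])
  show ?case
  proof (cases "e \<in> E")
    case True
    show ?thesis
    proof (cases "e = sp (t e)")
      case sp: True
      then show ?thesis using True 3 ext_sp[OF t_less_N[OF True]] by (metis (no_types, lifting) measurable_cong)
    next
      case False
      then show ?thesis using True comp[of e] by (simp add: ext_free free_iff)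
    qed
  qed (simp add: ext_outside)
qed

text \<open>The bound i keeps those constraints that remain when the vertices from i on have been
  eliminated; i = N gives the whole polytope.\<close>

definition nonneg :: "(nat \<Rightarrow> 'b::{ab_group_add, ord}) \<Rightarrow> nat \<Rightarrow> ('e \<Rightarrow> 'b) \<Rightarrow> bool" where
  "nonneg a i b \<longleftrightarrow> (\<forall>e\<in>E. t e < i \<longrightarrow> 0 \<le> ext a b e)"

lemma nonneg_N: "nonneg a N b \<longleftrightarrow> (\<forall>e\<in>E. 0 \<le> ext a b e)"
  using t_less_N by (auto simp: nonneg_def)

lemma normalized_volume_flow:
  fixes a :: "nat \<Rightarrow> real"
  shows "normalized_volume {b. flow a b} {b. flow a b \<and> (\<forall>e\<in>E. 0 \<le> b e)}
    = fact (card free) * measure (\<Pi>\<^sub>M e\<in>free. lborel) {b \<in> free \<rightarrow>\<^sub>E UNIV. nonneg a N b}"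
proof -
  interpret coordinate_chart "{b. flow a b}" free by (rule coordinate_chart_flow)
  let ?P = "{b. flow a b \<and> (\<forall>e\<in>E. 0 \<le> b e)}"
  have eq: "(\<lambda>b. restrict b free) ` ?P = {b \<in> free \<rightarrow>\<^sub>E UNIV. nonneg a N b}"
  proof (intro subset_antisym subsetI)
    fix b assume "b \<in> (\<lambda>b. restrict b free) ` ?P"
    then obtain c where c: "flow a c" "\<forall>e\<in>E. 0 \<le> c e" "b = restrict c free" by auto
    then have "ext a b = c" by (simp add: ext_restrict ext_eq_flow)
    then show "b \<in> {b \<in> free \<rightarrow>\<^sub>E UNIV. nonneg a N b}" using c by (auto simp: nonneg_N)
  next
    fix b assume b: "b \<in> {b \<in> free \<rightarrow>\<^sub>E UNIV. nonneg a N b}"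
    then have "b = restrict (ext a b) free"
      by (auto simp: fun_eq_iff ext_free restrict_def PiE_def extensional_def)
    moreover have "ext a b \<in> ?P" using b flow_ext by (auto simp: nonneg_N)
    ultimately show "b \<in> (\<lambda>b. restrict b free) ` ?P" by (rule image_eqI)
  qed
  have "{b \<in> space (\<Pi>\<^sub>M e\<in>free. lborel :: real measure). nonneg a N b} \<in> sets (\<Pi>\<^sub>M e\<in>free. lborel)"
    unfolding nonneg_N
    by (intro sets.sets_Collect_finite_All finite_E borel_measurable_le borel_measurable_const measurable_ext) auto
  then show ?thesis
    using normalized_volume_eq[of ?P] unfolding eq by (simp add: Collect_mono)
qed

end

section \<open>Lidskii formulas\<close>

text \<open>An inequality instead of a fixed sum: the slack is the exponent of the one extra summand
  in \<open>multi_convolution\<close>. Values outside A are 0, so that exponent vectors with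
  different supports can simply be added.\<close>

definition bounded_exponents :: "'e set \<Rightarrow> nat \<Rightarrow> ('e \<Rightarrow> nat) set" where
  "bounded_exponents A n = {\<kappa>. (\<forall>e. e \<notin> A \<longrightarrow> \<kappa> e = 0) \<and> sum \<kappa> A \<le> n}"

lemma bounded_exponents_empty: "bounded_exponents {} n = {\<lambda>_. 0}"
  by (auto simp: bounded_exponents_def)

lemma finite_bounded_exponents:
  assumes "finite A"
  shows "finite (bounded_exponents A n)"
proof (rule finite_subset)
  show "bounded_exponents A n \<subseteq> {\<kappa>. \<forall>e. (e \<in> A \<longrightarrow> \<kappa> e \<in> {..n}) \<and> (e \<notin> A \<longrightarrow> \<kappa> e = 0)}"
  proof (intro subsetI CollectI allI conjI impI)
    fix \<kappa> e assume \<kappa>: "\<kappa> \<in> bounded_exponents A n"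
    show "\<kappa> e \<in> {..n}" if "e \<in> A"
      using \<kappa> member_le_sum[of e A \<kappa>] that assms by (auto simp: bounded_exponents_def)
    show "\<kappa> e = 0" if "e \<notin> A"
      using \<kappa> that by (auto simp: bounded_exponents_def)
  qed
  show "finite {\<kappa>. \<forall>e. (e \<in> A \<longrightarrow> \<kappa> e \<in> {..n}) \<and> (e \<notin> A \<longrightarrow> \<kappa> e = (0::nat))}"
    by (rule finite_set_of_finite_funs) (use assms in auto)
qed

lemma bij_betw_bounded_exponents_insert:
  assumes "finite A" "x \<notin> A"
  shows "bij_betw (\<lambda>(\<kappa>, l). \<kappa>(x := l)) (SIGMA \<kappa>:bounded_exponents A n. {..n - sum \<kappa> A})
    (bounded_exponents (insert x A) n)"
proof (rule bij_betw_byWitness[where f' = "\<lambda>\<kappa>. (\<kappa>(x := 0), \<kappa> x)"])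
  have s: "sum (\<kappa>(x := l)) A = sum \<kappa> A" for \<kappa> :: "'a \<Rightarrow> nat" and l
    by (rule sum.cong) (use assms in auto)
  have s': "(\<Sum>e\<in>A. if e = x then 0 else \<kappa> e) = sum \<kappa> A" for \<kappa> :: "'a \<Rightarrow> nat"
    by (rule sum.cong) (use assms in auto)
  show "\<forall>p\<in>SIGMA \<kappa>:bounded_exponents A n. {..n - sum \<kappa> A}.
      (\<lambda>\<kappa>. (\<kappa>(x := 0), \<kappa> x)) (case p of (\<kappa>, l) \<Rightarrow> \<kappa>(x := l)) = p"
    using assms by (auto simp: bounded_exponents_def fun_eq_iff)
  show "\<forall>\<kappa>\<in>bounded_exponents (insert x A) n. (case (\<kappa>(x := 0), \<kappa> x) of (\<kappa>, l) \<Rightarrow> \<kappa>(x := l)) = \<kappa>"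
    by auto
  show "(\<lambda>(\<kappa>, l). \<kappa>(x := l)) ` (SIGMA \<kappa>:bounded_exponents A n. {..n - sum \<kappa> A})
      \<subseteq> bounded_exponents (insert x A) n"
    using assms s by (auto simp: bounded_exponents_def simp del: fun_upd_apply) (auto simp: s)
  show "(\<lambda>\<kappa>. (\<kappa>(x := 0), \<kappa> x)) ` bounded_exponents (insert x A) n
      \<subseteq> (SIGMA \<kappa>:bounded_exponents A n. {..n - sum \<kappa> A})"
    using assms by (auto simp: bounded_exponents_def s')
qed

text \<open>
  The two instances are \<open>y ^ k / fact k\<close> with \<open>eps = 0\<close> over the reals with Lebesgue measure, and
  the number of multisets of size \<open>k\<close> over a set of size \<open>y\<close>, with \<open>eps = 1\<close>, over the integers
  with counting measure.
\<close>

locale kernel =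
  fixes M :: "'b::{linordered_ab_group_add, second_countable_topology, linorder_topology, topological_ab_group_add} measure"
    and P :: "nat \<Rightarrow> 'b \<Rightarrow> real" and eps :: 'b
  assumes sets_M: "sets M = sets borel"
    and sigma_finite_M: "sigma_finite_measure M"
    and P_0: "P 0 y = 1"
    and P_nonneg: "0 \<le> y \<Longrightarrow> 0 \<le> P k y"
    and eps_nonneg: "0 \<le> eps"
    and P_measurable: "P k \<in> borel_measurable borel"
    and convolution: "P n (y + z) = (\<Sum>l\<le>n. P (n - l) y * P l z)"
    and beta_integral: "0 \<le> s \<Longrightarrow>
      (\<integral>\<^sup>+r. ennreal (of_bool (0 \<le> r \<and> r \<le> s) * (P k (r + eps) * P l (s - r + eps))) \<partial>M)
        = ennreal (P (Suc (k + l)) (s + eps))"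
begin

sublocale PM: product_sigma_finite "\<lambda>_. M"
  by (simp add: product_sigma_finite_def sigma_finite_M)

text \<open>The multinomial theorem for the kernel. It distributes the degree at a vertex between
  the part y of the vertex itself and the flows z on its incoming arcs, and is thereby the source of
  all exponents.\<close>

lemma multi_convolution:
  assumes "finite A"
  shows "P n (y + sum z A)
    = (\<Sum>\<kappa>\<in>bounded_exponents A n. P (n - sum \<kappa> A) y * (\<Prod>e\<in>A. P (\<kappa> e) (z e)))"
  using assms
proof (induction A arbitrary: y rule: finite_induct)
  case empty
  then show ?case by (simp add: bounded_exponents_empty)
next
  case (insert x A)
  have "P n (y + sum z (insert x A)) = P n ((y + z x) + sum z A)"
    using insert by (simp add: add.assoc)
  also have "\<dots> = (\<Sum>\<kappa>\<in>bounded_exponents A n. P (n - sum \<kappa> A) (y + z x) * (\<Prod>e\<in>A. P (\<kappa> e) (z e)))"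
    by (rule insert.IH)
  also have "\<dots> = (\<Sum>\<kappa>\<in>bounded_exponents A n. \<Sum>l\<le>n - sum \<kappa> A.
      P (n - sum \<kappa> A - l) y * P l (z x) * (\<Prod>e\<in>A. P (\<kappa> e) (z e)))"
    by (simp only: convolution sum_distrib_right)
  also have "\<dots> = (\<Sum>(\<kappa>, l)\<in>(SIGMA \<kappa>:bounded_exponents A n. {..n - sum \<kappa> A}).
      P (n - sum \<kappa> A - l) y * P l (z x) * (\<Prod>e\<in>A. P (\<kappa> e) (z e)))"
    by (rule sum.Sigma) (auto intro: finite_bounded_exponents insert)
  also have "\<dots> = (\<Sum>p\<in>(SIGMA \<kappa>:bounded_exponents A n. {..n - sum \<kappa> A}).
      (\<lambda>\<kappa>. P (n - sum \<kappa> (insert x A)) y * (\<Prod>e\<in>insert x A. P (\<kappa> e) (z e))) ((\<lambda>(\<kappa>, l). \<kappa>(x := l)) p))"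
  proof (rule sum.cong[OF refl], clarify)
    fix \<kappa> :: "'a \<Rightarrow> nat" and l
    have "sum (\<kappa>(x := l)) A = sum \<kappa> A" by (rule sum.cong) (use insert in auto)
    moreover have "(\<Prod>e\<in>A. P ((\<kappa>(x := l)) e) (z e)) = (\<Prod>e\<in>A. P (\<kappa> e) (z e))"
      by (rule prod.cong) (use insert in auto)
    ultimately show "P (n - sum \<kappa> A - l) y * P l (z x) * (\<Prod>e\<in>A. P (\<kappa> e) (z e))
      = P (n - sum (\<kappa>(x := l)) (insert x A)) y * (\<Prod>e\<in>insert x A. P ((\<kappa>(x := l)) e) (z e))"
      using insert by (simp add: add.commute)
  qed
  also have "\<dots> = (\<Sum>\<kappa>\<in>bounded_exponents (insert x A) n.
      P (n - sum \<kappa> (insert x A)) y * (\<Prod>e\<in>insert x A. P (\<kappa> e) (z e)))"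
    by (rule sum.reindex_bij_betw[OF bij_betw_bounded_exponents_insert[OF insert.hyps]])
  finally show ?case .
qed

lemma measurable_coord: "e \<in> A \<Longrightarrow> (\<lambda>b. b e) \<in> borel_measurable (PiM A (\<lambda>_. M))"
  using measurable_component_singleton[of e A "\<lambda>_. M"] measurable_cong_sets[OF refl sets_M] by blast

lemma borel_measurable_group_diff:
  assumes f: "f \<in> borel_measurable L" and g: "g \<in> borel_measurable L"
  shows "(\<lambda>x. f x - g x :: 'b) \<in> borel_measurable L"
proof -
  have "continuous_on UNIV (\<lambda>x :: 'b \<times> 'b. fst x - snd x)"
    by (intro continuous_intros)
  then show ?thesis
    by (intro borel_measurable_continuous_Pair[OF f g, where H = "\<lambda>x y. x - y"])
qed

text \<open>The remainder s - sum b A is the flow on the determined arc. Integrating one coordinate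
  by \<open>beta_integral\<close> merges its kernel into that of the remainder and raises the degree
  by one, which is why l is arbitrary in the induction and why \<open>card A\<close> enters the
  result.\<close>

lemma dirichlet_integral:
  assumes "finite A"
  shows "(\<integral>\<^sup>+b. ennreal (of_bool ((\<forall>e\<in>A. 0 \<le> b e) \<and> sum b A \<le> s) *
      ((\<Prod>e\<in>A. P (\<kappa> e) (b e + eps)) * P l (s - sum b A + eps))) \<partial>PiM A (\<lambda>_. M))
    = ennreal (of_bool (0 \<le> s) * P (sum \<kappa> A + card A + l) (s + eps))"
  using assms
proof (induction A arbitrary: l rule: finite_induct)
  case empty
  show ?case by (simp add: PiM_empty)
next
  case (insert x A)
  let ?f = "\<lambda>A b l. ennreal (of_bool ((\<forall>e\<in>A. 0 \<le> b e) \<and> sum b A \<le> s) *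
      ((\<Prod>e\<in>A. P (\<kappa> e) (b e + eps)) * P l (s - sum b A + eps)))"
  have "(\<lambda>b. of_bool ((\<forall>e\<in>insert x A. 0 \<le> b e) \<and> sum b (insert x A) \<le> s) *
      ((\<Prod>e\<in>insert x A. P (\<kappa> e) (b e + eps)) * P l (s - sum b (insert x A) + eps)))
      \<in> borel_measurable (PiM (insert x A) (\<lambda>_. M))" (is "?g \<in> _")
  proof -
    have fin: "finite (insert x A)" using insert by simp
    have sums: "(\<lambda>b. sum b (insert x A)) \<in> borel_measurable (PiM (insert x A) (\<lambda>_. M))"
      by (intro borel_measurable_sum measurable_coord)
    have "{b \<in> space (PiM (insert x A) (\<lambda>_. M)). (\<forall>e\<in>insert x A. 0 \<le> b e) \<and> sum b (insert x A) \<le> s}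
        \<in> sets (PiM (insert x A) (\<lambda>_. M))"
      by (intro sets.sets_Collect_conj sets.sets_Collect_finite_All[OF _ fin] borel_measurable_le
          sums measurable_coord borel_measurable_const)
    from borel_measurable_indicator[OF this]
    have "(\<lambda>b. of_bool ((\<forall>e\<in>insert x A. 0 \<le> b e) \<and> sum b (insert x A) \<le> s) :: real)
        \<in> borel_measurable (PiM (insert x A) (\<lambda>_. M))"
      by (rule measurable_cong[THEN iffD1, rotated]) (simp add: indicator_def)
    then show ?thesis
      by (intro borel_measurable_times borel_measurable_prod measurable_compose[OF _ P_measurable]
          borel_measurable_add borel_measurable_group_diff sums measurable_coord borel_measurable_const)
  qed
  then have "(\<lambda>b. ?f (insert x A) b l) \<in> borel_measurable (PiM (insert x A) (\<lambda>_. M))"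
    by (rule measurable_compose[OF _ measurable_ennreal])
  then have "(\<integral>\<^sup>+b. ?f (insert x A) b l \<partial>PiM (insert x A) (\<lambda>_. M))
      = (\<integral>\<^sup>+b. \<integral>\<^sup>+r. ?f (insert x A) (b(x := r)) l \<partial>M \<partial>PiM A (\<lambda>_. M))"
    by (rule PM.product_nn_integral_insert[OF insert.hyps])
  also have "\<dots> = (\<integral>\<^sup>+b. ?f A b (Suc (\<kappa> x + l)) \<partial>PiM A (\<lambda>_. M))"
  proof (rule nn_integral_cong)
    fix b :: "'a \<Rightarrow> 'b"
    let ?s = "s - sum b A"
    let ?c = "of_bool (\<forall>e\<in>A. 0 \<le> b e) * (\<Prod>e\<in>A. P (\<kappa> e) (b e + eps))"
    have c: "0 \<le> ?c" by (auto intro!: prod_nonneg P_nonneg add_nonneg_nonneg eps_nonneg)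
    let ?h = "\<lambda>r. of_bool (0 \<le> r \<and> r \<le> ?s) * (P (\<kappa> x) (r + eps) * P l (?s - r + eps))"
    have f: "?f (insert x A) (b(x := r)) l = ennreal ?c * ennreal (?h r)" for r
    proof -
      have "sum (b(x := r)) (insert x A) = r + sum b A"
        using insert by (simp add: sum.insert) (intro sum.cong, auto)
      moreover have "(\<Prod>e\<in>insert x A. P (\<kappa> e) ((b(x := r)) e + eps))
          = P (\<kappa> x) (r + eps) * (\<Prod>e\<in>A. P (\<kappa> e) (b e + eps))"
        using insert by (simp add: prod.insert) (intro disjI2 prod.cong, auto)
      moreover have "(\<forall>e\<in>insert x A. 0 \<le> (b(x := r)) e) \<longleftrightarrow> 0 \<le> r \<and> (\<forall>e\<in>A. 0 \<le> b e)"
        using insert by auto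
      moreover have "r + sum b A \<le> s \<longleftrightarrow> r \<le> ?s" by (simp add: le_diff_eq)
      moreover have "s - (r + sum b A) = ?s - r" by (simp add: algebra_simps)
      ultimately have "?f (insert x A) (b(x := r)) l = ennreal (?c * ?h r)"
        by (simp add: of_bool_conj algebra_simps)
      then show ?thesis using c by (simp add: ennreal_mult')
    qed
    have "(\<lambda>r. ennreal (?h r)) \<in> borel_measurable M"
    proof -
      have id: "(\<lambda>r. r) \<in> borel_measurable M" using measurable_ident_sets[OF sets_M] by simp
      have "{r \<in> space M. 0 \<le> r \<and> r \<le> ?s} \<in> sets M"
        by (intro sets.sets_Collect_conj borel_measurable_le id borel_measurable_const)
      from borel_measurable_indicator[OF this]
      have "(\<lambda>r. of_bool (0 \<le> r \<and> r \<le> ?s) :: real) \<in> borel_measurable M"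
        by (rule measurable_cong[THEN iffD1, rotated]) (simp add: indicator_def)
      then show ?thesis
        by (intro measurable_compose[OF _ measurable_ennreal] borel_measurable_times
          measurable_compose[OF _ P_measurable] borel_measurable_add borel_measurable_group_diff
          id borel_measurable_const)
    qed
    then have "(\<integral>\<^sup>+r. ?f (insert x A) (b(x := r)) l \<partial>M) = ennreal ?c * (\<integral>\<^sup>+r. ennreal (?h r) \<partial>M)"
      unfolding f by (rule nn_integral_cmult)
    also have "(\<integral>\<^sup>+r. ennreal (?h r) \<partial>M) = ennreal (of_bool (0 \<le> ?s) * P (Suc (\<kappa> x + l)) (?s + eps))"
    proof (cases "0 \<le> ?s")
      case True then show ?thesis using beta_integral[OF True] by simp
    next
      case False
      then have "\<not> (0 \<le> r \<and> r \<le> ?s)" for r using order_trans by blast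
      then have h0: "?h r = 0" for r by simp
      have "(\<integral>\<^sup>+r. ennreal (?h r) \<partial>M) = (\<integral>\<^sup>+r. 0 \<partial>M)"
        by (intro nn_integral_cong) (simp only: h0 ennreal_0)
      then show ?thesis using False by simp
    qed
    also have "ennreal ?c * \<dots> = ennreal (?c * (of_bool (0 \<le> ?s) * P (Suc (\<kappa> x + l)) (?s + eps)))"
      using c by (simp add: ennreal_mult')
    also have "\<dots> = ?f A b (Suc (\<kappa> x + l))"
      by (simp add: of_bool_conj mult_ac)
    finally show "(\<integral>\<^sup>+r. ?f (insert x A) (b(x := r)) l \<partial>M) = ?f A b (Suc (\<kappa> x + l))" .
  qed
  also have "\<dots> = ennreal (of_bool (0 \<le> s) * P (sum \<kappa> A + card A + Suc (\<kappa> x + l)) (s + eps))"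
    by (rule insert.IH)
  also have "sum \<kappa> A + card A + Suc (\<kappa> x + l) = sum \<kappa> (insert x A) + card (insert x A) + l"
    using insert by simp
  finally show ?case .
qed

end

section \<open>Exponent vectors of the elimination\<close>

context flow_graph
begin

text \<open>
  The number \<open>k e\<close> is the power of the flow on \<open>e\<close> that is selected when the kernel at the head of
  \<open>e\<close> is expanded; \<open>exponent k v\<close> is the power left for the net flow at \<open>v\<close>. Its subtraction
  does not truncate for \<open>k\<close> in \<open>exponents 0\<close>.
\<close>

definition exponent :: "('e \<Rightarrow> nat) \<Rightarrow> nat \<Rightarrow> nat" where
  "exponent k v = card (free_out v) + sum k (Out v) - sum k (In v)"

text \<open>An arc acquires an exponent when its head is eliminated, so only heads between i and N
  count; sinks are never eliminated. The inequality says that the arcs into v cannot draw more than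
  the degree produced at v.\<close>

definition exponents :: "nat \<Rightarrow> ('e \<Rightarrow> nat) set" where
  "exponents i = {k. (\<forall>e. \<not> (e \<in> E \<and> i \<le> h e \<and> h e < N) \<longrightarrow> k e = 0) \<and>
     (\<forall>v. i \<le> v \<and> v < N \<longrightarrow> sum k (In v) \<le> card (free_out v) + sum k (Out v))}"

lemma exponents_N: "exponents N = {\<lambda>_. 0}"
  by (auto simp: exponents_def)

lemma exponents_zero: "k \<in> exponents i \<Longrightarrow> e \<notin> E \<or> h e < i \<or> N \<le> h e \<Longrightarrow> k e = 0"
  by (auto simp: exponents_def)

text \<open>k is the exponent vector before i is eliminated, l the part newly drawn by the arcs into
  i. The bound on l is the degree of the Dirichlet integral over the arcs out of i.\<close>

definition split_exponents :: "nat \<Rightarrow> (('e \<Rightarrow> nat) \<times> ('e \<Rightarrow> nat)) set" where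
  "split_exponents i = (SIGMA k:exponents (Suc i).
     bounded_exponents (In i) (card (free_out i) + sum k (Out i)))"

text \<open>The supports of k and l are disjoint, and an arc out of a vertex from i on cannot enter
  i. Hence adding l changes only the sum over the arcs into i among the sums that matter.\<close>

lemma split_exponents_sums:
  assumes i: "i < N" and kl: "(k, l) \<in> split_exponents i"
  shows "\<And>e. e \<in> In i \<Longrightarrow> k e + l e = l e" "\<And>e. e \<notin> In i \<Longrightarrow> k e + l e = k e"
    and "\<And>v. i \<le> v \<Longrightarrow> (\<Sum>e\<in>Out v. k e + l e) = sum k (Out v)"
    and "\<And>v. i < v \<Longrightarrow> (\<Sum>e\<in>In v. k e + l e) = sum k (In v)"
    and "(\<Sum>e\<in>In i. k e + l e) = sum l (In i)"
proof -
  have k: "k e = 0" if "e \<in> In i" for e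
    using kl that by (auto simp: split_exponents_def In_def intro: exponents_zero)
  have l: "l e = 0" if "e \<notin> In i" for e
    using kl that by (auto simp: split_exponents_def bounded_exponents_def)
  show "k e + l e = l e" if "e \<in> In i" for e using k[OF that] by simp
  show "k e + l e = k e" if "e \<notin> In i" for e using l[OF that] by simp
  show "(\<Sum>e\<in>Out v. k e + l e) = sum k (Out v)" if "i \<le> v" for v
  proof (rule sum.cong[OF refl])
    fix e assume "e \<in> Out v"
    then have "e \<notin> In i" using that t_less_h[of e] by (auto simp: Out_def In_def)
    then show "k e + l e = k e" by (simp add: l)
  qed
  show "(\<Sum>e\<in>In v. k e + l e) = sum k (In v)" if "i < v" for v
    by (rule sum.cong) (use that l in \<open>auto simp: In_def\<close>)
  show "(\<Sum>e\<in>In i. k e + l e) = sum l (In i)"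
    by (rule sum.cong) (use k in auto)
qed

lemma bij_betw_split_exponents:
  assumes i: "i < N"
  shows "bij_betw (\<lambda>(k, l) e. k e + l e) (split_exponents i) (exponents i)"
proof (rule bij_betw_byWitness[where f' = "\<lambda>k. (\<lambda>e. if e \<in> In i then 0 else k e, \<lambda>e. if e \<in> In i then k e else 0)"])
  let ?r = "\<lambda>k :: 'e \<Rightarrow> nat. (\<lambda>e. if e \<in> In i then 0 else k e, \<lambda>e. if e \<in> In i then k e else 0)"
  show "\<forall>p\<in>split_exponents i. ?r (case p of (k, l) \<Rightarrow> \<lambda>e. k e + l e) = p"
  proof
    fix p assume "p \<in> split_exponents i"
    then obtain k l where p: "p = (k, l)" and kl: "(k, l) \<in> split_exponents i" by (cases p) auto
    have k: "k e = 0" if "e \<in> In i" for e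
      using kl that by (auto simp: split_exponents_def In_def intro: exponents_zero)
    have l: "l e = 0" if "e \<notin> In i" for e
      using kl that by (auto simp: split_exponents_def bounded_exponents_def)
    show "?r (case p of (k, l) \<Rightarrow> \<lambda>e. k e + l e) = p" unfolding p using k l by auto
  qed
  show "\<forall>k\<in>exponents i. (case ?r k of (k, l) \<Rightarrow> \<lambda>e. k e + l e) = k"
    by auto
  show "(\<lambda>(k, l) e. k e + l e) ` split_exponents i \<subseteq> exponents i"
  proof clarify
    fix k l assume kl: "(k, l) \<in> split_exponents i"
    note sums = split_exponents_sums[OF i kl]
    have k: "k \<in> exponents (Suc i)" and l: "l \<in> bounded_exponents (In i) (card (free_out i) + sum k (Out i))"
      using kl by (auto simp: split_exponents_def)
    show "(\<lambda>e. k e + l e) \<in> exponents i"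
      unfolding exponents_def
    proof (intro CollectI conjI allI impI)
      fix e assume e: "\<not> (e \<in> E \<and> i \<le> h e \<and> h e < N)"
      have "e \<notin> In i" using e i by (auto simp: In_def)
      then have "k e + l e = k e" by (rule sums(2))
      also have "k e = 0" using e by (intro exponents_zero[OF k]) auto
      finally show "k e + l e = 0" .
    next
      fix v assume v: "i \<le> v \<and> v < N"
      show "(\<Sum>e\<in>In v. k e + l e) \<le> card (free_out v) + (\<Sum>e\<in>Out v. k e + l e)"
      proof (cases "v = i")
        case True
        then show ?thesis using l sums(3)[of i] sums(5) by (simp add: bounded_exponents_def)
      next
        case False
        then have "i < v" using v by simp
        then show ?thesis using k v sums(3)[of v] sums(4)[of v] by (auto simp: exponents_def)
      qed
    qed
  qed
  show "?r ` exponents i \<subseteq> split_exponents i"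
  proof clarify
    fix k assume k: "k \<in> exponents i"
    let ?k = "\<lambda>e. if e \<in> In i then 0 else k e"
    have "sum ?k (Out v) = sum k (Out v)" if "i \<le> v" for v
      by (rule sum.cong) (use that t_less_h in \<open>force simp: Out_def In_def\<close>)+
    moreover have "sum ?k (In v) = sum k (In v)" if "i < v" for v
      by (rule sum.cong) (use that in \<open>auto simp: In_def\<close>)
    ultimately show "?r k \<in> split_exponents i"
      using k i unfolding split_exponents_def
      by (auto simp: exponents_def bounded_exponents_def In_def)
  qed
qed

lemma finite_exponents: "i \<le> N \<Longrightarrow> finite (exponents i)"
proof (induction "N - i" arbitrary: i)
  case 0
  then have "i = N" by simp
  then show ?case unfolding \<open>i = N\<close> exponents_N by simp
next
  case (Suc d)
  then have i: "i < N" by simp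
  have "finite (exponents (Suc i))" using Suc by simp
  then have "finite (split_exponents i)"
    unfolding split_exponents_def by (intro finite_SigmaI finite_bounded_exponents) auto
  then show ?case using bij_betw_finite[OF bij_betw_split_exponents[OF i]] by simp
qed

end

section \<open>Elimination of vertices for an arbitrary kernel\<close>

locale lidskii = flow_graph E t h N sp + kernel M P eps
  for E :: "'e set" and t h :: "'e \<Rightarrow> nat" and N sp
    and M :: "'b::{linordered_ab_group_add, second_countable_topology, linorder_topology, topological_ab_group_add} measure"
    and P eps +
  fixes a :: "nat \<Rightarrow> 'b"
  assumes a_bound: "v < N \<Longrightarrow> (\<Sum>e\<in>In v. eps) \<le> a v"
begin

text \<open>Chosen so that the kernel argument at v, which is net flow plus inflow plus
  \<open>eps\<close>, equals \<open>y v\<close> plus the sum of flow plus \<open>eps\<close> over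
  the arcs into v. For \<open>eps\<close> = 1 and net flow x + indeg(v) - 1 the value is x.\<close>

definition y :: "nat \<Rightarrow> 'b" where "y v = a v + eps - (\<Sum>e\<in>In v. eps)"

text \<open>The integrand that is left when the vertices from \<open>i\<close> on have been eliminated.\<close>

definition partial_sum :: "nat \<Rightarrow> ('e \<Rightarrow> 'b) \<Rightarrow> real" where
  "partial_sum i b = (\<Sum>k\<in>exponents i. (\<Prod>v\<in>{i..<N}. P (exponent k v) (y v)) *
     (\<Prod>e\<in>{e \<in> E. t e < i}. P (k e) (ext a b e + eps)))"

definition free_below :: "nat \<Rightarrow> 'e set" where
  "free_below i = {e \<in> free. t e < i}"

definition partial_integral :: "nat \<Rightarrow> ennreal" where
  "partial_integral i = (\<integral>\<^sup>+b. ennreal (of_bool (nonneg a i b) * partial_sum i b) \<partial>PiM (free_below i) (\<lambda>_. M))"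

text \<open>The purpose of \<open>a_bound\<close>: with nonnegative arguments all kernel values are
  nonnegative, so that finite sums and products pass through \<open>ennreal\<close>.\<close>

lemma y_nonneg: "v < N \<Longrightarrow> 0 \<le> y v"
  unfolding y_def using add_mono[OF a_bound eps_nonneg] by simp

lemma measurable_nonneg_below:
  "{b \<in> space (PiM (free_below i) (\<lambda>_. M)). nonneg a i b} \<in> sets (PiM (free_below i) (\<lambda>_. M))"
proof -
  have eq: "{b \<in> space (PiM (free_below i) (\<lambda>_. M)). nonneg a i b}
    = {b \<in> space (PiM (free_below i) (\<lambda>_. M)). \<forall>e\<in>{e \<in> E. t e < i}. 0 \<le> ext a b e}"
    by (auto simp: nonneg_def)
  show ?thesis
    unfolding eq
    by (intro sets.sets_Collect_finite_All borel_measurable_le borel_measurable_const measurable_ext[OF sets_M])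
      (use finite_E in \<open>auto simp: free_below_def\<close>)
qed

lemma measurable_partial:
  "(\<lambda>b. ennreal (of_bool (nonneg a i b) * partial_sum i b)) \<in> borel_measurable (PiM (free_below i) (\<lambda>_. M))"
proof -
  have "(\<lambda>b. of_bool (nonneg a i b) :: real) \<in> borel_measurable (PiM (free_below i) (\<lambda>_. M))"
    using borel_measurable_indicator[OF measurable_nonneg_below]
    by (rule measurable_cong[THEN iffD1, rotated]) (simp add: indicator_def)
  then show ?thesis
    unfolding partial_sum_def
    by (intro measurable_compose[OF _ measurable_ennreal] borel_measurable_times borel_measurable_sum
        borel_measurable_prod measurable_compose[OF _ P_measurable] borel_measurable_add
        measurable_ext[OF sets_M] borel_measurable_const)
      (auto simp: free_below_def)
qed

text \<open>With the flows on arcs of smaller tail fixed, each summand is a constant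
  \<open>C k\<close> times a Dirichlet integrand \<open>D c k\<close> on the arcs out of i.
  Integration leaves one kernel in the throughput s of i; its multinomial expansion produces the
  summands for i.\<close>

lemma eliminate_vertex:
  assumes i: "i < N" and x: "nonneg a i x"
  shows "(\<integral>\<^sup>+c. ennreal (of_bool (nonneg a (Suc i) (merge (free_below i) (free_out i) (x, c))) *
      partial_sum (Suc i) (merge (free_below i) (free_out i) (x, c))) \<partial>PiM (free_out i) (\<lambda>_. M))
    = ennreal (partial_sum i x)"
proof -
  define s where "s = a i + sum (ext a x) (In i)"
  define low where "low = {e \<in> E. t e < i}"
  define C where "C k = (\<Prod>v\<in>{Suc i..<N}. P (exponent k v) (y v)) * (\<Prod>e\<in>low. P (k e) (ext a x e + eps))" for k
  define D where "D c k = of_bool ((\<forall>e\<in>free_out i. 0 \<le> c e) \<and> sum c (free_out i) \<le> s) *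
      ((\<Prod>e\<in>free_out i. P (k e) (c e + eps)) * P (k (sp i)) (s - sum c (free_out i) + eps))" for c k
  have In_low: "In i \<subseteq> low" using t_less_h by (auto simp: In_def low_def)
  have finite_low: "finite low" using finite_E by (simp add: low_def)
  have ext_x: "0 \<le> ext a x e" if "e \<in> low" for e
    using x that by (auto simp: nonneg_def low_def)
  have C_nonneg: "0 \<le> C k" for k
    unfolding C_def by (intro mult_nonneg_nonneg prod_nonneg ballI P_nonneg y_nonneg add_nonneg_nonneg eps_nonneg)
      (auto intro: ext_x)
  have "0 \<le> (\<Sum>e\<in>In i. eps)" by (intro sum_nonneg eps_nonneg)
  then have s: "0 \<le> s"
    unfolding s_def using In_low by (intro add_nonneg_nonneg sum_nonneg ext_x order_trans[OF _ a_bound[OF i]]) (auto intro: eps_nonneg)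
  have integrand: "of_bool (nonneg a (Suc i) (merge (free_below i) (free_out i) (x, c))) *
      partial_sum (Suc i) (merge (free_below i) (free_out i) (x, c))
      = (\<Sum>k\<in>exponents (Suc i). C k * D c k)" for c
  proof -
    let ?b = "merge (free_below i) (free_out i) (x, c)"
    have low_eq: "ext a ?b e = ext a x e" if "e \<in> low" for e
      by (rule ext_cong) (use that in \<open>auto simp: merge_def free_below_def low_def\<close>)
    have free_eq: "ext a ?b e = c e" if "e \<in> free_out i" for e
      using that by (auto simp: ext_free free_out_iff merge_def free_below_def)
    have sp_eq: "ext a ?b (sp i) = s - sum c (free_out i)"
    proof -
      have "sum (ext a ?b) (In i) = sum (ext a x) (In i)"
        by (rule sum.cong) (use low_eq In_low in auto)
      moreover have "sum ?b (free_out i) = sum c (free_out i)"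
        by (rule sum.cong) (auto simp: free_out_iff merge_def free_below_def)
      ultimately show ?thesis by (simp add: ext_sp[OF i] s_def)
    qed
    have Suc_low: "{e \<in> E. t e < Suc i} = low \<union> insert (sp i) (free_out i)"
      unfolding Out_eq_insert(1)[OF i, symmetric] by (auto simp: low_def Out_def)
    have disjoint: "low \<inter> insert (sp i) (free_out i) = {}"
      using t_sp[OF i] by (auto simp: low_def free_out_iff)
    have "nonneg a (Suc i) ?b \<longleftrightarrow> (\<forall>e\<in>low \<union> insert (sp i) (free_out i). 0 \<le> ext a ?b e)"
      unfolding nonneg_def Suc_low[symmetric] by auto
    also have "\<dots> \<longleftrightarrow> (\<forall>e\<in>free_out i. 0 \<le> c e) \<and> sum c (free_out i) \<le> s"
      using ext_x by (auto simp: low_eq free_eq sp_eq ball_Un)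
    finally have nn: "nonneg a (Suc i) ?b \<longleftrightarrow> (\<forall>e\<in>free_out i. 0 \<le> c e) \<and> sum c (free_out i) \<le> s" .
    have "(\<Prod>e\<in>{e \<in> E. t e < Suc i}. P (k e) (ext a ?b e + eps))
      = (\<Prod>e\<in>low. P (k e) (ext a x e + eps)) *
        ((\<Prod>e\<in>free_out i. P (k e) (c e + eps)) * P (k (sp i)) (s - sum c (free_out i) + eps))" for k
      unfolding Suc_low
      by (subst prod.union_disjoint[OF finite_low _ disjoint])
        (simp_all add: low_eq free_eq sp_eq Out_eq_insert(2) mult.commute)
    then show ?thesis
      unfolding nn partial_sum_def D_def C_def sum_distrib_left by (intro sum.cong) (simp_all add: mult_ac)
  qed
  have D_nonneg: "0 \<le> D c k" for c k
  proof (cases "(\<forall>e\<in>free_out i. 0 \<le> c e) \<and> sum c (free_out i) \<le> s")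
    case True
    then show ?thesis unfolding D_def
      by (intro mult_nonneg_nonneg prod_nonneg ballI P_nonneg add_nonneg_nonneg eps_nonneg) auto
  next
    case False
    then show ?thesis unfolding D_def by (simp only: of_bool_def if_False mult_zero_left order_refl)
  qed
  have D_measurable: "(\<lambda>c. D c k) \<in> borel_measurable (PiM (free_out i) (\<lambda>_. M))" for k
  proof -
    have sums: "(\<lambda>c. sum c (free_out i)) \<in> borel_measurable (PiM (free_out i) (\<lambda>_. M))"
      by (intro borel_measurable_sum measurable_coord)
    have "{c \<in> space (PiM (free_out i) (\<lambda>_. M)). (\<forall>e\<in>free_out i. 0 \<le> c e) \<and> sum c (free_out i) \<le> s}
        \<in> sets (PiM (free_out i) (\<lambda>_. M))"
      by (intro sets.sets_Collect_conj sets.sets_Collect_finite_All finite_sets borel_measurable_le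
          sums measurable_coord borel_measurable_const)
    from borel_measurable_indicator[OF this]
    have "(\<lambda>c. of_bool ((\<forall>e\<in>free_out i. 0 \<le> c e) \<and> sum c (free_out i) \<le> s) :: real)
        \<in> borel_measurable (PiM (free_out i) (\<lambda>_. M))"
      by (rule measurable_cong[THEN iffD1, rotated]) (simp add: indicator_def)
    then show ?thesis
      unfolding D_def
      by (intro borel_measurable_times borel_measurable_prod measurable_compose[OF _ P_measurable]
          borel_measurable_add borel_measurable_group_diff sums measurable_coord borel_measurable_const)
  qed
  have inner: "(\<integral>\<^sup>+c. ennreal (D c k) \<partial>PiM (free_out i) (\<lambda>_. M))
      = ennreal (P (card (free_out i) + sum k (Out i)) (s + eps))" for k
    unfolding D_def dirichlet_integral[OF finite_sets(3)]
    using s by (simp add: sum_Out[OF i] ac_simps)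
  have outer: "C k * P (card (free_out i) + sum k (Out i)) (s + eps)
     = (\<Sum>l\<in>bounded_exponents (In i) (card (free_out i) + sum k (Out i)).
         (\<lambda>k. (\<Prod>v\<in>{i..<N}. P (exponent k v) (y v)) * (\<Prod>e\<in>low. P (k e) (ext a x e + eps)))
           (\<lambda>e. k e + l e))" if k: "k \<in> exponents (Suc i)" for k
  proof -
    let ?n = "card (free_out i) + sum k (Out i)"
    \<comment> \<open>Each incoming arc takes its own \<open>eps\<close>; the definition of
      \<open>y\<close> compensates for this.\<close>
    have "s + eps = y i + (\<Sum>e\<in>In i. ext a x e + eps)"
      by (simp add: s_def y_def sum.distrib algebra_simps)
    then have "C k * P ?n (s + eps) = (\<Sum>l\<in>bounded_exponents (In i) ?n.
        C k * (P (?n - sum l (In i)) (y i) * (\<Prod>e\<in>In i. P (l e) (ext a x e + eps))))"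
      by (simp add: multi_convolution sum_distrib_left)
    also have "\<dots> = (\<Sum>l\<in>bounded_exponents (In i) ?n.
         (\<lambda>k. (\<Prod>v\<in>{i..<N}. P (exponent k v) (y v)) * (\<Prod>e\<in>low. P (k e) (ext a x e + eps)))
           (\<lambda>e. k e + l e))"
    proof (rule sum.cong[OF refl])
      fix l assume "l \<in> bounded_exponents (In i) ?n"
      then have kl: "(k, l) \<in> split_exponents i" using k by (simp add: split_exponents_def)
      note sums = split_exponents_sums[OF i kl]
      let ?k = "\<lambda>e. k e + l e"
      have exp_i: "exponent ?k i = ?n - sum l (In i)"
        by (simp add: exponent_def sums(3)[OF order_refl] sums(5))
      have exp_v: "exponent ?k v = exponent k v" if "v \<in> {Suc i..<N}" for v
        using that by (simp add: exponent_def sums(3) sums(4))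
      have vs: "{i..<N} = insert i {Suc i..<N}" using i by auto
      have 1: "(\<Prod>v\<in>{i..<N}. P (exponent ?k v) (y v))
        = P (?n - sum l (In i)) (y i) * (\<Prod>v\<in>{Suc i..<N}. P (exponent k v) (y v))"
        unfolding vs by (simp add: exp_i) (intro disjI2 prod.cong, auto simp: exp_v)
      have low_split: "low = (low - In i) \<union> In i" using In_low by auto
      have 2: "(\<Prod>e\<in>low. P (f e) (ext a x e + eps))
        = (\<Prod>e\<in>low - In i. P (f e) (ext a x e + eps)) * (\<Prod>e\<in>In i. P (f e) (ext a x e + eps))" for f
        by (subst low_split, rule prod.union_disjoint) (use finite_low in auto)
      have 3: "(\<Prod>e\<in>low - In i. P (?k e) (ext a x e + eps)) = (\<Prod>e\<in>low - In i. P (k e) (ext a x e + eps))"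
        by (rule prod.cong) (auto simp: sums(2))
      have 4: "(\<Prod>e\<in>In i. P (?k e) (ext a x e + eps)) = (\<Prod>e\<in>In i. P (l e) (ext a x e + eps))"
        by (rule prod.cong) (auto simp: sums(1))
      have 5: "(\<Prod>e\<in>In i. P (k e) (ext a x e + eps)) = 1"
        by (rule prod.neutral) (use exponents_zero[OF k] in \<open>auto simp: In_def P_0\<close>)
      show "C k * (P (?n - sum l (In i)) (y i) * (\<Prod>e\<in>In i. P (l e) (ext a x e + eps)))
        = (\<lambda>k. (\<Prod>v\<in>{i..<N}. P (exponent k v) (y v)) * (\<Prod>e\<in>low. P (k e) (ext a x e + eps))) ?k"
        unfolding C_def 2[of k] 2[of ?k] 1 3 4 5 by (simp add: mult_ac)
    qed
    finally show ?thesis .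
  qed
  have "(\<integral>\<^sup>+c. ennreal (of_bool (nonneg a (Suc i) (merge (free_below i) (free_out i) (x, c))) *
      partial_sum (Suc i) (merge (free_below i) (free_out i) (x, c))) \<partial>PiM (free_out i) (\<lambda>_. M))
    = (\<integral>\<^sup>+c. (\<Sum>k\<in>exponents (Suc i). ennreal (C k) * ennreal (D c k)) \<partial>PiM (free_out i) (\<lambda>_. M))"
    unfolding integrand
    by (intro nn_integral_cong)
      (simp add: sum_ennreal[symmetric] C_nonneg D_nonneg ennreal_mult)
  also have "\<dots> = (\<Sum>k\<in>exponents (Suc i). \<integral>\<^sup>+c. ennreal (C k) * ennreal (D c k) \<partial>PiM (free_out i) (\<lambda>_. M))"
    by (rule nn_integral_sum)
      (intro borel_measurable_times_ennreal borel_measurable_const measurable_compose[OF D_measurable measurable_ennreal])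
  also have "\<dots> = (\<Sum>k\<in>exponents (Suc i). ennreal (C k) * ennreal (P (card (free_out i) + sum k (Out i)) (s + eps)))"
    by (intro sum.cong refl, subst nn_integral_cmult)
      (auto intro: measurable_compose[OF D_measurable measurable_ennreal] simp: inner)
  also have "\<dots> = ennreal (\<Sum>k\<in>exponents (Suc i). C k * P (card (free_out i) + sum k (Out i)) (s + eps))"
    using s eps_nonneg by (simp add: sum_ennreal[symmetric] C_nonneg P_nonneg ennreal_mult)
  also have "(\<Sum>k\<in>exponents (Suc i). C k * P (card (free_out i) + sum k (Out i)) (s + eps))
    = (\<Sum>k\<in>exponents (Suc i). \<Sum>l\<in>bounded_exponents (In i) (card (free_out i) + sum k (Out i)).
         (\<lambda>k. (\<Prod>v\<in>{i..<N}. P (exponent k v) (y v)) * (\<Prod>e\<in>low. P (k e) (ext a x e + eps)))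
           (\<lambda>e. k e + l e))"
    by (rule sum.cong[OF refl outer])
  also have "\<dots> = (\<Sum>(k, l)\<in>split_exponents i.
         (\<lambda>k. (\<Prod>v\<in>{i..<N}. P (exponent k v) (y v)) * (\<Prod>e\<in>low. P (k e) (ext a x e + eps)))
           (\<lambda>e. k e + l e))"
    unfolding split_exponents_def using i by (intro sum.Sigma finite_exponents ballI finite_bounded_exponents) auto
  also have "\<dots> = (\<Sum>p\<in>split_exponents i.
         (\<lambda>k. (\<Prod>v\<in>{i..<N}. P (exponent k v) (y v)) * (\<Prod>e\<in>low. P (k e) (ext a x e + eps)))
           ((\<lambda>(k, l) e. k e + l e) p))"
    by (rule sum.cong) auto
  also have "\<dots> = partial_sum i x"
    unfolding partial_sum_def low_def by (rule sum.reindex_bij_betw[OF bij_betw_split_exponents[OF i]])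
  finally show ?thesis .
qed

lemma partial_integral_step:
  assumes i: "i < N"
  shows "partial_integral (Suc i) = partial_integral i"
proof -
  have Un: "free_below (Suc i) = free_below i \<union> free_out i"
    by (auto simp: free_below_def free_out_iff)
  have fin: "finite (free_below i)" "finite (free_out i)" by (auto simp: free_below_def)
  have disjoint: "free_below i \<inter> free_out i = {}"
    by (auto simp: free_below_def free_out_iff)
  have "partial_integral (Suc i) = (\<integral>\<^sup>+x. \<integral>\<^sup>+c. ennreal (of_bool (nonneg a (Suc i) (merge (free_below i) (free_out i) (x, c))) *
      partial_sum (Suc i) (merge (free_below i) (free_out i) (x, c)))
      \<partial>PiM (free_out i) (\<lambda>_. M) \<partial>PiM (free_below i) (\<lambda>_. M))"
    unfolding partial_integral_def Un
    by (rule PM.product_nn_integral_fold[OF disjoint fin]) (use measurable_partial[of "Suc i"] in \<open>simp add: Un\<close>)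
  also have "\<dots> = partial_integral i"
    unfolding partial_integral_def
  proof (rule nn_integral_cong)
    fix x
    show "(\<integral>\<^sup>+c. ennreal (of_bool (nonneg a (Suc i) (merge (free_below i) (free_out i) (x, c))) *
      partial_sum (Suc i) (merge (free_below i) (free_out i) (x, c))) \<partial>PiM (free_out i) (\<lambda>_. M))
      = ennreal (of_bool (nonneg a i x) * partial_sum i x)"
    proof (cases "nonneg a i x")
      case True
      then show ?thesis using eliminate_vertex[OF i True] by simp
    next
      case False
      \<comment> \<open>A negative flow on an arc with tail below i is unaffected by c, so the
        constraint fails on the whole fibre.\<close>
      have "\<not> nonneg a (Suc i) (merge (free_below i) (free_out i) (x, c))" for c
      proof -
        obtain e where e: "e \<in> E" "t e < i" "\<not> 0 \<le> ext a x e" using False by (auto simp: nonneg_def)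
        have "ext a (merge (free_below i) (free_out i) (x, c)) e = ext a x e"
          by (rule ext_cong) (use e in \<open>auto simp: merge_def free_below_def\<close>)
        then show ?thesis using e less_SucI unfolding nonneg_def by metis
      qed
      then show ?thesis using False by simp
    qed
  qed
  finally show ?thesis .
qed

text \<open>The two ends of a chain of equal integrals. At N the only exponent vector is 0 and the
  integral is the measure of the polytope; at 0 no variable is left and the integral is the finite
  sum.\<close>

theorem lidskii_formula:
  "emeasure (PiM free (\<lambda>_. M)) {b \<in> space (PiM free (\<lambda>_. M)). nonneg a N b}
    = ennreal (\<Sum>k\<in>exponents 0. \<Prod>v<N. P (exponent k v) (y v))"
proof -
  have free: "free_below N = free" using t_less_N by (auto simp: free_below_def free_iff)
  have empty: "free_below 0 = {}" by (auto simp: free_below_def)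
  have "partial_sum N b = 1" for b by (simp add: partial_sum_def exponents_N P_0)
  then have "partial_integral N = (\<integral>\<^sup>+b. indicator {b \<in> space (PiM free (\<lambda>_. M)). nonneg a N b} b \<partial>PiM free (\<lambda>_. M))"
    unfolding partial_integral_def free by (intro nn_integral_cong) (simp add: indicator_def)
  also have "\<dots> = emeasure (PiM free (\<lambda>_. M)) {b \<in> space (PiM free (\<lambda>_. M)). nonneg a N b}"
    using measurable_nonneg_below[of N] unfolding free by simp
  finally have "emeasure (PiM free (\<lambda>_. M)) {b \<in> space (PiM free (\<lambda>_. M)). nonneg a N b} = partial_integral N" ..
  also have "\<dots> = partial_integral 0"
  proof -
    have "i \<le> N \<Longrightarrow> partial_integral i = partial_integral 0" for i
      by (induction i) (auto simp: partial_integral_step)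
    from this[OF order_refl] show ?thesis .
  qed
  also have "\<dots> = ennreal (\<Sum>k\<in>exponents 0. \<Prod>v<N. P (exponent k v) (y v))"
    by (simp add: partial_integral_def empty PiM_empty nonneg_def partial_sum_def atLeast0LessThan)
  finally show ?thesis .
qed

end

section \<open>The monomial and the multichoose kernel\<close>

text \<open>The classes required by \<open>kernel\<close> hold for the discrete topology, so lattice
  points can be counted by integration over the integers.\<close>

instance int :: second_countable_topology
proof
  have "countable (range lessThan \<union> range greaterThan :: int set set)" by simp
  moreover have "open = generate_topology (range lessThan \<union> range greaterThan :: int set set)"
    by (rule open_generated_order)
  ultimately show "\<exists>B :: int set set. countable B \<and> open = generate_topology B" by blast
qed

instance int :: topological_ab_group_add
  by standard (simp add: nhds_discrete filterlim_principal eventually_principal)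

text \<open>Integration by parts shifts one power from s - r to r. For positive exponents the
  boundary terms vanish.\<close>

lemma has_integral_beta_monomials:
  fixes s :: real
  assumes s: "0 \<le> s"
  shows "((\<lambda>r. r ^ k / fact k * ((s - r) ^ l / fact l)) has_integral s ^ Suc (k + l) / fact (Suc (k + l))) {0..s}"
proof (induction l arbitrary: k)
  case 0
  have "((\<lambda>r. r ^ Suc k / fact (Suc k)) has_real_derivative r ^ k / fact k) (at r within {0..s})" for r
    by (rule derivative_eq_intros refl | simp add: field_simps del: of_nat_Suc)+
  then have "((\<lambda>r. r ^ k / fact k) has_integral (s ^ Suc k / fact (Suc k) - 0 ^ Suc k / fact (Suc k))) {0..s}"
    by (intro fundamental_theorem_of_calculus s) (simp add: has_real_derivative_iff_has_vector_derivative)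
  then show ?case by simp
next
  case (Suc l)
  let ?G = "\<lambda>r. r ^ Suc k / fact (Suc k) * ((s - r) ^ Suc l / fact (Suc l))"
  let ?f = "\<lambda>k l r. r ^ k / fact k * ((s - r) ^ l / fact l)"
  have "(?G has_real_derivative ?f k (Suc l) r - ?f (Suc k) l r) (at r within {0..s})" for r
  proof -
    have 1: "((\<lambda>r. r ^ Suc k / fact (Suc k)) has_real_derivative r ^ k / fact k) (at r within {0..s})"
      by (rule derivative_eq_intros refl | simp add: field_simps del: of_nat_Suc)+
    have 2: "((\<lambda>r. (s - r) ^ Suc l / fact (Suc l)) has_real_derivative - ((s - r) ^ l / fact l)) (at r within {0..s})"
      by (rule derivative_eq_intros refl | simp add: field_simps del: of_nat_Suc)+
    show ?thesis using DERIV_mult[OF 1 2] by (simp add: algebra_simps)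
  qed
  then have "((\<lambda>r. ?f k (Suc l) r - ?f (Suc k) l r) has_integral (?G s - ?G 0)) {0..s}"
    by (intro fundamental_theorem_of_calculus s) (simp add: has_real_derivative_iff_has_vector_derivative)
  from has_integral_add[OF this Suc.IH[of "Suc k"]] show ?case by simp
qed

interpretation monomial_kernel: kernel "lborel :: real measure" "\<lambda>k y. y ^ k / fact k" 0
proof (rule kernel.intro)
  show "sets lborel = sets (borel :: real measure)" by simp
  show "sigma_finite_measure (lborel :: real measure)" by (rule lborel.sigma_finite_measure_axioms)
  show "(y :: real) ^ 0 / fact 0 = 1" for y by simp
  show "0 \<le> y \<Longrightarrow> 0 \<le> y ^ k / fact k" for y :: real and k by simp
  show "(\<lambda>y :: real. y ^ k / fact k) \<in> borel_measurable borel" for k by measurable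
  show "(y + z) ^ n / fact n = (\<Sum>l\<le>n. y ^ (n - l) / fact (n - l) * (z ^ l / fact l))" for y z :: real and n
  proof -
    have "(y + z) ^ n / fact n = (\<Sum>l\<le>n. of_nat (n choose l) * z ^ l * y ^ (n - l) / fact n)"
      by (simp add: add.commute[of y] binomial_ring sum_divide_distrib)
    also have "\<dots> = (\<Sum>l\<le>n. y ^ (n - l) / fact (n - l) * (z ^ l / fact l))"
      by (intro sum.cong) (auto simp: binomial_fact field_simps)
    finally show ?thesis .
  qed
  show "(\<integral>\<^sup>+r. ennreal (of_bool (0 \<le> r \<and> r \<le> s) * ((r + 0) ^ k / fact k * ((s - r + 0) ^ l / fact l))) \<partial>lborel)
      = ennreal ((s + 0) ^ Suc (k + l) / fact (Suc (k + l)))" if s: "0 \<le> s" for s :: real and k l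
  proof (rule nn_integral_has_integral_lborel)
    show "(\<lambda>r. of_bool (0 \<le> r \<and> r \<le> s) * ((r + 0) ^ k / fact k * ((s - r + 0) ^ l / fact l))) \<in> borel_measurable borel"
    proof -
      have "(\<lambda>r. of_bool (0 \<le> r \<and> r \<le> s) :: real) = indicator {0..s}" by (auto simp: indicator_def)
      then show ?thesis by simp
    qed
    show "0 \<le> of_bool (0 \<le> r \<and> r \<le> s) * ((r + 0) ^ k / fact k * ((s - r + 0) ^ l / fact l))" for r
      by (cases "0 \<le> r \<and> r \<le> s") auto
    have "((\<lambda>r. if r \<in> {0..s} then r ^ k / fact k * ((s - r) ^ l / fact l) else 0)
        has_integral s ^ Suc (k + l) / fact (Suc (k + l))) UNIV"
      unfolding has_integral_restrict_UNIV by (rule has_integral_beta_monomials[OF s])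
    moreover have "(\<lambda>r. if r \<in> {0..s} then r ^ k / fact k * ((s - r) ^ l / fact l) else 0)
        = (\<lambda>r. of_bool (0 \<le> r \<and> r \<le> s) * ((r + 0) ^ k / fact k * ((s - r + 0) ^ l / fact l)))"
      by (auto simp: fun_eq_iff)
    ultimately show "((\<lambda>r. of_bool (0 \<le> r \<and> r \<le> s) * ((r + 0) ^ k / fact k * ((s - r + 0) ^ l / fact l)))
        has_integral (s + 0) ^ Suc (k + l) / fact (Suc (k + l))) UNIV" by simp
  qed
qed simp

section \<open>Multichoose coefficients as discrete monomials\<close>

definition multichoose :: "nat \<Rightarrow> int \<Rightarrow> real" where
  "multichoose k y = pochhammer (of_int y) k / fact k"

text \<open>Pascal's rule, playing the part of the derivative rule for y^(k+1)/(k+1)!.\<close>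

lemma multichoose_diff:
  "multichoose (Suc k) y - multichoose (Suc k) (y - 1) = multichoose k y"
proof -
  have "pochhammer (real_of_int y) (Suc k) - pochhammer (real_of_int (y - 1)) (Suc k)
    = real (Suc k) * pochhammer (real_of_int y) k"
    using pochhammer_rec[of "real_of_int (y - 1)" k] by (simp add: pochhammer_Suc algebra_simps)
  then show ?thesis
    unfolding multichoose_def by (simp add: diff_divide_distrib[symmetric] divide_simps del: of_nat_Suc)
qed

lemma multichoose_0_left [simp]: "multichoose 0 y = 1"
  by (simp add: multichoose_def)

lemma multichoose_zero: "multichoose k 0 = of_bool (k = 0)"
  by (cases k) (auto simp: multichoose_def pochhammer_rec)

text \<open>The beta integral again, with summation by parts in place of integration by
  parts.\<close>

lemma sum_multichoose:
  "(\<Sum>r\<le>n. multichoose k (int r + 1) * multichoose l (int (n - r) + 1)) = multichoose (Suc (k + l)) (int n + 1)"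
proof (induction l arbitrary: k)
  case 0
  have "(\<Sum>r\<le>n. multichoose k (int r + 1)) = multichoose (Suc k) (int n + 1)"
  proof (induction n)
    case 0
    then show ?case using multichoose_diff[of k 1] by (simp add: multichoose_zero)
  next
    case (Suc n)
    then show ?case using multichoose_diff[of k "int (Suc n) + 1"] by (simp add: ac_simps)
  qed
  then show ?case by simp
next
  case (Suc l)
  let ?p = "multichoose (Suc k)" and ?q = "multichoose (Suc l)"
  have "(\<Sum>r\<le>n. multichoose k (int r + 1) * ?q (int (n - r) + 1))
    = (\<Sum>r\<le>n. ?p (int r + 1) * ?q (int (n - r) + 1)) - (\<Sum>r\<le>n. ?p (int r) * ?q (int (n - r) + 1))"
    using multichoose_diff[of k "int r + 1" for r]
    by (simp add: sum_subtractf[symmetric] left_diff_distrib[symmetric])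
  \<comment> \<open>The boundary terms vanish: \<open>?p\<close> is 0 at r = 0, so the sum can be
    shifted here, and \<open>?q\<close> is 0 at r = n, so the missing last term can be restored
    next.\<close>
  also have "(\<Sum>r\<le>n. ?p (int r) * ?q (int (n - r) + 1)) = (\<Sum>r<n. ?p (int r + 1) * ?q (int (n - Suc r) + 1))"
    by (subst lessThan_Suc_atMost[symmetric], subst sum.lessThan_Suc_shift) (simp add: multichoose_zero add.commute)
  also have "\<dots> = (\<Sum>r\<le>n. ?p (int r + 1) * ?q (int (n - r)))"
    by (subst lessThan_Suc_atMost[symmetric], subst sum.lessThan_Suc)
      (auto simp: multichoose_zero of_nat_diff intro!: sum.cong)
  also have "(\<Sum>r\<le>n. ?p (int r + 1) * ?q (int (n - r) + 1)) - (\<Sum>r\<le>n. ?p (int r + 1) * ?q (int (n - r)))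
    = (\<Sum>r\<le>n. ?p (int r + 1) * multichoose l (int (n - r) + 1))"
  proof -
    have "c * ?q (j + 1) - c * ?q j = c * multichoose l (j + 1)" for c j
      using multichoose_diff[of l "j + 1"] by (simp add: right_diff_distrib[symmetric])
    then show ?thesis unfolding sum_subtractf[symmetric] by (intro sum.cong) auto
  qed
  also have "\<dots> = multichoose (Suc (Suc k + l)) (int n + 1)" by (rule Suc.IH)
  finally show ?case by simp
qed

interpretation multichoose_kernel: kernel "count_space (UNIV :: int set)" multichoose 1
proof (rule kernel.intro)
  have "A \<in> sets borel" for A :: "int set" by (rule borel_open[OF open_discrete])
  then show "sets (count_space UNIV) = sets (borel :: int measure)" by auto
  show "sigma_finite_measure (count_space (UNIV :: int set))"
    by (rule sigma_finite_measure_count_space_countable) auto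
  show "multichoose 0 y = 1" for y by simp
  show nonneg: "0 \<le> y \<Longrightarrow> 0 \<le> multichoose k y" for y k
    unfolding multichoose_def pochhammer_prod by (intro divide_nonneg_pos prod_nonneg) auto
  show "multichoose k \<in> borel_measurable borel" for k
    using borel_open[OF open_discrete] by (auto simp: measurable_def)
  show "multichoose n (y + z) = (\<Sum>l\<le>n. multichoose (n - l) y * multichoose l z)" for y z n
  proof -
    have "multichoose n (y + z)
      = (\<Sum>l\<le>n. of_nat (n choose l) * pochhammer (real_of_int z) l * pochhammer (real_of_int y) (n - l) / fact n)"
      unfolding multichoose_def
      by (simp add: add.commute[of "real_of_int y"] pochhammer_binomial_sum sum_divide_distrib)
    also have "\<dots> = (\<Sum>l\<le>n. multichoose (n - l) y * multichoose l z)"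
      by (intro sum.cong) (auto simp: multichoose_def binomial_fact field_simps)
    finally show ?thesis .
  qed
  show "(\<integral>\<^sup>+r. ennreal (of_bool (0 \<le> r \<and> r \<le> s) * (multichoose k (r + 1) * multichoose l (s - r + 1))) \<partial>count_space UNIV)
      = ennreal (multichoose (Suc (k + l)) (s + 1))" if s: "0 \<le> s" for s k l
  proof -
    obtain n where n: "s = int n" using s nonneg_int_cases by blast
    have "(\<integral>\<^sup>+r. ennreal (of_bool (0 \<le> r \<and> r \<le> s) * (multichoose k (r + 1) * multichoose l (s - r + 1))) \<partial>count_space UNIV)
      = (\<Sum>r\<in>{0..s}. ennreal (of_bool (0 \<le> r \<and> r \<le> s) * (multichoose k (r + 1) * multichoose l (s - r + 1))))"
      by (rule nn_integral_count_space') auto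
    also have "\<dots> = (\<Sum>r\<in>{0..s}. ennreal (multichoose k (r + 1) * multichoose l (s - r + 1)))"
      by (rule sum.cong) auto
    also have "\<dots> = ennreal (\<Sum>r\<in>{0..s}. multichoose k (r + 1) * multichoose l (s - r + 1))"
      by (rule sum_ennreal) (auto intro!: mult_nonneg_nonneg nonneg)
    also have "(\<Sum>r\<in>{0..s}. multichoose k (r + 1) * multichoose l (s - r + 1))
      = (\<Sum>r\<le>n. multichoose k (int r + 1) * multichoose l (s - int r + 1))"
      unfolding n image_int_atLeastAtMost[of 0 n, symmetric, simplified]
      by (subst sum.reindex) (auto simp: atMost_atLeast0)
    also have "\<dots> = (\<Sum>r\<le>n. multichoose k (int r + 1) * multichoose l (int (n - r) + 1))"
      by (rule sum.cong) (auto simp: n of_nat_diff)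
    finally show ?thesis by (simp only: n sum_multichoose)
  qed
qed simp

section \<open>Volume and number of integer points of a flow polytope\<close>

context flow_graph
begin

lemma disjoint_free_out: "v \<noteq> w \<Longrightarrow> free_out v \<inter> free_out w = {}"
  by (auto simp: free_out_iff)

text \<open>Each \<open>k e\<close> is added at the tail of e and subtracted at its head, so only
  the number of free arcs survives. Arcs into sinks do not disturb the balance, because their
  exponent is 0.\<close>

lemma sum_exponent:
  assumes "k \<in> exponents 0"
  shows "(\<Sum>v<N. exponent k v) = card free"
proof -
  have "(\<Sum>v<N. sum k (Out v)) = sum k (\<Union>v<N. Out v)"
    by (rule sum.UNION_disjoint[symmetric]) (auto simp: Out_def finite_E)
  also have "(\<Union>v<N. Out v) = E" using t_less_N by (auto simp: Out_def)
  finally have 1: "(\<Sum>v<N. sum k (Out v)) = sum k E" .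
  have "(\<Sum>v<N. sum k (In v)) = sum k (\<Union>v<N. In v)"
    by (rule sum.UNION_disjoint[symmetric]) (auto simp: In_def finite_E)
  also have "\<dots> = sum k E"
    by (rule sum.mono_neutral_left)
      (use finite_E in \<open>auto simp: In_def intro!: exponents_zero[OF assms]\<close>)
  finally have 2: "(\<Sum>v<N. sum k (In v)) = sum k E" .
  have "(\<Sum>v<N. card (free_out v)) = card (\<Union>v<N. free_out v)"
    by (rule card_UN_disjoint[symmetric]) (auto dest: disjoint_free_out simp: free_out_iff)
  also have "(\<Union>v<N. free_out v) = free" using t_less_N by (auto simp: free_out_iff free_iff)
  finally have 3: "(\<Sum>v<N. card (free_out v)) = card free" .
  have "exponent k v + sum k (In v) = card (free_out v) + sum k (Out v)" if "v < N" for v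
    using assms that by (auto simp: exponent_def exponents_def)
  then have "(\<Sum>v<N. exponent k v + sum k (In v)) = (\<Sum>v<N. card (free_out v) + sum k (Out v))"
    by simp
  then show ?thesis by (simp add: sum.distrib 1 2 3)
qed

lemma card_free: "card free = card E - N"
proof -
  have "inj_on sp {..<N}" by (rule inj_on_inverseI[of _ t]) (simp add: t_sp)
  moreover have "sp ` {..<N} \<subseteq> E" using sp_in by auto
  ultimately show ?thesis unfolding free_def
    by (simp add: card_Diff_subset card_image)
qed

text \<open>Makes the sum over exponent vectors nonempty, which yields a positive leading
  coefficient later.\<close>

lemma zero_exponents: "(\<lambda>_. 0) \<in> exponents 0"
  by (auto simp: exponents_def)

lemma normalized_volume_flow_eq_sum:
  fixes a :: "nat \<Rightarrow> real"
  assumes "\<And>v. v < N \<Longrightarrow> 0 \<le> a v"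
  shows "normalized_volume {b. flow a b} {b. flow a b \<and> (\<forall>e\<in>E. 0 \<le> b e)}
    = fact (card free) * (\<Sum>k\<in>exponents 0. \<Prod>v<N. a v ^ exponent k v / fact (exponent k v))"
proof -
  interpret lidskii E t h N sp lborel "\<lambda>k y. y ^ k / fact k" 0 a
    by unfold_locales (use assms in auto)
  have "0 \<le> (\<Sum>k\<in>exponents 0. \<Prod>v<N. a v ^ exponent k v / fact (exponent k v))"
    by (intro sum_nonneg prod_nonneg) (use assms in auto)
  then show ?thesis
    using lidskii_formula by (simp add: normalized_volume_flow measure_def y_def)
qed

definition nonneg_flows :: "(nat \<Rightarrow> int) \<Rightarrow> ('e \<Rightarrow> nat) set" where
  "nonneg_flows a = {b. flow a (\<lambda>e. int (b e))}"

lemma bij_betw_nonneg_flows: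
  "bij_betw (\<lambda>b. restrict (\<lambda>e. int (b e)) free) (nonneg_flows a) {b \<in> free \<rightarrow>\<^sub>E UNIV. nonneg a N b}"
proof (rule bij_betw_byWitness[where f' = "\<lambda>b e. nat (ext a b e)"])
  show "\<forall>b\<in>nonneg_flows a. (\<lambda>e. nat (ext a (restrict (\<lambda>e. int (b e)) free) e)) = b"
    by (auto simp: nonneg_flows_def ext_restrict ext_eq_flow)
  have int_nat: "(\<lambda>e. int (nat (ext a b e))) = ext a b" if "nonneg a N b" for b
  proof
    fix e show "int (nat (ext a b e)) = ext a b e"
      using that by (cases "e \<in> E") (auto simp: nonneg_N ext_outside)
  qed
  show "\<forall>b\<in>{b \<in> free \<rightarrow>\<^sub>E UNIV. nonneg a N b}. restrict (\<lambda>e. int (nat (ext a b e))) free = b"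
  proof
    fix b assume b: "b \<in> {b \<in> free \<rightarrow>\<^sub>E UNIV. nonneg a N b}"
    then have "restrict (\<lambda>e. int (nat (ext a b e))) free = restrict (ext a b) free"
      using int_nat by simp
    also have "\<dots> = b" using b by (auto simp: fun_eq_iff ext_free restrict_def PiE_def extensional_def)
    finally show "restrict (\<lambda>e. int (nat (ext a b e))) free = b" .
  qed
  show "(\<lambda>b. restrict (\<lambda>e. int (b e)) free) ` nonneg_flows a \<subseteq> {b \<in> free \<rightarrow>\<^sub>E UNIV. nonneg a N b}"
    by (auto simp: nonneg_flows_def nonneg_N ext_restrict ext_eq_flow)
  show "(\<lambda>b e. nat (ext a b e)) ` {b \<in> free \<rightarrow>\<^sub>E UNIV. nonneg a N b} \<subseteq> nonneg_flows a"
    using int_nat flow_ext by (auto simp: nonneg_flows_def)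
qed

lemma card_nonneg_flows:
  assumes a: "\<And>v. v < N \<Longrightarrow> int (card (In v)) \<le> a v"
  shows "real (card (nonneg_flows a))
    = (\<Sum>k\<in>exponents 0. \<Prod>v<N. multichoose (exponent k v) (a v + 1 - int (card (In v))))"
proof -
  interpret lidskii E t h N sp "count_space (UNIV :: int set)" multichoose 1 a
    by unfold_locales (use a in auto)
  let ?S = "{b \<in> free \<rightarrow>\<^sub>E UNIV. nonneg a N b}"
  let ?r = "\<Sum>k\<in>exponents 0. \<Prod>v<N. multichoose (exponent k v) (a v + 1 - int (card (In v)))"
  have PiM: "PiM free (\<lambda>_. count_space (UNIV :: int set)) = count_space (free \<rightarrow>\<^sub>E UNIV)"
    by (rule count_space_PiM_finite) auto
  have em: "emeasure (count_space (free \<rightarrow>\<^sub>E UNIV)) ?S = ennreal ?r"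
    using lidskii_formula unfolding PiM by (simp add: y_def)
  have S: "?S \<subseteq> free \<rightarrow>\<^sub>E UNIV" by auto
  \<comment> \<open>Finiteness of the set of flows is read off from the formula: an infinite set
    would have infinite counting measure.\<close>
  have fin: "finite ?S"
  proof (rule ccontr)
    assume "infinite ?S"
    then show False using em by (simp add: emeasure_count_space[OF S])
  qed
  have "0 \<le> ?r"
  proof (intro sum_nonneg prod_nonneg ballI multichoose_kernel.P_nonneg)
    fix v assume "v \<in> {..<N}" then show "0 \<le> a v + 1 - int (card (In v))" using a[of v] by simp
  qed
  then have "real (card ?S) = ?r"
    using em fin by (simp add: emeasure_count_space[OF S] ennreal_of_nat_eq_real_of_nat)
  then show ?thesis using bij_betw_same_card[OF bij_betw_nonneg_flows] by metis
qed

end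

section \<open>The Kostant partition function as a polynomial\<close>

definition multichoose_poly :: "nat \<Rightarrow> real poly" where
  "multichoose_poly k = smult (1 / fact k) (pochhammer [:0, 1:] k)"

lemma poly_multichoose_poly: "poly (multichoose_poly k) (real x) = multichoose k (int x)"
proof -
  have "poly (pochhammer [:0, 1:] k) y = pochhammer y k" for y :: real
    by (induction k) (simp_all add: pochhammer_Suc)
  then show ?thesis by (simp add: multichoose_poly_def multichoose_def)
qed

lemma degree_lead_coeff_multichoose_poly:
  "degree (multichoose_poly k) = k" "lead_coeff (multichoose_poly k) = 1 / fact k"
proof -
  have "degree (pochhammer [:0, 1 :: real:] k) = k \<and> lead_coeff (pochhammer [:0, 1 :: real:] k) = 1"
  proof (induction k)
    case (Suc k)
    have lin: "[:0, 1 :: real:] + of_nat k = [:real k, 1:]" by (simp add: of_nat_poly)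
    let ?q = "pochhammer [:0, 1 :: real:] k" and ?r = "[:real k, 1:]"
    have "?q \<noteq> 0" using Suc by auto
    then have d: "degree (?q * ?r) = degree ?q + degree ?r" by (intro degree_mult_eq) simp_all
    have l: "lead_coeff (?q * ?r) = lead_coeff ?q * lead_coeff ?r" by (rule lead_coeff_mult)
    have q: "degree ?q = k" "lead_coeff ?q = 1" using Suc by blast+
    have "degree (?q * ?r) = Suc k" unfolding d q(1) by simp
    moreover have "lead_coeff (?q * ?r) = 1" unfolding l q(2) by simp
    ultimately show ?case unfolding pochhammer_Suc lin by blast
  qed simp
  then have q: "degree (pochhammer [:0, 1 :: real:] k) = k" "lead_coeff (pochhammer [:0, 1 :: real:] k) = 1"
    by blast+
  show "degree (multichoose_poly k) = k" by (simp add: multichoose_poly_def q(1))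
  show "lead_coeff (multichoose_poly k) = 1 / fact k"
    unfolding multichoose_poly_def lead_coeff_smult q(2) by simp
qed

lemma coeff_mult_nonneg:
  fixes p q :: "real poly"
  assumes "\<And>i. 0 \<le> coeff p i" "\<And>i. 0 \<le> coeff q i"
  shows "0 \<le> coeff (p * q) i"
  unfolding coeff_mult by (intro sum_nonneg mult_nonneg_nonneg assms)

lemma coeff_multichoose_poly_nonneg: "0 \<le> coeff (multichoose_poly k) i"
proof -
  have "0 \<le> coeff (pochhammer [:0, 1 :: real:] k) i" for i
  proof (induction k arbitrary: i)
    case 0
    then show ?case by (simp add: coeff_1)
  next
    case (Suc k)
    have lin: "[:0, 1 :: real:] + of_nat k = [:real k, 1:]" by (simp add: of_nat_poly)
    show ?case unfolding pochhammer_Suc lin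
      by (intro coeff_mult_nonneg Suc) (auto simp: coeff_pCons split: nat.split)
  qed
  then show ?thesis by (simp add: multichoose_poly_def)
qed

lemma coeff_prod_nonneg:
  fixes f :: "'x \<Rightarrow> real poly"
  assumes "\<And>x i. 0 \<le> coeff (f x) i"
  shows "0 \<le> coeff (prod f A) i"
proof (induction A arbitrary: i rule: infinite_finite_induct)
  case (insert x A)
  then show ?case by (simp add: coeff_mult_nonneg assms)
qed (auto simp: coeff_1)

text \<open>All products have the same degree d and a positive leading coefficient, so the leading
  terms cannot cancel in the sum.\<close>

lemma sum_prod_multichoose_poly:
  fixes K :: "'k set" and j :: "'k \<Rightarrow> nat \<Rightarrow> nat"
  assumes K: "finite K" "K \<noteq> {}" and j: "\<And>k. k \<in> K \<Longrightarrow> (\<Sum>v<n. j k v) = d"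
  defines "p \<equiv> (\<Sum>k\<in>K. \<Prod>v<n. multichoose_poly (j k v))"
  shows "poly p (real x) = (\<Sum>k\<in>K. \<Prod>v<n. multichoose (j k v) (int x))"
    and "0 \<le> coeff p i"
    and "coeff p d = (\<Sum>k\<in>K. \<Prod>v<n. 1 / fact (j k v))"
    and "degree p = d" and "p \<noteq> 0"
proof -
  have nz: "multichoose_poly i \<noteq> 0" for i
    using degree_lead_coeff_multichoose_poly(2)[of i] by auto
  have deg: "degree (\<Prod>v<n. multichoose_poly (j k v)) = d" if "k \<in> K" for k
    using j[OF that] nz by (simp add: degree_prod_sum_eq degree_lead_coeff_multichoose_poly)
  have lead: "coeff (\<Prod>v<n. multichoose_poly (j k v)) d = (\<Prod>v<n. 1 / fact (j k v))" if "k \<in> K" for k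
    using lead_coeff_prod[of "\<lambda>v. multichoose_poly (j k v)" "{..<n}"] deg[OF that]
      degree_lead_coeff_multichoose_poly by simp
  show "poly p (real x) = (\<Sum>k\<in>K. \<Prod>v<n. multichoose (j k v) (int x))"
    by (simp add: p_def poly_sum poly_prod poly_multichoose_poly)
  show "0 \<le> coeff p i"
    unfolding p_def coeff_sum by (intro sum_nonneg coeff_prod_nonneg coeff_multichoose_poly_nonneg)
  show *: "coeff p d = (\<Sum>k\<in>K. \<Prod>v<n. 1 / fact (j k v))"
    unfolding p_def coeff_sum by (rule sum.cong[OF refl lead])
  have "0 < (\<Sum>k\<in>K. \<Prod>v<n. 1 / fact (j k v) :: real)"
    using K by (intro sum_pos prod_pos) auto
  then have nonzero: "coeff p d \<noteq> 0" using * by simp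
  have "degree p \<le> d" unfolding p_def by (rule degree_sum_le[OF K(1)]) (simp add: deg)
  then show "degree p = d" using le_degree[OF nonzero] by simp
  show "p \<noteq> 0" using nonzero by auto
qed

section \<open>Integer flows on the ordered graph\<close>

locale ordered_digraph = fin_digraph G for G :: "(nat, 'e) pre_digraph" +
  fixes n :: nat
  assumes verts_G: "verts G = {1..n + 1}"
    and ordered: "e \<in> arcs G \<Longrightarrow> tail G e < head G e"
begin

lemma tail_bounds: "e \<in> arcs G \<Longrightarrow> 1 \<le> tail G e \<and> tail G e \<le> n"
  using tail_in_verts[of e] head_in_verts[of e] ordered[of e] by (auto simp: verts_G)

lemma head_bounds: "e \<in> arcs G \<Longrightarrow> 2 \<le> head G e \<and> head G e \<le> n + 1"
  using tail_in_verts[of e] head_in_verts[of e] ordered[of e] by (auto simp: verts_G)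

lemma finite_arc_sets [simp]: "finite (out_arcs G v)" "finite (in_arcs G v)"
  by (auto simp: out_arcs_def in_arcs_def)

lemma Max_verts: "verts G - {Max (verts G)} = {1..n}"
proof -
  have "Max (verts G) = n + 1" unfolding verts_G by (rule Max_eqI) auto
  then show ?thesis by (auto simp: verts_G)
qed

definition integer_flows :: "(nat \<Rightarrow> int) \<Rightarrow> ('e \<Rightarrow> nat) set" where
  "integer_flows v = {b. (\<forall>e. e \<notin> arcs G \<longrightarrow> b e = 0) \<and>
     (\<forall>i\<in>{1..n}. (\<Sum>e\<in>out_arcs G i. int (b e)) = v i + (\<Sum>e\<in>in_arcs G i. int (b e)))}"

text \<open>The net flows of all vertices add up to 0, so the balance at the last vertex follows
  from the others. The remaining difference is one of encoding: values outside the arcs are 0 here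
  and undefined in the Kostant partition function.\<close>

lemma kostant_eq_card_integer_flows:
  assumes v: "v (n + 1) = - (\<Sum>i=1..n. v i)"
  shows "kostant G v = card (integer_flows v)"
proof -
  define D :: "('e \<Rightarrow> nat) \<Rightarrow> nat \<Rightarrow> int" where
    "D b k = (\<Sum>e\<in>arcs G. int (b e) * (of_bool (k = tail G e) - of_bool (k = head G e)))" for b k
  have D: "D b k = (\<Sum>e\<in>out_arcs G k. int (b e)) - (\<Sum>e\<in>in_arcs G k. int (b e))" for b k
  proof -
    have "(\<Sum>e\<in>out_arcs G k. int (b e)) = (\<Sum>e\<in>arcs G. int (b e) * of_bool (k = tail G e))"
      unfolding out_arcs_def by (rule sum.mono_neutral_cong_left) auto
    moreover have "(\<Sum>e\<in>in_arcs G k. int (b e)) = (\<Sum>e\<in>arcs G. int (b e) * of_bool (k = head G e))"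
      unfolding in_arcs_def by (rule sum.mono_neutral_cong_left) auto
    ultimately show ?thesis by (simp add: D_def right_diff_distrib sum_subtractf)
  qed
  have total: "(\<Sum>k\<in>verts G. D b k) = 0" for b
  proof -
    have "(\<Sum>k\<in>verts G. D b k)
      = (\<Sum>e\<in>arcs G. int (b e) * (\<Sum>k\<in>verts G. of_bool (k = tail G e) - of_bool (k = head G e)))"
      unfolding D_def sum_distrib_left by (rule sum.swap)
    also have "\<dots> = 0"
    proof (rule sum.neutral, rule ballI)
      fix e assume e: "e \<in> arcs G"
      have "(\<Sum>k\<in>verts G. of_bool (k = w) :: int) = 1" if "w \<in> verts G" for w
        using that finite_verts by (simp add: of_bool_def)
      then show "int (b e) * (\<Sum>k\<in>verts G. of_bool (k = tail G e) - of_bool (k = head G e)) = 0"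
        using tail_in_verts[OF e] head_in_verts[OF e] by (simp add: sum_subtractf)
    qed
    finally show ?thesis .
  qed
  have verts_insert: "verts G = insert (n + 1) {1..n}" by (auto simp: verts_G)
  have all: "(\<forall>k\<in>verts G. D b k = v k) \<longleftrightarrow> (\<forall>k\<in>{1..n}. D b k = v k)" for b
  proof
    assume *: "\<forall>k\<in>{1..n}. D b k = v k"
    have "D b (n + 1) + (\<Sum>k=1..n. D b k) = 0"
      using total[of b] unfolding verts_insert by (subst (asm) sum.insert) auto
    moreover have "(\<Sum>k=1..n. D b k) = (\<Sum>k=1..n. v k)" using * by simp
    ultimately have "D b (n + 1) = v (n + 1)" using v by simp
    then show "\<forall>k\<in>verts G. D b k = v k" unfolding verts_insert using * by blast
  qed (auto simp: verts_G)
  have D_cong: "D b k = D c k" if "\<And>e. e \<in> arcs G \<Longrightarrow> b e = c e" for b c k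
    unfolding D_def by (rule sum.cong) (use that in auto)
  have D_restrict: "D (restrict b (arcs G)) k = D b k" for b k by (rule D_cong) simp
  have D_extend: "D (\<lambda>e. if e \<in> arcs G then b e else 0) k = D b k" for b k by (rule D_cong) simp
  have flows: "integer_flows v = {b. (\<forall>e. e \<notin> arcs G \<longrightarrow> b e = 0) \<and> (\<forall>k\<in>{1..n}. D b k = v k)}"
    unfolding integer_flows_def D by (auto simp: algebra_simps)
  have "bij_betw (\<lambda>b. restrict b (arcs G)) (integer_flows v)
      {b \<in> arcs G \<rightarrow>\<^sub>E UNIV. \<forall>k\<in>verts G. D b k = v k}"
  proof (rule bij_betw_byWitness[where f' = "\<lambda>b e. if e \<in> arcs G then b e else 0"])
    show "\<forall>b\<in>integer_flows v. (\<lambda>e. if e \<in> arcs G then restrict b (arcs G) e else 0) = b"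
      by (auto simp: flows fun_eq_iff)
    show "\<forall>b\<in>{b \<in> arcs G \<rightarrow>\<^sub>E UNIV. \<forall>k\<in>verts G. D b k = v k}.
        restrict (\<lambda>e. if e \<in> arcs G then b e else 0) (arcs G) = b"
      by (auto simp: fun_eq_iff PiE_def extensional_def restrict_def)
    show "(\<lambda>b. restrict b (arcs G)) ` integer_flows v \<subseteq> {b \<in> arcs G \<rightarrow>\<^sub>E UNIV. \<forall>k\<in>verts G. D b k = v k}"
      unfolding flows all by (auto simp: D_restrict)
    show "(\<lambda>b e. if e \<in> arcs G then b e else 0) ` {b \<in> arcs G \<rightarrow>\<^sub>E UNIV. \<forall>k\<in>verts G. D b k = v k}
        \<subseteq> integer_flows v"
      unfolding flows all by (auto simp: D_extend)
  qed
  then show ?thesis unfolding kostant_def D_def by (simp add: bij_betw_same_card)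
qed

lemma in_arcs_1: "in_arcs G 1 = {}"
  by (force simp: in_arcs_def dest: head_bounds)

text \<open>Vertex 1 has no incoming arc, so it would need the outflow u_1 = -1.\<close>

lemma integer_flows_0:
  assumes "1 \<le> n" and u: "\<forall>i\<in>{1..n}. u i = shifted_indegree G i" and "x = 0"
  shows "integer_flows (\<lambda>i. int x + u i) = {}"
proof -
  have "u 1 = -1" using u \<open>1 \<le> n\<close> in_arcs_1 by (simp add: shifted_indegree_def in_degree_def)
  have "b \<notin> integer_flows (\<lambda>i. int x + u i)" for b
  proof
    assume "b \<in> integer_flows (\<lambda>i. int x + u i)"
    then have "(\<Sum>e\<in>out_arcs G 1. int (b e)) = int x + u 1 + (\<Sum>e\<in>in_arcs G 1. int (b e))"
      using \<open>1 \<le> n\<close> unfolding integer_flows_def by auto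
    moreover have "0 \<le> (\<Sum>e\<in>out_arcs G 1. int (b e))" by (rule sum_nonneg) simp
    ultimately show False using \<open>u 1 = -1\<close> \<open>x = 0\<close> in_arcs_1 by simp
  qed
  then show ?thesis by auto
qed

text \<open>An incoming arc makes u_i nonnegative, so at least x >= 1 units would have to leave a
  vertex without outgoing arcs.\<close>

lemma integer_flows_no_out:
  assumes u: "\<forall>i\<in>{1..n}. u i = shifted_indegree G i" and "1 \<le> x"
    and i: "i \<in> {1..n}" "out_arcs G i = {}" "in_arcs G i \<noteq> {}"
  shows "integer_flows (\<lambda>i. int x + u i) = {}"
proof -
  have "0 < card (in_arcs G i)" using i(3) by (simp add: card_gt_0_iff)
  then have "0 \<le> u i" using u i(1) by (simp add: shifted_indegree_def in_degree_def)
  have "b \<notin> integer_flows (\<lambda>i. int x + u i)" for b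
  proof
    assume "b \<in> integer_flows (\<lambda>i. int x + u i)"
    then have "(\<Sum>e\<in>out_arcs G i. int (b e)) = int x + u i + (\<Sum>e\<in>in_arcs G i. int (b e))"
      using i(1) unfolding integer_flows_def by auto
    moreover have "0 \<le> (\<Sum>e\<in>in_arcs G i. int (b e))" by (rule sum_nonneg) simp
    ultimately show False using \<open>0 \<le> u i\<close> \<open>1 \<le> x\<close> i(2) by simp
  qed
  then show ?thesis by auto
qed

lemma flow_volume_no_out:
  assumes i: "i \<in> {1..n}" "out_arcs G i = {}"
  shows "flow_volume G (\<lambda>_. 1) = 0"
proof -
  have "b \<notin> flow_polytope G (\<lambda>_. 1)" for b
  proof
    assume b: "b \<in> flow_polytope G (\<lambda>_. 1)"
    then have "net_flow G b i = 1"
      using i(1) unfolding flow_polytope_def flow_space_def Max_verts by auto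
    moreover have "0 \<le> sum b (in_arcs G i)"
      using b by (intro sum_nonneg) (auto simp: flow_polytope_def in_arcs_def)
    ultimately show False using i(2) by (simp add: net_flow_def)
  qed
  then have "flow_polytope G (\<lambda>_. 1) = {}" by auto
  then show ?thesis by (simp add: flow_volume_def normalized_volume_def Let_def)
qed

text \<open>Count and volume are expressed over the same K and j. This is what identifies the
  leading coefficient: the leading coefficient of each multichoose product is the corresponding
  volume term for net flows 1. Vertices are renumbered from 0 to fit
  \<open>flow_graph\<close>.\<close>

lemma lidskii_expansion:
  assumes out: "\<forall>i\<in>{1..n}. out_arcs G i \<noteq> {}"
    and u: "\<forall>i\<in>{1..n}. u i = shifted_indegree G i"
  obtains K :: "('e \<Rightarrow> nat) set" and j where
    "finite K" "K \<noteq> {}" "\<And>k. k \<in> K \<Longrightarrow> (\<Sum>v<n. j k v) = card (arcs G) - n"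
    "\<And>x. 1 \<le> x \<Longrightarrow> real (card (integer_flows (\<lambda>i. int x + u i))) = (\<Sum>k\<in>K. \<Prod>v<n. multichoose (j k v) (int x))"
    "flow_volume G (\<lambda>_. 1) = fact (card (arcs G) - n) * (\<Sum>k\<in>K. \<Prod>v<n. 1 / fact (j k v))"
proof -
  define sp where "sp v = (SOME e. e \<in> out_arcs G (Suc v))" for v
  have sp: "sp v \<in> arcs G \<and> tail G (sp v) = Suc v" if "v < n" for v
  proof -
    have "out_arcs G (Suc v) \<noteq> {}" using out that by auto
    then have "sp v \<in> out_arcs G (Suc v)" unfolding sp_def by (rule some_in_eq[THEN iffD2])
    then show ?thesis by (simp add: out_arcs_def)
  qed
  define t where "t e = tail G e - 1" for e
  define h where "h e = head G e - 1" for e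
  interpret F: flow_graph "arcs G" t h n sp
  proof
    fix e assume e: "e \<in> arcs G"
    show "t e < n" "t e < h e"
      using tail_bounds[OF e] ordered[OF e] by (auto simp: t_def h_def)
  qed (use sp in \<open>auto simp: t_def\<close>)
  have Out: "F.Out v = out_arcs G (Suc v)" and In: "F.In v = in_arcs G (Suc v)" for v
    using tail_bounds head_bounds unfolding F.Out_def F.In_def out_arcs_def in_arcs_def t_def h_def by force+
  have shift: "(\<forall>v<n. Q (Suc v)) \<longleftrightarrow> (\<forall>i\<in>{1..n}. Q i)" for Q
  proof
    assume *: "\<forall>v<n. Q (Suc v)"
    show "\<forall>i\<in>{1..n}. Q i"
    proof
      fix i assume "i \<in> {1..n}"
      then have "i - 1 < n" "Suc (i - 1) = i" by auto
      then show "Q i" using * by metis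
    qed
  qed auto
  show thesis
  proof (rule that[of "F.exponents 0" F.exponent])
    show "finite (F.exponents 0)" by (rule F.finite_exponents) simp
    show "F.exponents 0 \<noteq> {}" using F.zero_exponents by auto
    show "(\<Sum>v<n. F.exponent k v) = card (arcs G) - n" if "k \<in> F.exponents 0" for k
      using F.sum_exponent[OF that] F.card_free by simp
    show "real (card (integer_flows (\<lambda>i. int x + u i))) = (\<Sum>k\<in>F.exponents 0. \<Prod>v<n. multichoose (F.exponent k v) (int x))"
      if x: "1 \<le> x" for x
    proof -
      let ?a = "\<lambda>v. int x + u (Suc v)"
      \<comment> \<open>The shifted in-degree cancels the correction by the in-degree in the
        counting formula, which leaves x as the argument of every kernel.\<close>
      have u': "u (Suc v) = int (card (F.In v)) - 1" if "v < n" for v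
        using u that by (simp add: In shifted_indegree_def in_degree_def)
      have "integer_flows (\<lambda>i. int x + u i) = F.nonneg_flows ?a"
        unfolding integer_flows_def F.nonneg_flows_def F.flow_def Out In
        by (subst shift) auto
      also have "real (card \<dots>) = (\<Sum>k\<in>F.exponents 0. \<Prod>v<n. multichoose (F.exponent k v) (?a v + 1 - int (card (F.In v))))"
        by (rule F.card_nonneg_flows) (use x u' in auto)
      also have "\<dots> = (\<Sum>k\<in>F.exponents 0. \<Prod>v<n. multichoose (F.exponent k v) (int x))"
        by (intro sum.cong prod.cong) (auto simp: u')
      finally show ?thesis .
    qed
    have space: "flow_space G (\<lambda>_. 1) = {b. F.flow (\<lambda>_. 1) b}"
      unfolding flow_space_def Max_verts F.flow_def Out In net_flow_def
      by (subst shift) (auto simp: algebra_simps)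
    have polytope: "flow_polytope G (\<lambda>_. 1) = {b. F.flow (\<lambda>_. 1) b \<and> (\<forall>e\<in>arcs G. 0 \<le> b e)}"
      unfolding flow_polytope_def space by auto
    show "flow_volume G (\<lambda>_. 1) = fact (card (arcs G) - n) * (\<Sum>k\<in>F.exponents 0. \<Prod>v<n. 1 / fact (F.exponent k v))"
      unfolding flow_volume_def space polytope
      by (subst F.normalized_volume_flow_eq_sum) (simp_all add: F.card_free)
  qed
qed

end

section \<open>The graph with an added source\<close>

text \<open>An undirected path to a second vertex begins with an arc at v, in one of the two
  directions.\<close>

lemma (in wf_digraph) connected_incident:
  assumes conn: "Digraph_Component.connected G" and v: "v \<in> verts G" and w: "w \<in> verts G" "w \<noteq> v"
  shows "out_arcs G v \<noteq> {} \<or> in_arcs G v \<noteq> {}"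
proof -
  have "(v, w) \<in> rtrancl_on (verts G) ((arcs_ends G)\<^sup>s)"
    using conn v w unfolding connected_conv by auto
  then obtain z where "(v, z) \<in> (arcs_ends G)\<^sup>s"
    by (cases rule: converse_rtrancl_on_cases) (use w in auto)
  then show ?thesis by (auto simp: symcl_def arcs_ends_conv)
qed

lemma sum_net_flow:
  assumes "finite (arcs H)" "finite (verts H)" "tail H ` arcs H \<subseteq> verts H" "head H ` arcs H \<subseteq> verts H"
  shows "(\<Sum>v\<in>verts H. net_flow H b v) = 0"
proof -
  have "(\<Sum>v\<in>verts H. sum b (out_arcs H v)) = sum b (arcs H)"
    unfolding out_arcs_def by (rule sum.group) (use assms in auto)
  moreover have "(\<Sum>v\<in>verts H. sum b (in_arcs H v)) = sum b (arcs H)"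
    unfolding in_arcs_def by (rule sum.group) (use assms in auto)
  ultimately show ?thesis by (simp add: net_flow_def sum_subtractf)
qed

context ordered_digraph
begin

abbreviation "source_graph x \<equiv> add_source n x G"

lemma source_graph_simps:
  "verts (source_graph x) = {0..n + 1}"
  "arcs (source_graph x) = Inl ` arcs G \<union> Inr ` ({1..n} \<times> {..<x})"
  "tail (source_graph x) (Inl e) = tail G e" "head (source_graph x) (Inl e) = head G e"
  "tail (source_graph x) (Inr p) = 0" "head (source_graph x) (Inr p) = fst p"
  by (auto simp: add_source_def verts_G Plus_def)

lemma source_graph_out_arcs: "1 \<le> v \<Longrightarrow> out_arcs (source_graph x) v = Inl ` out_arcs G v"
  unfolding out_arcs_def source_graph_simps by (auto simp: source_graph_simps)

lemma source_graph_in_arcs: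
  "v \<in> {1..n} \<Longrightarrow> in_arcs (source_graph x) v = Inl ` in_arcs G v \<union> Inr ` ({v} \<times> {..<x})"
  unfolding in_arcs_def source_graph_simps by (auto simp: source_graph_simps)

lemma source_graph_in_arcs_0: "in_arcs (source_graph x) 0 = {}"
  unfolding in_arcs_def source_graph_simps using head_bounds by (force simp: source_graph_simps)

lemma source_graph_Max: "verts (source_graph x) - {Max (verts (source_graph x))} = {0..n}"
proof -
  have "Max (verts (source_graph x)) = n + 1" unfolding source_graph_simps by (rule Max_eqI) auto
  then show ?thesis by (auto simp: source_graph_simps)
qed

lemma source_graph_net_flow:
  "(\<Sum>v=0..n+1. net_flow (source_graph x) b v) = 0"
proof -
  have "(\<Sum>v\<in>verts (source_graph x). net_flow (source_graph x) b v) = 0"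
  proof (rule sum_net_flow)
    show "finite (arcs (source_graph x))" by (simp add: source_graph_simps)
    show "tail (source_graph x) ` arcs (source_graph x) \<subseteq> verts (source_graph x)"
      using tail_bounds by (auto simp: source_graph_simps) (meson le_SucI le_trans)+
    show "head (source_graph x) ` arcs (source_graph x) \<subseteq> verts (source_graph x)"
      using head_bounds by (auto simp: source_graph_simps)
  qed (simp add: source_graph_simps)
  then show ?thesis by (simp only: source_graph_simps)
qed

lemma E_poly_0: "E_poly n G 0 = 0"
proof -
  have "out_arcs (source_graph 0) 0 = {}"
    unfolding out_arcs_def source_graph_simps using tail_bounds by (force simp: source_graph_simps)
  then have "net_flow (source_graph 0) b 0 = 0" for b
    by (simp add: net_flow_def source_graph_in_arcs_0)
  then have "flow_polytope (source_graph 0) (\<lambda>v. if v = 0 then 1 else 0) = {}"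
    unfolding flow_polytope_def flow_space_def source_graph_Max by force
  then show ?thesis by (simp add: E_poly_def flow_volume_def normalized_volume_def Let_def)
qed

text \<open>With net flow 0 at all vertices of the reversed graph but the first, a term survives
  exactly when its other exponents vanish, and then equals the reciprocal of the factorial in the
  normalization. The volume is therefore a number of exponent vectors, and these are themselves
  integer flows on G.\<close>

theorem E_poly_eq_card_integer_flows:
  assumes u: "\<forall>i\<in>{1..n}. u i = shifted_indegree G i" and x: "1 \<le> x" and top: "in_arcs G (n + 1) \<noteq> {}"
  shows "E_poly n G x = real (card (integer_flows (\<lambda>i. int x + u i)))"
proof -
  let ?H = "source_graph x"
  \<comment> \<open>The graph is reversed: its vertex \<open>v\<close> is \<open>n + 1 - v\<close>, so that \<open>0\<close> becomes the sink.\<close>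
  define t where "t e = n + 1 - head ?H e" for e
  define h where "h e = n + 1 - tail ?H e" for e
  define sp where "sp v = (SOME e. e \<in> in_arcs ?H (n + 1 - v))" for v
  have head_H: "1 \<le> head ?H e \<and> head ?H e \<le> n + 1 \<and> tail ?H e < head ?H e" if "e \<in> arcs ?H" for e
  proof (cases e)
    case (Inl a)
    then show ?thesis using that head_bounds[of a] ordered[of a] by (auto simp: source_graph_simps)
  qed (use that in \<open>auto simp: source_graph_simps\<close>)
  \<comment> \<open>No added arc reaches n + 1, so there an arc of G is required
    (\<open>top\<close>); every other vertex has an added arc because x >= 1.\<close>
  have sp: "sp v \<in> in_arcs ?H (n + 1 - v)" if "v < n + 1" for v
  proof -
    have "in_arcs ?H (n + 1 - v) \<noteq> {}"
    proof (cases "v = 0")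
      case True
      obtain e where "e \<in> arcs G" "head G e = n + 1" using top by (auto simp: in_arcs_def)
      then have "Inl e \<in> in_arcs ?H (n + 1 - v)" using True by (simp add: in_arcs_def source_graph_simps)
      then show ?thesis by blast
    next
      case False
      then have "n + 1 - v \<in> {1..n}" using that by auto
      then have "Inr (n + 1 - v, 0) \<in> in_arcs ?H (n + 1 - v)"
        using x by (subst source_graph_in_arcs) auto
      then show ?thesis by blast
    qed
    then show ?thesis unfolding sp_def by (rule some_in_eq[THEN iffD2])
  qed
  interpret R: flow_graph "arcs ?H" t h "n + 1" sp
  proof
    show "finite (arcs ?H)" by (simp add: source_graph_simps)
    fix e assume e: "e \<in> arcs ?H"
    show "t e < n + 1" "t e < h e" using head_H[OF e] by (auto simp: t_def h_def)
  next
    fix v assume v: "v < n + 1"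
    show "sp v \<in> arcs ?H" "t (sp v) = v" using sp[OF v] v by (auto simp: t_def in_arcs_def)
  qed
  have Out: "R.Out v = in_arcs ?H (n + 1 - v)" and In: "R.In v = out_arcs ?H (n + 1 - v)" if "v < n + 1" for v
    using that head_H unfolding R.Out_def R.In_def out_arcs_def in_arcs_def t_def h_def by fastforce+
  have flip: "(\<forall>v<n + 1. Q (n + 1 - v)) \<longleftrightarrow> (\<forall>w\<in>{1..n + 1}. Q w)" for Q
  proof
    assume *: "\<forall>v<n + 1. Q (n + 1 - v)"
    show "\<forall>w\<in>{1..n + 1}. Q w"
    proof
      fix w assume "w \<in> {1..n + 1}"
      then have "n + 1 - w < n + 1" "n + 1 - (n + 1 - w) = w" by auto
      then show "Q w" using * by metis
    qed
  qed auto
  let ?e0 = "\<lambda>v. if v = 0 then 1 else (0 :: real)"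
  have flow_iff: "R.flow ?e0 b \<longleftrightarrow> b \<in> flow_space ?H (\<lambda>v. if v = 0 then 1 else 0)" for b
  proof -
    have "(\<forall>v<n + 1. sum b (R.Out v) = ?e0 v + sum b (R.In v))
      \<longleftrightarrow> (\<forall>v<n + 1. net_flow ?H b (n + 1 - v) = (if n + 1 - v = n + 1 then -1 else 0))"
      by (auto simp: Out In net_flow_def)
    also have "\<dots> \<longleftrightarrow> (\<forall>w\<in>{1..n + 1}. net_flow ?H b w = (if w = n + 1 then -1 else 0))"
      by (rule flip[of "\<lambda>w. net_flow ?H b w = (if w = n + 1 then -1 else 0)"])
    also have "\<dots> \<longleftrightarrow> net_flow ?H b (n + 1) = -1 \<and> (\<forall>w\<in>{1..n}. net_flow ?H b w = 0)"
      by (auto simp: le_Suc_eq)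
    \<comment> \<open>The flow space imposes no law at n + 1, the reversed graph none at 0. The net
      flows sum to 0, so the law at either vertex implies the law at the other.\<close>
    also have "\<dots> \<longleftrightarrow> net_flow ?H b 0 = 1 \<and> (\<forall>w\<in>{1..n}. net_flow ?H b w = 0)"
    proof -
      have "{0..n + 1} = insert 0 (insert (n + 1) {1..n})" by auto
      then have "net_flow ?H b 0 + (net_flow ?H b (n + 1) + (\<Sum>w=1..n. net_flow ?H b w)) = 0"
        using source_graph_net_flow[of x b] by simp
      moreover have "(\<Sum>w=1..n. net_flow ?H b w) = 0" if "\<forall>w\<in>{1..n}. net_flow ?H b w = 0"
        using that by simp
      ultimately show ?thesis by auto
    qed
    also have "\<dots> \<longleftrightarrow> (\<forall>v\<in>{0..n}. net_flow ?H b v = of_int (if v = 0 then 1 else 0))"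
    proof -
      have "{0..n} = insert 0 {1..n}" by auto
      then show ?thesis by auto
    qed
    finally show ?thesis unfolding R.flow_def flow_space_def source_graph_Max by simp
  qed
  \<comment> \<open>The terms that survive: a zero net flow contributes 0^0 = 1 for exponent 0 and 0
    otherwise. By \<open>sum_exponent\<close> the whole degree then sits at vertex 0.\<close>
  define K where "K = {k \<in> R.exponents 0. \<forall>v\<in>{1..n}. R.exponent k v = 0}"
  have "E_poly n G x = normalized_volume {b. R.flow ?e0 b} {b. R.flow ?e0 b \<and> (\<forall>e\<in>arcs ?H. 0 \<le> b e)}"
    unfolding E_poly_def flow_volume_def flow_polytope_def flow_iff by simp
  also have "\<dots> = fact (card R.free) *
      (\<Sum>k\<in>R.exponents 0. \<Prod>v<n + 1. ?e0 v ^ R.exponent k v / fact (R.exponent k v))"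
    by (rule R.normalized_volume_flow_eq_sum) simp
  also have "\<dots> = fact (card R.free) * (\<Sum>k\<in>R.exponents 0. of_bool (k \<in> K) / fact (card R.free))"
  proof -
    have "(\<Prod>v<n + 1. ?e0 v ^ R.exponent k v / fact (R.exponent k v)) = of_bool (k \<in> K) / fact (card R.free)"
      if k: "k \<in> R.exponents 0" for k
    proof -
      have split: "{..<n + 1} = insert 0 {1..n}" by auto
      show ?thesis
      proof (cases "k \<in> K")
        case True
        then have z: "R.exponent k v = 0" if "v \<in> {1..n}" for v using that by (auto simp: K_def)
        have "R.exponent k 0 = card R.free"
          using R.sum_exponent[OF k] unfolding split by (simp add: z)
        then show ?thesis using True unfolding split by (simp add: z)
      next
        case False
        then obtain v where "v \<in> {1..n}" "R.exponent k v \<noteq> 0" using k by (auto simp: K_def)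
        then have "\<exists>v\<in>{..<n + 1}. ?e0 v ^ R.exponent k v / fact (R.exponent k v) = 0"
          by (intro bexI[of _ v]) auto
        then have "(\<Prod>v<n + 1. ?e0 v ^ R.exponent k v / fact (R.exponent k v)) = 0"
          by (rule prod_zero[OF finite_lessThan])
        then show ?thesis using False by (simp only: of_bool_def if_False div_0)
      qed
    qed
    then show ?thesis by simp
  qed
  also have "\<dots> = real (card K)"
  proof -
    have "finite (R.exponents 0)" by (rule R.finite_exponents) simp
    then have "(\<Sum>k\<in>R.exponents 0. of_bool (k \<in> K) / fact (card R.free)) = (\<Sum>k\<in>K. 1 / fact (card R.free) :: real)"
      by (intro sum.mono_neutral_cong_right) (auto simp: K_def)
    then show ?thesis by simp
  qed
  also have "card K = card (integer_flows (\<lambda>i. int x + u i))"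
  proof (rule bij_betw_same_card[of "\<lambda>k e. k (Inl e)"])
    let ?ext = "\<lambda>b. case_sum b (\<lambda>_. 0 :: nat)"
    have sum_out: "sum k (out_arcs ?H w) = (\<Sum>e\<in>out_arcs G w. k (Inl e))" if "1 \<le> w" for k :: "_ \<Rightarrow> nat" and w
      unfolding source_graph_out_arcs[OF that] by (subst sum.reindex) auto
    have sum_in: "sum k (in_arcs ?H w) = (\<Sum>e\<in>in_arcs G w. k (Inl e))"
      if "w \<in> {1..n}" "\<And>p. k (Inr p) = 0" for k :: "_ \<Rightarrow> nat" and w
      unfolding source_graph_in_arcs[OF that(1)]
      by (subst sum.union_disjoint) (auto simp: that(2) sum.reindex)
    \<comment> \<open>Here x + u_i arises as a number of arcs: x added ones and indeg(i) old ones,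
      minus the determined arc.\<close>
    have card_free_out: "int (card (R.free_out v)) = int x + u (n + 1 - v)" if v: "v \<in> {1..n}" for v
    proof -
      have w: "n + 1 - v \<in> {1..n}" using v by auto
      have vN: "v < n + 1" using v by auto
      have "card (R.Out v) = card (in_arcs G (n + 1 - v)) + x"
        unfolding Out[OF vN] source_graph_in_arcs[OF w]
        by (subst card_Un_disjoint) (auto simp: card_image)
      moreover have "card (R.Out v) = Suc (card (R.free_out v))"
        unfolding R.Out_eq_insert(1)[OF vN] using R.Out_eq_insert(2) by simp
      ultimately show ?thesis using u w by (simp add: shifted_indegree_def in_degree_def)
    qed
    have K_iff: "k \<in> K \<longleftrightarrow> (\<forall>p. k (Inr p) = 0) \<and> (\<lambda>e. k (Inl e)) \<in> integer_flows (\<lambda>i. int x + u i)" for k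
    proof -
      \<comment> \<open>After reversal the added arcs lead into the sink, where no exponent is
        drawn; only arcs of G can carry one.\<close>
      have support: "(\<forall>e. \<not> (e \<in> arcs ?H \<and> 0 \<le> h e \<and> h e < n + 1) \<longrightarrow> k e = 0)
        \<longleftrightarrow> (\<forall>p. k (Inr p) = 0) \<and> (\<forall>e. e \<notin> arcs G \<longrightarrow> k (Inl e) = 0)"
      proof -
        have "Inl e \<in> arcs ?H \<and> h (Inl e) < n + 1 \<longleftrightarrow> e \<in> arcs G" for e
          using tail_bounds[of e] by (auto simp: source_graph_simps h_def)
        moreover have "\<not> (Inr p \<in> arcs ?H \<and> h (Inr p) < n + 1)" for p
          by (simp add: source_graph_simps h_def)
        ultimately show ?thesis by (metis (no_types, lifting) sum.exhaust zero_le)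
      qed
      show ?thesis
      proof (cases "\<forall>p. k (Inr p) = 0")
        case False
        then show ?thesis unfolding K_def R.exponents_def using support by blast
      next
        case True
        \<comment> \<open>\<open>exponent\<close> uses truncated subtraction, so a zero value alone
          gives only one inequality. The admissibility condition adds the other, and together they
          are the conservation law.\<close>
        have eq: "sum k (R.In v) \<le> card (R.free_out v) + sum k (R.Out v) \<and> R.exponent k v = 0
          \<longleftrightarrow> (\<Sum>e\<in>out_arcs G (n + 1 - v). int (k (Inl e)))
              = int x + u (n + 1 - v) + (\<Sum>e\<in>in_arcs G (n + 1 - v). int (k (Inl e)))"
          if v: "v \<in> {1..n}" for v
        proof -
          have w: "n + 1 - v \<in> {1..n}" "1 \<le> n + 1 - v" using v by auto
          have vN: "v < n + 1" using v by auto
          have "sum k (R.In v) \<le> card (R.free_out v) + sum k (R.Out v) \<and> R.exponent k v = 0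
            \<longleftrightarrow> int (sum k (R.In v)) = int (card (R.free_out v)) + int (sum k (R.Out v))"
            unfolding R.exponent_def by linarith
          then show ?thesis
            unfolding card_free_out[OF v] In[OF vN] Out[OF vN] sum_out[OF w(2)] sum_in[of "n + 1 - v" k, OF w(1) True[rule_format]]
            by simp
        qed
        have "R.In 0 = {}"
          unfolding R.In_def h_def using head_H by fastforce
        then have "k \<in> K \<longleftrightarrow> (\<forall>e. e \<notin> arcs G \<longrightarrow> k (Inl e) = 0) \<and>
          (\<forall>v\<in>{1..n}. sum k (R.In v) \<le> card (R.free_out v) + sum k (R.Out v) \<and> R.exponent k v = 0)"
          unfolding K_def R.exponents_def using support True
          by (auto simp: less_Suc_eq_le) (metis One_nat_def Suc_le_eq atLeastAtMost_iff gr_zeroI sum.empty zero_le)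
        also have "\<dots> \<longleftrightarrow> (\<lambda>e. k (Inl e)) \<in> integer_flows (\<lambda>i. int x + u i)"
        proof -
          let ?Q = "\<lambda>w. (\<Sum>e\<in>out_arcs G w. int (k (Inl e))) = int x + u w + (\<Sum>e\<in>in_arcs G w. int (k (Inl e)))"
          have "(\<forall>v\<in>{1..n}. ?Q (n + 1 - v)) \<longleftrightarrow> (\<forall>w\<in>{1..n}. ?Q w)"
          proof
            assume *: "\<forall>v\<in>{1..n}. ?Q (n + 1 - v)"
            show "\<forall>w\<in>{1..n}. ?Q w"
            proof
              fix w assume "w \<in> {1..n}"
              then have "n + 1 - w \<in> {1..n}" "n + 1 - (n + 1 - w) = w" by auto
              then show "?Q w" using * by metis
            qed
          next
            assume *: "\<forall>w\<in>{1..n}. ?Q w"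
            show "\<forall>v\<in>{1..n}. ?Q (n + 1 - v)"
            proof
              fix v assume "v \<in> {1..n}"
              then have "n + 1 - v \<in> {1..n}" by auto
              then show "?Q (n + 1 - v)" using * by blast
            qed
          qed
          then show ?thesis unfolding integer_flows_def by (simp add: eq)
        qed
        finally show ?thesis using True by simp
      qed
    qed
    show "bij_betw (\<lambda>k e. k (Inl e)) K (integer_flows (\<lambda>i. int x + u i))"
    proof (rule bij_betw_byWitness[where f' = ?ext])
      show "\<forall>k\<in>K. ?ext (\<lambda>e. k (Inl e)) = k"
      proof (intro ballI ext)
        fix k z assume "k \<in> K"
        then show "?ext (\<lambda>e. k (Inl e)) z = k z" unfolding K_iff by (cases z) auto
      qed
    qed (auto simp: K_iff)
  qed
  finally show ?thesis .
qed

end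

text \<open>Two degenerate situations shape the polynomial claim. If m = n and every vertex before
  the last has an outgoing arc, p is a nonzero constant, whereas the polytope for x = 0 is empty and
  E is 0 there. If some vertex before the last has no outgoing arc, E vanishes identically and so
  does the volume of F_G(1,...,1); then p = 0, and the exact degree is asserted only in the opposite
  case.\<close>

theorem theorem8p1:
  fixes G :: "(nat, 'e) pre_digraph" and n m :: nat and u :: "nat \<Rightarrow> int"
  assumes n: "n \<ge> 1"
    and fin: "fin_digraph G"
    and verts: "verts G = {1..n+1}"
    and ordered: "\<forall>e\<in>arcs G. tail G e < head G e"
    and conn: "Digraph_Component.connected G"
    and m: "m = card (arcs G)"
    and u: "\<forall>i\<in>{1..n}. u i = shifted_indegree G i"
  shows "(\<forall>x. E_poly n G x =
            real (kostant G (\<lambda>i. if i \<le> n then int x + u i else - int x * int n - (\<Sum>k=1..n. u k)))) \<and>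
         (\<exists>p :: real poly.
            (\<forall>x. 0 < x \<or> n < m \<longrightarrow> E_poly n G x = poly p (real x)) \<and>
            degree p \<le> m - n \<and>
            (\<forall>k. 0 \<le> coeff p k) \<and>
            coeff p (m - n) = flow_volume G (\<lambda>_. 1) / fact (m - n) \<and>
            ((\<forall>i\<in>{1..n}. out_arcs G i \<noteq> {}) \<longrightarrow> p \<noteq> 0 \<and> degree p = m - n))"
proof -
  interpret ordered_digraph G n
    using fin verts ordered by (auto simp: ordered_digraph_def ordered_digraph_axioms_def)
  let ?v = "\<lambda>x i. if i \<le> n then int x + u i else - int x * int n - (\<Sum>k=1..n. u k)"
  let ?K = "\<lambda>x. integer_flows (\<lambda>i. int x + u i)"
  have kostant: "kostant G (?v x) = card (?K x)" for x
  proof -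
    have "(\<Sum>i=1..n. ?v x i) = (\<Sum>i=1..n. int x + u i)" by (rule sum.cong) auto
    then have "?v x (n + 1) = - (\<Sum>i=1..n. ?v x i)" by (simp add: sum.distrib mult.commute)
    then have "kostant G (?v x) = card (integer_flows (?v x))"
      by (rule kostant_eq_card_integer_flows)
    also have "integer_flows (?v x) = ?K x"
      unfolding integer_flows_def by (intro Collect_cong conj_cong ball_cong refl) auto
    finally show ?thesis .
  qed
  \<comment> \<open>Since n >= 1, every vertex has a partner to be connected with. This supplies an
    arc into n + 1, and an incoming arc at any vertex without outgoing ones.\<close>
  have incident: "out_arcs G i \<noteq> {} \<or> in_arcs G i \<noteq> {}" if "i \<in> {1..n + 1}" for i
    using connected_incident[OF conn, of i "if i = 1 then n + 1 else 1"] that n verts by auto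
  have "out_arcs G (n + 1) = {}" using tail_bounds by (force simp: out_arcs_def)
  then have top: "in_arcs G (n + 1) \<noteq> {}" using incident[of "n + 1"] by simp
  have K0: "?K 0 = {}" using integer_flows_0[OF n u refl] by simp
  have E: "E_poly n G x = real (card (?K x))" for x
  proof (cases "x = 0")
    case True
    then show ?thesis using K0 E_poly_0 by simp
  next
    case False
    then show ?thesis using E_poly_eq_card_integer_flows[OF u _ top] by simp
  qed
  have "\<exists>p :: real poly.
            (\<forall>x. 0 < x \<or> n < m \<longrightarrow> E_poly n G x = poly p (real x)) \<and>
            degree p \<le> m - n \<and>
            (\<forall>k. 0 \<le> coeff p k) \<and>
            coeff p (m - n) = flow_volume G (\<lambda>_. 1) / fact (m - n) \<and>
            ((\<forall>i\<in>{1..n}. out_arcs G i \<noteq> {}) \<longrightarrow> p \<noteq> 0 \<and> degree p = m - n)"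
  proof (cases "\<forall>i\<in>{1..n}. out_arcs G i \<noteq> {}")
    case False
    then obtain i where i: "i \<in> {1..n}" "out_arcs G i = {}" by auto
    have "E_poly n G x = 0" for x
    proof (cases "x = 0")
      case True
      then show ?thesis by (simp add: E_poly_0)
    next
      case False
      then have "?K x = {}" using incident[of i] i by (intro integer_flows_no_out[OF u _ i]) auto
      then show ?thesis by (simp add: E)
    qed
    then show ?thesis using False flow_volume_no_out[OF i] by (intro exI[of _ 0]) simp
  next
    case True
    obtain K :: "('e \<Rightarrow> nat) set" and j where
      K: "finite K" "K \<noteq> {}" "\<And>k. k \<in> K \<Longrightarrow> (\<Sum>v<n. j k v) = m - n"
      and card_K: "\<And>x. 1 \<le> x \<Longrightarrow> real (card (?K x)) = (\<Sum>k\<in>K. \<Prod>v<n. multichoose (j k v) (int x))"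
      and vol: "flow_volume G (\<lambda>_. 1) = fact (m - n) * (\<Sum>k\<in>K. \<Prod>v<n. 1 / fact (j k v))"
      using lidskii_expansion[OF True u] unfolding m[symmetric] by metis
    define p where "p = (\<Sum>k\<in>K. \<Prod>v<n. multichoose_poly (j k v))"
    note p = sum_prod_multichoose_poly[where K = K and n = n and j = j and d = "m - n", OF K, folded p_def]
    have "E_poly n G x = poly p (real x)" if x: "0 < x \<or> n < m" for x
    proof (cases "x = 0")
      case False
      then show ?thesis using card_K[of x] by (simp add: E p(1))
    next
      case x0: True
      \<comment> \<open>For m > n the exponents have positive sum, so some factor is a multichoose
        coefficient of positive degree at 0, which vanishes. Hence p agrees with E at x = 0
        too.\<close>
      have "(\<Prod>v<n. multichoose (j k v) 0) = 0" if k: "k \<in> K" for k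
      proof -
        have "(\<Sum>v<n. j k v) \<noteq> 0" using K(3)[OF k] x x0 by simp
        then obtain v where "v < n" "j k v \<noteq> 0" by (metis lessThan_iff sum.neutral)
        then show ?thesis by (intro prod_zero) (auto simp: multichoose_zero)
      qed
      then have "(\<Sum>k\<in>K. \<Prod>v<n. multichoose (j k v) 0) = 0" by (intro sum.neutral ballI)
      then show ?thesis using x0 K0 p(1)[of 0] by (simp add: E)
    qed
    then show ?thesis
      using p(2-5) vol by (intro exI[of _ p]) auto
  qed
  then show ?thesis using E kostant by simp
qed

end
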